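(* Let $D=(V,E)$ be a finite digraph. The algebra $H\mathfrak{X}^1$ arising from the differential calculus of $D$ is isomorphic to the quotient of the path algebra $\mathbb{K}D^{\mathrm{db}}$ of the double of $D$ by the following relations, where the generators of $\mathbb{K}D^{\mathrm{db}}$ correspond to the elements of $H\mathfrak{X}^1$ $$u_{p,q}=f_p\bullet\overline{f_q},\quad L^{ab}_{cd}=-\overline{f_d}\bullet e_{b\leftarrow a}\bullet\overline{f_c},\quad R^{ab}_{cd}=f_a\bullet\overline{e_{d\leftarrow c}}\bullet f_b,$$ $$L^{ab}_{q}=\overline{f_q}\bullet e_{b\leftarrow a}\bullet\overline{f_q}-f_b\bullet\overline{f_q},\quad R^{p}_{cd}=f_p\bullet\overline{e_{d\leftarrow c}}\bullet f_p+f_p\bullet\overline{f_c}:$$ for all $q\in V$, all $s\to t\in E$, all pairs $a\to b,\ p\to b\in E$ (in the first line) and all pairs $d\to a,\ d\to p\in E$ (in the second line), $$\sum_{i:\,q\to i\in E}R^{ab}_{qi}\bullet L^{pb}_{qi}=\delta_{a,p}\,u_{a,q},\qquad \sum_{i:\,q\to i\in E}R^{qi}_{ab}\bullet L^{qi}_{pb}=\delta_{a,p}\,u_{q,a},$$ $$\sum_{i:\,i\to q\in E}L^{da}_{iq}\bullet R^{dp}_{iq}=\delta_{a,p}\,u_{a,q},\qquad \sum_{i:\,i\to q\in E}L^{iq}_{da}\bullet R^{iq}_{dp}=\delta_{a,p}\,u_{q,a},$$ $$R^{q}_{st}=\sum_{i:\,q\to i\in E}R^{qi}_{st}\bullet L^{qi}_{t},\qquad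 L^{st}_{q}=\sum_{i:\,i\to q\in E}L^{st}_{iq}\bullet R^{s}_{iq}.$$
   Context: $\mathbb{K}$ is a field. A digraph $D=(V,E)$ has a finite vertex set $V$ and a set of edges $E$; no edge has equal source and target, and an edge is determined by its source and target; write $a\to b\in E$. **Double of $D$.** $D^{\mathrm{db}}$ is the quiver with vertex set $V\times V$ and the following (pairwise distinct) arrows: for every pair $a\to b,\ c\to d\in E$, an arrow $L^{ab}_{cd}$ from $(a,c)$ to $(b,d)$ and an arrow $R^{ab}_{cd}$ from $(b,d)$ to $(a,c)$; for every $a\to b\in E$ and $c\in V$ an arrow $L^{ab}_{c}$ from $(a,c)$ to $(b,c)$; for every $c\to d\in E$ and $a\in V$ an arrow $R^{a}_{cd}$ from $(a,d)$ to $(a,c)$. In the path algebra $\mathbb{K}D^{\mathrm{db}}$, $u_{p,q}$ is the idempotent of the vertex $(p,q)$, and paths compose from right to left: $u_{p,q}\bullet\alpha\bullet u_{p',q'}=\alpha$ if $\alpha$ is an arrow from $(p',q')$ to $(p,q)$, and $\alpha\bullet\beta=0$ unless the source of $\alpha$ is the target of $\beta$. **Digraph calculus.** $A=\mathbb{K}(V)$ with basis of idempotents $f_p$ ($p\in V$). $\Omega^1$ has basis $\omega_{a\to b}$ ($a\to b\in E$), with $f_p\omega_{a\to b}f_q=\delta_{p,a}\delta_{q,b}\omega_{a\to b}$, and $df_p=\sum_{a:a\to p\in E}\omega_{a\to p}-\sum_{b:p\to b\in E}\omega_{p\to b}$. $\mathfrak{X}^1$ has basis $e_{b\leftarrow a}$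 ($a\to b\in E$) with $f_pe_{b\leftarrow a}f_q=\delta_{p,b}\delta_{a,q}e_{b\leftarrow a}$. $\mathrm{ev}(e_{b\leftarrow a}\otimes\omega_{p\to q})=\delta_{p,a}\delta_{q,b}f_b$, $\underline{\mathrm{ev}}(\omega_{p\to q}\otimes e_{b\leftarrow a})=\delta_{p,a}\delta_{q,b}f_a$; $\mathrm{coev}(1)=\sum_{a\to b\in E}\omega_{a\to b}\otimes e_{b\leftarrow a}=\sum_{a\to b\in E} d(-f_a)\otimes e_{b\leftarrow a}$ and $\underline{\mathrm{coev}}(1)=\sum_{a\to b\in E} e_{b\leftarrow a}\otimes\omega_{a\to b}=\sum_{a\to b\in E} e_{b\leftarrow a}\otimes df_b$. Write $\mathrm{coev}(1)=\sum_i db_i\otimes x_i$ and $\underline{\mathrm{coev}}(1)=\sum_j y_j\otimes dc_j$ for these (so $i,j$ run over $E$). Repeated indices $i,j$ are summed. **$H\mathfrak{X}^1$** (presentation for surjective calculi): the $\mathbb{K}$-algebra (product $\bullet$, commutator $[\cdot,\cdot]$) generated by $A$, by $A^{\mathrm{op}}$ (elements $\overline a$, $\overline a\bullet\overline b=\overline{ba}$), and by two copies of the vector space $\mathfrak{X}^1$ (elements $x$ and $\overline x$), with relations, for $a,b\in A$, $x\in\mathfrak{X}^1$: $a\bullet\overline b=\overline b\bullet a$; $a\bullet x=ax$; $x\bullet a=xa+\mathrm{ev}(x\otimes da)$; $\overline a\bullet\overline x=\overline{xa}$; $\overline x\bullet\overline a=\overline{ax}+\overline{\underline{\mathrm{ev}}(da\otimes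 x)}$; $\sum_m\overline{s_m}\bullet x\bullet\overline{r_m}=0$ and $\sum_m r_m\bullet\overline x\bullet s_m=0$ whenever $\sum_m r_m\otimes s_m\in A\otimes_{\mathbb K}A$ satisfies $\sum r_ms_m=0$ and $\sum r_m\,ds_m=0$ in $\Omega^1$; $[\overline x,b_i]\bullet x_i=\overline x$; $[x,\overline{c_j}]\bullet\overline{y_j}=x$; $[y_j,\overline a]\bullet[\overline x,c_j]=\overline{\mathrm{ev}(x\otimes da)}$; $[\overline{x_i},a]\bullet[x,\overline{b_i}]=\underline{\mathrm{ev}}(da\otimes x)$. (It carries a Hopf algebroid structure over $A$.) *)

theory Defs
  imports
    "HOL-Algebra.QuotRing"
    "HOL-Algebra.Module"
    "HOL-Library.Poly_Mapping"
    "HOL-Library.Function_Algebras"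
    "Graph_Theory.Pair_Digraph"
begin

section \<open>Algebras over a field, their quotients and isomorphisms\<close>

text \<open>
  The scalars form a type \<open>'k\<close> of class \<open>field\<close>; algebras are records of type
  \<open>('k, 'a) module\<close> of HOL-Algebra, i.e. rings with a scalar multiplication.
\<close>

definition quot_alg :: "('k, 'a) module \<Rightarrow> 'a set \<Rightarrow> ('k, 'a set) module" where
  "quot_alg R I =
     \<lparr>carrier = carrier (R Quot I), monoid.mult = monoid.mult (R Quot I), one = one (R Quot I),
      zero = zero (R Quot I), add = add (R Quot I),
      smult = (\<lambda>c X. \<Union>x\<in>X. I +>\<^bsub>R\<^esub> (c \<odot>\<^bsub>R\<^esub> x))\<rparr>"

definition alg_iso :: "('k, 'a) module \<Rightarrow> ('k, 'b) module \<Rightarrow> ('a \<Rightarrow> 'b) set" where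
  "alg_iso R S =
     {h \<in> ring_iso R S. \<forall>c. \<forall>x\<in>carrier R. h (c \<odot>\<^bsub>R\<^esub> x) = c \<odot>\<^bsub>S\<^esub> h x}"

text \<open>
  The algebra with basis \<open>B\<close> whose product is given on basis elements by a partial
  operation \<open>c\<close> (the value \<open>None\<close> stands for the product \<open>0\<close>) and whose unit is the sum of
  the finitely many elements of \<open>U\<close>.
\<close>

definition basis_mult ::
    "('p \<Rightarrow> 'p \<Rightarrow> 'p option) \<Rightarrow> ('p \<Rightarrow>\<^sub>0 'k::field) \<Rightarrow> ('p \<Rightarrow>\<^sub>0 'k) \<Rightarrow> ('p \<Rightarrow>\<^sub>0 'k)" where
  "basis_mult c x y =
     (\<Sum>p\<in>Poly_Mapping.keys x. \<Sum>q\<in>Poly_Mapping.keys y.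
        case c p q of None \<Rightarrow> 0 | Some r \<Rightarrow> Poly_Mapping.single r (Poly_Mapping.lookup x p * Poly_Mapping.lookup y q))"

definition basis_smult :: "'k::field \<Rightarrow> ('p \<Rightarrow>\<^sub>0 'k) \<Rightarrow> ('p \<Rightarrow>\<^sub>0 'k)" where
  "basis_smult k x = Poly_Mapping.map ((*) k) x"

definition basis_alg ::
    "'p set \<Rightarrow> ('p \<Rightarrow> 'p \<Rightarrow> 'p option) \<Rightarrow> 'p set \<Rightarrow> ('k::field, 'p \<Rightarrow>\<^sub>0 'k) module" where
  "basis_alg B c U =
     \<lparr>carrier = {x. Poly_Mapping.keys x \<subseteq> B}, monoid.mult = basis_mult c,
      one = (\<Sum>u\<in>U. Poly_Mapping.single u 1), zero = 0, add = (+), smult = basis_smult\<rparr>"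

subsection \<open>Free algebras\<close>

definition free_alg :: "'g set \<Rightarrow> ('k::field, 'g list \<Rightarrow>\<^sub>0 'k) module" where
  "free_alg G = basis_alg (lists G) (\<lambda>v w. Some (v @ w)) {[]}"

definition free_mult ::
    "('g list \<Rightarrow>\<^sub>0 'k::field) \<Rightarrow> ('g list \<Rightarrow>\<^sub>0 'k) \<Rightarrow> ('g list \<Rightarrow>\<^sub>0 'k)"  (infixl "\<bullet>" 70) where
  "x \<bullet> y = basis_mult (\<lambda>v w. Some (v @ w)) x y"

definition free_comm :: "('g list \<Rightarrow>\<^sub>0 'k::field) \<Rightarrow> ('g list \<Rightarrow>\<^sub>0 'k) \<Rightarrow> ('g list \<Rightarrow>\<^sub>0 'k)" where
  "free_comm x y = x \<bullet> y - y \<bullet> x"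

definition free_gen :: "'g \<Rightarrow> ('g list \<Rightarrow>\<^sub>0 'k::field)" where
  "free_gen g = Poly_Mapping.single [g] 1"

definition free_one :: "'g list \<Rightarrow>\<^sub>0 'k::field" where
  "free_one = Poly_Mapping.single [] 1"

subsection \<open>Path algebras\<close>

text \<open>
  A quiver is a \<open>pre_digraph\<close>. A path is a triple \<open>(u, p, v)\<close> of its source, the list of its
  arrows in the order in which they are traversed, and its target. Paths compose from
  right to left, so the arrows of the right factor come first in the list.
\<close>

type_synonym ('a, 'b) qpath = "'a \<times> 'b list \<times> 'a"

definition path_comp :: "('a, 'b) qpath \<Rightarrow> ('a, 'b) qpath \<Rightarrow> ('a, 'b) qpath option" where
  "path_comp = (\<lambda>(u, p, v) (u', p', v'). if u = v' then Some (u', p' @ p, v) else None)"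

definition path_alg ::
    "('a, 'b) pre_digraph \<Rightarrow> ('k::field, ('a, 'b) qpath \<Rightarrow>\<^sub>0 'k) module" where
  "path_alg Q =
     basis_alg {(u, p, v). pre_digraph.awalk Q u p v} path_comp ((\<lambda>v. (v, [], v)) ` verts Q)"

definition path_mult ::
    "(('a, 'b) qpath \<Rightarrow>\<^sub>0 'k::field) \<Rightarrow> (('a, 'b) qpath \<Rightarrow>\<^sub>0 'k) \<Rightarrow> (('a, 'b) qpath \<Rightarrow>\<^sub>0 'k)"
    (infixl "\<bullet>\<^sub>p" 70) where
  "x \<bullet>\<^sub>p y = basis_mult path_comp x y"

definition vertex_idem :: "'a \<Rightarrow> (('a, 'b) qpath \<Rightarrow>\<^sub>0 'k::field)" where
  "vertex_idem v = Poly_Mapping.single (v, [], v) 1"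

definition arrow_elt :: "('a, 'b) pre_digraph \<Rightarrow> 'b \<Rightarrow> (('a, 'b) qpath \<Rightarrow>\<^sub>0 'k::field)" where
  "arrow_elt Q e = Poly_Mapping.single (tail Q e, [e], head Q e) 1"

section \<open>The double of a digraph\<close>

text \<open>
  \<open>L2 a b c d\<close>, \<open>R2 a b c d\<close>, \<open>L1 a b q\<close>, \<open>R1 p c d\<close> are the arrows written
  $L^{ab}_{cd}$, $R^{ab}_{cd}$, $L^{ab}_{q}$, $R^{p}_{cd}$.
\<close>

datatype 'v dbl_arrow = L2 'v 'v 'v 'v | R2 'v 'v 'v 'v | L1 'v 'v 'v | R1 'v 'v 'v

primrec dbl_tail :: "'v dbl_arrow \<Rightarrow> 'v \<times> 'v" where
  "dbl_tail (L2 a b c d) = (a, c)"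
| "dbl_tail (R2 a b c d) = (b, d)"
| "dbl_tail (L1 a b q) = (a, q)"
| "dbl_tail (R1 p c d) = (p, d)"

primrec dbl_head :: "'v dbl_arrow \<Rightarrow> 'v \<times> 'v" where
  "dbl_head (L2 a b c d) = (b, d)"
| "dbl_head (R2 a b c d) = (a, c)"
| "dbl_head (L1 a b q) = (b, q)"
| "dbl_head (R1 p c d) = (p, c)"

definition double :: "'v pair_pre_digraph \<Rightarrow> ('v \<times> 'v, 'v dbl_arrow) pre_digraph" where
  "double D =
     \<lparr>verts = pverts D \<times> pverts D,
      arcs = {L2 a b c d | a b c d. (a, b) \<in> parcs D \<and> (c, d) \<in> parcs D}
           \<union> {R2 a b c d | a b c d. (a, b) \<in> parcs D \<and> (c, d) \<in> parcs D}
           \<union> {L1 a b q | a b q. (a, b) \<in> parcs D \<and> q \<in> pverts D}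
           \<union> {R1 p c d | p c d. p \<in> pverts D \<and> (c, d) \<in> parcs D},
      tail = dbl_tail, head = dbl_head\<rparr>"

type_synonym ('v, 'k) dbl_elt = "('v \<times> 'v, 'v dbl_arrow) qpath \<Rightarrow>\<^sub>0 'k"

definition u_elt :: "'v \<Rightarrow> 'v \<Rightarrow> ('v, 'k::field) dbl_elt" where
  "u_elt p q = vertex_idem (p, q)"

definition L2_elt :: "'v pair_pre_digraph \<Rightarrow> 'v \<times> 'v \<Rightarrow> 'v \<times> 'v \<Rightarrow> ('v, 'k::field) dbl_elt" where
  "L2_elt D = (\<lambda>(a, b) (c, d). arrow_elt (double D) (L2 a b c d))"

definition R2_elt :: "'v pair_pre_digraph \<Rightarrow> 'v \<times> 'v \<Rightarrow> 'v \<times> 'v \<Rightarrow> ('v, 'k::field) dbl_elt" where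
  "R2_elt D = (\<lambda>(a, b) (c, d). arrow_elt (double D) (R2 a b c d))"

definition L1_elt :: "'v pair_pre_digraph \<Rightarrow> 'v \<times> 'v \<Rightarrow> 'v \<Rightarrow> ('v, 'k::field) dbl_elt" where
  "L1_elt D = (\<lambda>(a, b) q. arrow_elt (double D) (L1 a b q))"

definition R1_elt :: "'v pair_pre_digraph \<Rightarrow> 'v \<Rightarrow> 'v \<times> 'v \<Rightarrow> ('v, 'k::field) dbl_elt" where
  "R1_elt D = (\<lambda>p (c, d). arrow_elt (double D) (R1 p c d))"

text \<open>The relations are pairs of a left- and a right-hand side.\<close>

inductive dbl_rel ::
    "'v pair_pre_digraph \<Rightarrow> ('v, 'k::field) dbl_elt \<Rightarrow> ('v, 'k) dbl_elt \<Rightarrow> bool"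
  for D :: "'v pair_pre_digraph" where
  RL_lower: "q \<in> pverts D \<Longrightarrow> (a, b) \<in> parcs D \<Longrightarrow> (p, b) \<in> parcs D \<Longrightarrow>
     dbl_rel D (\<Sum>i | (q, i) \<in> parcs D. R2_elt D (a, b) (q, i) \<bullet>\<^sub>p L2_elt D (p, b) (q, i))
               (if a = p then u_elt a q else 0)"
| RL_upper: "q \<in> pverts D \<Longrightarrow> (a, b) \<in> parcs D \<Longrightarrow> (p, b) \<in> parcs D \<Longrightarrow>
     dbl_rel D (\<Sum>i | (q, i) \<in> parcs D. R2_elt D (q, i) (a, b) \<bullet>\<^sub>p L2_elt D (q, i) (p, b))
               (if a = p then u_elt q a else 0)"
| LR_lower: "q \<in> pverts D \<Longrightarrow> (d, a) \<in> parcs D \<Longrightarrow> (d, p) \<in> parcs D \<Longrightarrow>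
     dbl_rel D (\<Sum>i | (i, q) \<in> parcs D. L2_elt D (d, a) (i, q) \<bullet>\<^sub>p R2_elt D (d, p) (i, q))
               (if a = p then u_elt a q else 0)"
| LR_upper: "q \<in> pverts D \<Longrightarrow> (d, a) \<in> parcs D \<Longrightarrow> (d, p) \<in> parcs D \<Longrightarrow>
     dbl_rel D (\<Sum>i | (i, q) \<in> parcs D. L2_elt D (i, q) (d, a) \<bullet>\<^sub>p R2_elt D (i, q) (d, p))
               (if a = p then u_elt q a else 0)"
| R1: "q \<in> pverts D \<Longrightarrow> (s, t) \<in> parcs D \<Longrightarrow>
     dbl_rel D (R1_elt D q (s, t))
               (\<Sum>i | (q, i) \<in> parcs D. R2_elt D (q, i) (s, t) \<bullet>\<^sub>p L1_elt D (q, i) t)"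
| L1: "q \<in> pverts D \<Longrightarrow> (s, t) \<in> parcs D \<Longrightarrow>
     dbl_rel D (L1_elt D (s, t) q)
               (\<Sum>i | (i, q) \<in> parcs D. L2_elt D (s, t) (i, q) \<bullet>\<^sub>p R1_elt D s (i, q))"

definition dbl_ideal :: "'v pair_pre_digraph \<Rightarrow> ('v, 'k::field) dbl_elt set" where
  "dbl_ideal D = genideal (path_alg (double D)) {l - r | l r. dbl_rel D l r}"

definition dbl_quot :: "'v pair_pre_digraph \<Rightarrow> ('k::field, ('v, 'k) dbl_elt set) module" where
  "dbl_quot D = quot_alg (path_alg (double D)) (dbl_ideal D)"

definition dbl_cls :: "'v pair_pre_digraph \<Rightarrow> ('v, 'k::field) dbl_elt \<Rightarrow> ('v, 'k) dbl_elt set" where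
  "dbl_cls D x = dbl_ideal D +>\<^bsub>path_alg (double D)\<^esub> x"

section \<open>The differential calculus of a digraph\<close>

text \<open>
  The spaces $A$, $\Omega^1$ and $\mathfrak{X}^1$ are given by coordinates: their elements are
  the functions with values in \<open>'k\<close> on the basis, extended by \<open>0\<close>. The arc \<open>(a, b)\<close> indexes
  the basis element $\omega_{a\to b}$ of $\Omega^1$ and the basis element $e_{b\leftarrow a}$
  of $\mathfrak{X}^1$.
\<close>

definition coord_space :: "'i set \<Rightarrow> ('i \<Rightarrow> 'k::field) set" where
  "coord_space S = {f. \<forall>i. i \<notin> S \<longrightarrow> f i = 0}"

definition basis_vec :: "'i \<Rightarrow> 'i \<Rightarrow> 'k::field" where
  "basis_vec i = (\<lambda>j. if j = i then 1 else 0)"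

definition scale :: "'k::field \<Rightarrow> ('i \<Rightarrow> 'k) \<Rightarrow> ('i \<Rightarrow> 'k)" where
  "scale k f = (\<lambda>i. k * f i)"

abbreviation fun_A :: "'v pair_pre_digraph \<Rightarrow> ('v \<Rightarrow> 'k::field) set" where
  "fun_A D \<equiv> coord_space (pverts D)"

abbreviation forms :: "'v pair_pre_digraph \<Rightarrow> ('v \<times> 'v \<Rightarrow> 'k::field) set" where
  "forms D \<equiv> coord_space (parcs D)"

abbreviation vfields :: "'v pair_pre_digraph \<Rightarrow> ('v \<times> 'v \<Rightarrow> 'k::field) set" where
  "vfields D \<equiv> coord_space (parcs D)"

definition one_A :: "'v pair_pre_digraph \<Rightarrow> 'v \<Rightarrow> 'k::field" where
  "one_A D = (\<lambda>v. if v \<in> pverts D then 1 else 0)"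

abbreviation f_vec :: "'v \<Rightarrow> 'v \<Rightarrow> 'k::field" where
  "f_vec p \<equiv> basis_vec p"

abbreviation omega_vec :: "'v \<Rightarrow> 'v \<Rightarrow> 'v \<times> 'v \<Rightarrow> 'k::field" where
  "omega_vec a b \<equiv> basis_vec (a, b)"

abbreviation e_vec :: "'v \<Rightarrow> 'v \<Rightarrow> 'v \<times> 'v \<Rightarrow> 'k::field" where
  "e_vec b a \<equiv> basis_vec (a, b)"

definition form_lact :: "('v \<Rightarrow> 'k::field) \<Rightarrow> ('v \<times> 'v \<Rightarrow> 'k) \<Rightarrow> ('v \<times> 'v \<Rightarrow> 'k)" where
  "form_lact f w = (\<lambda>(a, b). f a * w (a, b))"

definition form_ract :: "('v \<times> 'v \<Rightarrow> 'k::field) \<Rightarrow> ('v \<Rightarrow> 'k) \<Rightarrow> ('v \<times> 'v \<Rightarrow> 'k)" where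
  "form_ract w f = (\<lambda>(a, b). w (a, b) * f b)"

definition vf_lact :: "('v \<Rightarrow> 'k::field) \<Rightarrow> ('v \<times> 'v \<Rightarrow> 'k) \<Rightarrow> ('v \<times> 'v \<Rightarrow> 'k)" where
  "vf_lact f x = (\<lambda>(a, b). f b * x (a, b))"

definition vf_ract :: "('v \<times> 'v \<Rightarrow> 'k::field) \<Rightarrow> ('v \<Rightarrow> 'k) \<Rightarrow> ('v \<times> 'v \<Rightarrow> 'k)" where
  "vf_ract x f = (\<lambda>(a, b). x (a, b) * f a)"

definition ext_d :: "'v pair_pre_digraph \<Rightarrow> ('v \<Rightarrow> 'k::field) \<Rightarrow> ('v \<times> 'v \<Rightarrow> 'k)" where
  "ext_d D f = (\<lambda>(a, b). if (a, b) \<in> parcs D then f b - f a else 0)"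

definition ev :: "'v pair_pre_digraph \<Rightarrow> ('v \<times> 'v \<Rightarrow> 'k::field) \<Rightarrow> ('v \<times> 'v \<Rightarrow> 'k) \<Rightarrow> ('v \<Rightarrow> 'k)" where
  "ev D x w = (\<lambda>b. \<Sum>a | (a, b) \<in> parcs D. x (a, b) * w (a, b))"

definition ev_u :: "'v pair_pre_digraph \<Rightarrow> ('v \<times> 'v \<Rightarrow> 'k::field) \<Rightarrow> ('v \<times> 'v \<Rightarrow> 'k) \<Rightarrow> ('v \<Rightarrow> 'k)" where
  "ev_u D w x = (\<lambda>a. \<Sum>b | (a, b) \<in> parcs D. w (a, b) * x (a, b))"

text \<open>
  $\mathrm{coev}(1)=\sum_i db_i\otimes x_i$ and $\underline{\mathrm{coev}}(1)=\sum_j y_j\otimes dc_j$,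
  both indexed by the arcs, with $b_{a\to b}=-f_a$, $x_{a\to b}=y_{a\to b}=e_{b\leftarrow a}$
  and $c_{a\to b}=f_b$.
\<close>

definition coev_b :: "'v \<times> 'v \<Rightarrow> 'v \<Rightarrow> 'k::field" where
  "coev_b i = - f_vec (fst i)"

definition coev_x :: "'v \<times> 'v \<Rightarrow> 'v \<times> 'v \<Rightarrow> 'k::field" where
  "coev_x i = e_vec (snd i) (fst i)"

definition coev_y :: "'v \<times> 'v \<Rightarrow> 'v \<times> 'v \<Rightarrow> 'k::field" where
  "coev_y j = e_vec (snd j) (fst j)"

definition coev_c :: "'v \<times> 'v \<Rightarrow> 'v \<Rightarrow> 'k::field" where
  "coev_c j = f_vec (snd j)"

subsection \<open>Agreement with the formulas on bases\<close>

lemma form_bimodule_basis: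
  "form_ract (form_lact (f_vec p) (omega_vec a b)) (f_vec q)
     = (if p = a \<and> q = b then omega_vec a b else 0)"
  by (auto simp: form_ract_def form_lact_def basis_vec_def fun_eq_iff)

lemma vf_bimodule_basis:
  "vf_ract (vf_lact (f_vec p) (e_vec b a)) (f_vec q)
     = (if p = b \<and> a = q then e_vec b a else 0)"
  by (auto simp: vf_ract_def vf_lact_def basis_vec_def fun_eq_iff)

lemma (in pair_digraph) finite_in_nbrs: "finite {a. (a, p) \<in> parcs G}"
  by (rule finite_subset[OF _ pair_finite_verts]) (auto dest: in_arcsD1)

lemma (in pair_digraph) finite_out_nbrs: "finite {b. (p, b) \<in> parcs G}"
  by (rule finite_subset[OF _ pair_finite_verts]) (auto dest: in_arcsD2)

lemma sum_fun_apply: "(\<Sum>i\<in>I. g i) x = (\<Sum>i\<in>I. g i x)"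
  for g :: "'i \<Rightarrow> 'a \<Rightarrow> 'b::comm_monoid_add"
  by (induction I rule: infinite_finite_induct) auto

lemma ext_d_add: "ext_d D (f + g) = ext_d D f + ext_d D g"
  by (auto simp: ext_d_def fun_eq_iff)

lemma ext_d_scale: "ext_d D (scale k f) = scale k (ext_d D f)"
  by (auto simp: ext_d_def scale_def fun_eq_iff algebra_simps)

lemma (in pair_digraph) ext_d_basis:
  "ext_d G (f_vec p) = (\<Sum>a | (a, p) \<in> parcs G. omega_vec a p)
                     - (\<Sum>b | (p, b) \<in> parcs G. omega_vec p b :: 'a \<times> 'a \<Rightarrow> 'k::field)"
proof (rule ext, clarify)
  fix s t
  have 1: "(\<Sum>a | (a, p) \<in> parcs G. omega_vec a p (s, t) :: 'k)
             = (if t = p \<and> (s, p) \<in> parcs G then 1 else 0)"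
    by (cases "t = p") (simp_all add: basis_vec_def finite_in_nbrs)
  have 2: "(\<Sum>b | (p, b) \<in> parcs G. omega_vec p b (s, t) :: 'k)
             = (if s = p \<and> (p, t) \<in> parcs G then 1 else 0)"
    by (cases "s = p") (simp_all add: basis_vec_def finite_out_nbrs)
  show "ext_d G (f_vec p) (s, t) = ((\<Sum>a | (a, p) \<in> parcs G. omega_vec a p)
                     - (\<Sum>b | (p, b) \<in> parcs G. omega_vec p b :: 'a \<times> 'a \<Rightarrow> 'k)) (s, t)"
    unfolding minus_apply sum_fun_apply 1 2 by (auto simp: ext_d_def basis_vec_def)
qed

lemma (in pair_digraph) ev_basis:
  assumes "(a, b) \<in> parcs G" "(p, q) \<in> parcs G"
  shows "ev G (e_vec b a) (omega_vec p q) = (if p = a \<and> q = b then f_vec b else 0)"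
proof -
  have "(\<Sum>s | (s, t) \<in> parcs G. e_vec b a (s, t) * omega_vec p q (s, t) :: 'k::field)
          = (\<Sum>s | (s, t) \<in> parcs G. if s = a then (if t = b \<and> p = a \<and> q = b then 1 else 0) else 0)" for t
    by (rule sum.cong) (auto simp: basis_vec_def)
  note eq = this
  show ?thesis
    using assms unfolding ev_def eq by (auto simp: fun_eq_iff finite_in_nbrs basis_vec_def)
qed

lemma (in pair_digraph) ev_u_basis:
  assumes "(a, b) \<in> parcs G" "(p, q) \<in> parcs G"
  shows "ev_u G (omega_vec p q) (e_vec b a) = (if p = a \<and> q = b then f_vec a else 0)"
proof -
  have "(\<Sum>t | (s, t) \<in> parcs G. omega_vec p q (s, t) * e_vec b a (s, t) :: 'k::field)
          = (\<Sum>t | (s, t) \<in> parcs G. if t = b then (if s = a \<and> p = a \<and> q = b then 1 else 0) else 0)" for s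
    by (rule sum.cong) (auto simp: basis_vec_def)
  note eq = this
  show ?thesis
    using assms unfolding ev_u_def eq by (auto simp: fun_eq_iff finite_out_nbrs basis_vec_def)
qed

text \<open>
  Since $e_{b\leftarrow a}=f_b e_{b\leftarrow a}=e_{b\leftarrow a}f_a$, the next two facts say that
  $d(-f_a)\otimes e_{b\leftarrow a}=\omega_{a\to b}\otimes e_{b\leftarrow a}$ and
  $e_{b\leftarrow a}\otimes df_b=e_{b\leftarrow a}\otimes\omega_{a\to b}$ over $A$.
\<close>

lemma (in pair_digraph) coev_b_basis:
  assumes "(a, b) \<in> parcs G"
  shows "form_ract (ext_d G (coev_b (a, b))) (f_vec b) = omega_vec a b"
  using assms pair_no_loops[OF assms]
  by (auto simp: form_ract_def ext_d_def coev_b_def basis_vec_def fun_eq_iff)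

lemma (in pair_digraph) coev_c_basis:
  assumes "(a, b) \<in> parcs G"
  shows "form_lact (f_vec a) (ext_d G (coev_c (a, b))) = omega_vec a b"
  using assms pair_no_loops[OF assms]
  by (auto simp: form_lact_def ext_d_def coev_c_def basis_vec_def fun_eq_iff)

section \<open>The algebra generated by \<open>A\<close>, its opposite and two copies of the vector fields\<close>

datatype ('v, 'k) hx_gen =
    GA "'v \<Rightarrow> 'k" | GAbar "'v \<Rightarrow> 'k" | GX "'v \<times> 'v \<Rightarrow> 'k" | GXbar "'v \<times> 'v \<Rightarrow> 'k"

definition hx_gens :: "'v pair_pre_digraph \<Rightarrow> ('v, 'k::field) hx_gen set" where
  "hx_gens D = GA ` fun_A D \<union> GAbar ` fun_A D \<union> GX ` vfields D \<union> GXbar ` vfields D"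

type_synonym ('v, 'k) hx_elt = "('v, 'k) hx_gen list \<Rightarrow>\<^sub>0 'k"

definition hA :: "('v \<Rightarrow> 'k::field) \<Rightarrow> ('v, 'k) hx_elt" where "hA a = free_gen (GA a)"
definition hAbar :: "('v \<Rightarrow> 'k::field) \<Rightarrow> ('v, 'k) hx_elt" where "hAbar a = free_gen (GAbar a)"
definition hX :: "('v \<times> 'v \<Rightarrow> 'k::field) \<Rightarrow> ('v, 'k) hx_elt" where "hX x = free_gen (GX x)"
definition hXbar :: "('v \<times> 'v \<Rightarrow> 'k::field) \<Rightarrow> ('v, 'k) hx_elt" where "hXbar x = free_gen (GXbar x)"

text \<open>
  Every element of \<open>A\<close> and of the space of vector fields is a generator of the free algebra.
  The first twelve rules make \<open>hA\<close> and \<open>hAbar\<close> unital algebra maps from \<open>A\<close> and its opposite,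
  and \<open>hX\<close> and \<open>hXbar\<close> linear maps. A tensor $\sum_m r_m\otimes s_m$ in
  $A\otimes_{\mathbb K}A$ is given as a list of pairs.
\<close>

inductive hx_rel ::
    "'v pair_pre_digraph \<Rightarrow> ('v, 'k::field) hx_elt \<Rightarrow> ('v, 'k) hx_elt \<Rightarrow> bool"
  for D :: "'v pair_pre_digraph" where
  A_add: "a \<in> fun_A D \<Longrightarrow> b \<in> fun_A D \<Longrightarrow> hx_rel D (hA (a + b)) (hA a + hA b)"
| A_scale: "a \<in> fun_A D \<Longrightarrow> hx_rel D (hA (scale k a)) (basis_smult k (hA a))"
| A_mult: "a \<in> fun_A D \<Longrightarrow> b \<in> fun_A D \<Longrightarrow> hx_rel D (hA a \<bullet> hA b) (hA (a * b))"
| A_one: "hx_rel D (hA (one_A D)) free_one"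
| Abar_add: "a \<in> fun_A D \<Longrightarrow> b \<in> fun_A D \<Longrightarrow> hx_rel D (hAbar (a + b)) (hAbar a + hAbar b)"
| Abar_scale: "a \<in> fun_A D \<Longrightarrow> hx_rel D (hAbar (scale k a)) (basis_smult k (hAbar a))"
| Abar_mult: "a \<in> fun_A D \<Longrightarrow> b \<in> fun_A D \<Longrightarrow> hx_rel D (hAbar a \<bullet> hAbar b) (hAbar (b * a))"
| Abar_one: "hx_rel D (hAbar (one_A D)) free_one"
| X_add: "x \<in> vfields D \<Longrightarrow> y \<in> vfields D \<Longrightarrow> hx_rel D (hX (x + y)) (hX x + hX y)"
| X_scale: "x \<in> vfields D \<Longrightarrow> hx_rel D (hX (scale k x)) (basis_smult k (hX x))"
| Xbar_add: "x \<in> vfields D \<Longrightarrow> y \<in> vfields D \<Longrightarrow> hx_rel D (hXbar (x + y)) (hXbar x + hXbar y)"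
| Xbar_scale: "x \<in> vfields D \<Longrightarrow> hx_rel D (hXbar (scale k x)) (basis_smult k (hXbar x))"
| A_Abar_commute: "a \<in> fun_A D \<Longrightarrow> b \<in> fun_A D \<Longrightarrow> hx_rel D (hA a \<bullet> hAbar b) (hAbar b \<bullet> hA a)"
| A_X: "a \<in> fun_A D \<Longrightarrow> x \<in> vfields D \<Longrightarrow> hx_rel D (hA a \<bullet> hX x) (hX (vf_lact a x))"
| X_A: "a \<in> fun_A D \<Longrightarrow> x \<in> vfields D \<Longrightarrow>
     hx_rel D (hX x \<bullet> hA a) (hX (vf_ract x a) + hA (ev D x (ext_d D a)))"
| Abar_Xbar: "a \<in> fun_A D \<Longrightarrow> x \<in> vfields D \<Longrightarrow>
     hx_rel D (hAbar a \<bullet> hXbar x) (hXbar (vf_ract x a))"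
| Xbar_Abar: "a \<in> fun_A D \<Longrightarrow> x \<in> vfields D \<Longrightarrow>
     hx_rel D (hXbar x \<bullet> hAbar a) (hXbar (vf_lact a x) + hAbar (ev_u D (ext_d D a) x))"
| ker_X: "set ms \<subseteq> fun_A D \<times> fun_A D \<Longrightarrow> x \<in> vfields D \<Longrightarrow>
     (\<Sum>(r, s)\<leftarrow>ms. r * s) = 0 \<Longrightarrow> (\<Sum>(r, s)\<leftarrow>ms. form_lact r (ext_d D s)) = 0 \<Longrightarrow>
     hx_rel D (\<Sum>(r, s)\<leftarrow>ms. hAbar s \<bullet> hX x \<bullet> hAbar r) 0"
| ker_Xbar: "set ms \<subseteq> fun_A D \<times> fun_A D \<Longrightarrow> x \<in> vfields D \<Longrightarrow>
     (\<Sum>(r, s)\<leftarrow>ms. r * s) = 0 \<Longrightarrow> (\<Sum>(r, s)\<leftarrow>ms. form_lact r (ext_d D s)) = 0 \<Longrightarrow>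
     hx_rel D (\<Sum>(r, s)\<leftarrow>ms. hA r \<bullet> hXbar x \<bullet> hA s) 0"
| Xbar_inv: "x \<in> vfields D \<Longrightarrow>
     hx_rel D (\<Sum>i\<in>parcs D. free_comm (hXbar x) (hA (coev_b i)) \<bullet> hX (coev_x i)) (hXbar x)"
| X_inv: "x \<in> vfields D \<Longrightarrow>
     hx_rel D (\<Sum>j\<in>parcs D. free_comm (hX x) (hAbar (coev_c j)) \<bullet> hXbar (coev_y j)) (hX x)"
| ev_inv: "a \<in> fun_A D \<Longrightarrow> x \<in> vfields D \<Longrightarrow>
     hx_rel D (\<Sum>j\<in>parcs D. free_comm (hX (coev_y j)) (hAbar a)
                            \<bullet> free_comm (hXbar x) (hA (coev_c j)))
              (hAbar (ev D x (ext_d D a)))"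
| ev_u_inv: "a \<in> fun_A D \<Longrightarrow> x \<in> vfields D \<Longrightarrow>
     hx_rel D (\<Sum>i\<in>parcs D. free_comm (hXbar (coev_x i)) (hA a)
                            \<bullet> free_comm (hX x) (hAbar (coev_b i)))
              (hA (ev_u D (ext_d D a) x))"

definition hx_ideal :: "'v pair_pre_digraph \<Rightarrow> ('v, 'k::field) hx_elt set" where
  "hx_ideal D = genideal (free_alg (hx_gens D)) {l - r | l r. hx_rel D l r}"

definition HX1 :: "'v pair_pre_digraph \<Rightarrow> ('k::field, ('v, 'k) hx_elt set) module" where
  "HX1 D = quot_alg (free_alg (hx_gens D)) (hx_ideal D)"

definition hx_cls :: "'v pair_pre_digraph \<Rightarrow> ('v, 'k::field) hx_elt \<Rightarrow> ('v, 'k) hx_elt set" where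
  "hx_cls D x = hx_ideal D +>\<^bsub>free_alg (hx_gens D)\<^esub> x"

section \<open>Well-definedness\<close>

text \<open>
  \<open>genideal\<close> is an intersection of ideals of a ring containing the given set, hence meaningful
  only for a subset of the carrier of a ring. The lemmas below establish this for the two
  ideals above.
\<close>

definition opt_single :: "'p option \<Rightarrow> 'k \<Rightarrow> ('p \<Rightarrow>\<^sub>0 'k::field)" where
  "opt_single r k = (case r of None \<Rightarrow> 0 | Some r \<Rightarrow> Poly_Mapping.single r k)"

lemma opt_single_add: "opt_single r (k + l) = opt_single r k + opt_single r l"
  by (simp add: opt_single_def single_add split: option.split)

lemma opt_single_0 [simp]: "opt_single r 0 = 0"
  by (simp add: opt_single_def split: option.split)

lemma basis_mult_sum:
  assumes "finite S" "finite T" "Poly_Mapping.keys x \<subseteq> S" "Poly_Mapping.keys y \<subseteq> T"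
  shows "basis_mult c x y =
    (\<Sum>p\<in>S. \<Sum>q\<in>T. opt_single (c p q) (Poly_Mapping.lookup x p * Poly_Mapping.lookup y q))"
proof -
  have "basis_mult c x y = (\<Sum>p\<in>Poly_Mapping.keys x. \<Sum>q\<in>T. opt_single (c p q) (Poly_Mapping.lookup x p * Poly_Mapping.lookup y q))"
    unfolding basis_mult_def opt_single_def[symmetric]
    by (intro sum.cong refl sum.mono_neutral_left) (use assms in \<open>auto simp: in_keys_iff\<close>)
  also have "\<dots> = (\<Sum>p\<in>S. \<Sum>q\<in>T. opt_single (c p q) (Poly_Mapping.lookup x p * Poly_Mapping.lookup y q))"
    by (intro sum.mono_neutral_left) (use assms in \<open>auto simp: in_keys_iff\<close>)
  finally show ?thesis .
qed

lemma basis_mult_add_left: "basis_mult c (x + x') y = basis_mult c x y + basis_mult c x' y"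
proof -
  let ?S = "Poly_Mapping.keys x \<union> Poly_Mapping.keys x'"
  have "Poly_Mapping.keys (x + x') \<subseteq> ?S" by (rule keys_add)
  then show ?thesis
    by (simp add: basis_mult_sum[where S = ?S and T = "Poly_Mapping.keys y"] lookup_add
        distrib_right opt_single_add sum.distrib)
qed

lemma basis_mult_add_right: "basis_mult c x (y + y') = basis_mult c x y + basis_mult c x y'"
proof -
  let ?S = "Poly_Mapping.keys y \<union> Poly_Mapping.keys y'"
  have "Poly_Mapping.keys (y + y') \<subseteq> ?S" by (rule keys_add)
  then show ?thesis
    by (simp add: basis_mult_sum[where T = ?S and S = "Poly_Mapping.keys x"] lookup_add
        distrib_left opt_single_add sum.distrib)
qed

lemma basis_mult_0 [simp]: "basis_mult c 0 x = 0" "basis_mult c x 0 = 0"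
  by (simp_all add: basis_mult_def)

lemma basis_mult_single:
  "basis_mult c (Poly_Mapping.single p k) (Poly_Mapping.single q l) = opt_single (c p q) (k * l)"
  by (subst basis_mult_sum[where S = "{p}" and T = "{q}"]) auto

lemma finsupp_induct:
  fixes x :: "'p \<Rightarrow>\<^sub>0 'k::field"
  assumes "Poly_Mapping.keys x \<subseteq> B" "P 0"
    and "\<And>p k y. p \<in> B \<Longrightarrow> P y \<Longrightarrow> P (Poly_Mapping.single p k + y)"
  shows "P x"
  using assms(1)
proof (induction x rule: update_induct)
  case const show ?case by (rule assms(2))
next
  case (update f a b)
  have eq: "Poly_Mapping.update a b f = Poly_Mapping.single a b + f"
    using update by (intro poly_mapping_eqI) (auto simp: lookup_update lookup_add lookup_single when_def in_keys_iff)
  have "Poly_Mapping.keys (Poly_Mapping.update a b f) = insert a (Poly_Mapping.keys f)"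
    using update by (auto simp: in_keys_iff lookup_update split: if_splits)
  then show ?case using update unfolding eq by (auto intro!: assms(3))
qed

lemma basis_mult_assoc:
  assumes "\<And>p q r. Option.bind (c p q) (\<lambda>s. c s r) = Option.bind (c q r) (c p)"
  shows "basis_mult c (basis_mult c x y) z = basis_mult c x (basis_mult c y z)"
proof -
  have o: "basis_mult c (opt_single s k) (Poly_Mapping.single r l) = opt_single (Option.bind s (\<lambda>s. c s r)) (k * l)"
          "basis_mult c (Poly_Mapping.single r l) (opt_single s k) = opt_single (Option.bind s (c r)) (l * k)"
    for s r :: _ and k l :: 'b
    by (cases s; simp add: opt_single_def basis_mult_single[unfolded opt_single_def])+
  have 1: "basis_mult c (basis_mult c (Poly_Mapping.single p k) (Poly_Mapping.single q l)) z
      = basis_mult c (Poly_Mapping.single p k) (basis_mult c (Poly_Mapping.single q l) z)" for p k q l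
    by (induction z rule: finsupp_induct[OF subset_UNIV])
       (simp_all add: basis_mult_add_right basis_mult_single o assms mult.assoc)
  have 2: "basis_mult c (basis_mult c (Poly_Mapping.single p k) y) z
      = basis_mult c (Poly_Mapping.single p k) (basis_mult c y z)" for p k
    by (induction y rule: finsupp_induct[OF subset_UNIV])
       (simp_all add: basis_mult_add_right basis_mult_add_left 1)
  show ?thesis
    by (induction x rule: finsupp_induct[OF subset_UNIV]) (simp_all add: basis_mult_add_left 2)
qed

lemma keys_basis_mult:
  assumes "\<And>p q r. p \<in> B \<Longrightarrow> q \<in> B \<Longrightarrow> c p q = Some r \<Longrightarrow> r \<in> B"
    and "Poly_Mapping.keys x \<subseteq> B" "Poly_Mapping.keys y \<subseteq> B"
  shows "Poly_Mapping.keys (basis_mult c x y) \<subseteq> B"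
proof -
  have "Poly_Mapping.keys (opt_single (c p q) k) \<subseteq> B" if "p \<in> B" "q \<in> B" for p q and k :: 'b
    using assms(1)[OF that] by (auto simp: opt_single_def split: option.split if_splits)
  then show ?thesis
    unfolding basis_mult_def opt_single_def[symmetric] using assms(2,3)
    by (intro order.trans[OF keys_sum] UN_least) blast
qed

lemma ring_basis_alg:
  fixes c :: "'p \<Rightarrow> 'p \<Rightarrow> 'p option"
  assumes fin: "finite U" and sub: "U \<subseteq> B"
    and closed: "\<And>p q r. p \<in> B \<Longrightarrow> q \<in> B \<Longrightarrow> c p q = Some r \<Longrightarrow> r \<in> B"
    and assoc: "\<And>p q r. Option.bind (c p q) (\<lambda>s. c s r) = Option.bind (c q r) (c p)"
    and l: "\<And>p. p \<in> B \<Longrightarrow> \<exists>u\<in>U. c u p = Some p \<and> (\<forall>v\<in>U. v \<noteq> u \<longrightarrow> c v p = None)"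
    and r: "\<And>p. p \<in> B \<Longrightarrow> \<exists>u\<in>U. c p u = Some p \<and> (\<forall>v\<in>U. v \<noteq> u \<longrightarrow> c p v = None)"
  shows "ring (basis_alg B c U :: ('k::field, 'p \<Rightarrow>\<^sub>0 'k) module)"
proof -
  let ?e = "\<Sum>u\<in>U. Poly_Mapping.single u (1::'k)"
  have suml: "basis_mult c (\<Sum>u\<in>V. Poly_Mapping.single u (1::'k)) x = (\<Sum>u\<in>V. basis_mult c (Poly_Mapping.single u 1) x)" for V x
    by (induction V rule: infinite_finite_induct) (simp_all add: basis_mult_add_left)
  have sumr: "basis_mult c x (\<Sum>u\<in>V. Poly_Mapping.single u (1::'k)) = (\<Sum>u\<in>V. basis_mult c x (Poly_Mapping.single u 1))" for V x
    by (induction V rule: infinite_finite_induct) (simp_all add: basis_mult_add_right)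
  have 1: "basis_mult c ?e (Poly_Mapping.single p k) = Poly_Mapping.single p k" if pB: "p \<in> B" for p k
  proof -
    obtain u where u: "u \<in> U" "c u p = Some p" "\<forall>v\<in>U. v \<noteq> u \<longrightarrow> c v p = None" using l[OF pB] by blast
    have "basis_mult c ?e (Poly_Mapping.single p k) = (\<Sum>v\<in>U. if v = u then Poly_Mapping.single p k else 0)"
      unfolding suml by (rule sum.cong) (use u in \<open>auto simp: basis_mult_single opt_single_def\<close>)
    then show ?thesis using u fin by simp
  qed
  have 2: "basis_mult c (Poly_Mapping.single p k) ?e = Poly_Mapping.single p k" if pB: "p \<in> B" for p k
  proof -
    obtain u where u: "u \<in> U" "c p u = Some p" "\<forall>v\<in>U. v \<noteq> u \<longrightarrow> c p v = None" using r[OF pB] by blast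
    have "basis_mult c (Poly_Mapping.single p k) ?e = (\<Sum>v\<in>U. if v = u then Poly_Mapping.single p k else 0)"
      unfolding sumr by (rule sum.cong) (use u in \<open>auto simp: basis_mult_single opt_single_def\<close>)
    then show ?thesis using u fin by simp
  qed
  have L: "basis_mult c ?e x = x" if "Poly_Mapping.keys x \<subseteq> B" for x
    using that by (rule finsupp_induct) (simp_all add: basis_mult_add_right 1)
  have R: "basis_mult c x ?e = x" if "Poly_Mapping.keys x \<subseteq> B" for x
    using that by (rule finsupp_induct) (simp_all add: basis_mult_add_left 2)
  have E: "Poly_Mapping.keys ?e \<subseteq> B"
    using sub by (intro order.trans[OF keys_sum]) auto
  show ?thesis
  proof (rule ringI)
    show "abelian_group (basis_alg B c U :: ('k, 'p \<Rightarrow>\<^sub>0 'k) module)"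
    proof (rule abelian_groupI, simp_all add: basis_alg_def add_ac)
      fix x y :: "'p \<Rightarrow>\<^sub>0 'k" assume "Poly_Mapping.keys x \<subseteq> B" "Poly_Mapping.keys y \<subseteq> B"
      then show "Poly_Mapping.keys (x + y) \<subseteq> B" using keys_add[of x y] by blast
    next
      fix x :: "'p \<Rightarrow>\<^sub>0 'k" assume "Poly_Mapping.keys x \<subseteq> B"
      then show "\<exists>y. Poly_Mapping.keys y \<subseteq> B \<and> x + y = 0" by (intro exI[of _ "- x"]) auto
    qed
    show "monoid (basis_alg B c U :: ('k, 'p \<Rightarrow>\<^sub>0 'k) module)"
      by (rule monoidI)
         (simp_all add: basis_alg_def L R E keys_basis_mult[OF closed] basis_mult_assoc[OF assoc])
  qed (simp_all add: basis_alg_def basis_mult_add_left basis_mult_add_right)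
qed

lemma ring_free_alg: "ring (free_alg G :: ('k::field, _) module)"
  unfolding free_alg_def by (rule ring_basis_alg) auto

lemma ring_path_alg:
  assumes "fin_digraph Q"
  shows "ring (path_alg Q :: ('k::field, _) module)"
proof -
  interpret fin_digraph Q by fact
  show ?thesis
    unfolding path_alg_def
  proof (rule ring_basis_alg, goal_cases)
    case (3 p q r)
    then show ?case by (auto simp: path_comp_def split: if_splits)
  next
    case (4 p q r)
    then show ?case by (auto simp: path_comp_def split: prod.splits)
  next
    case (5 p)
    then obtain u w v where "p = (u, w, v)" "awalk u w v" by auto
    then show ?case by (intro bexI[of _ "(v, [], v)"]) (auto simp: path_comp_def)
  next
    case (6 p)
    then obtain u w v where "p = (u, w, v)" "awalk u w v" by auto
    then show ?case by (intro bexI[of _ "(u, [], u)"]) (auto simp: path_comp_def)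
  qed (auto simp: awalk_Nil_iff)
qed

lemma (in pair_digraph) fin_digraph_double: "fin_digraph (double G)"
proof
  let ?V = "pverts G"
  have "arcs (double G) \<subseteq> (\<lambda>(a,b,c,d). L2 a b c d) ` (?V \<times> ?V \<times> ?V \<times> ?V)
     \<union> (\<lambda>(a,b,c,d). R2 a b c d) ` (?V \<times> ?V \<times> ?V \<times> ?V)
     \<union> (\<lambda>(a,b,c). L1 a b c) ` (?V \<times> ?V \<times> ?V) \<union> (\<lambda>(a,b,c). R1 a b c) ` (?V \<times> ?V \<times> ?V)"
    by (auto simp: double_def image_iff dest: in_arcsD1 in_arcsD2)
  then show "finite (arcs (double G))" by (rule finite_subset) (simp add: pair_finite_verts)
qed (auto simp: double_def pair_finite_verts dest: in_arcsD1 in_arcsD2)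

lemma (in pair_digraph) dbl_rel_carrier:
  fixes l r :: "('a, 'k::field) dbl_elt"
  assumes "dbl_rel G l r"
  shows "l \<in> carrier (path_alg (double G))" "r \<in> carrier (path_alg (double G))"
proof -
  interpret Q: fin_digraph "double G" by (rule fin_digraph_double)
  have arr: "Poly_Mapping.keys (arrow_elt (double G) e :: ('a, 'k) dbl_elt) \<subseteq> {(u, p, v). Q.awalk u p v}"
    if "e \<in> arcs (double G)" for e
    using that by (auto simp: arrow_elt_def Q.arc_implies_awalk)
  have gens:
    "(a, b) \<in> parcs G \<Longrightarrow> (c, d) \<in> parcs G \<Longrightarrow>
       Poly_Mapping.keys (L2_elt G (a, b) (c, d) :: ('a, 'k) dbl_elt) \<subseteq> {(u, p, v). Q.awalk u p v}"
    "(a, b) \<in> parcs G \<Longrightarrow> (c, d) \<in> parcs G \<Longrightarrow>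
       Poly_Mapping.keys (R2_elt G (a, b) (c, d) :: ('a, 'k) dbl_elt) \<subseteq> {(u, p, v). Q.awalk u p v}"
    "(a, b) \<in> parcs G \<Longrightarrow> q \<in> pverts G \<Longrightarrow>
       Poly_Mapping.keys (L1_elt G (a, b) q :: ('a, 'k) dbl_elt) \<subseteq> {(u, p, v). Q.awalk u p v}"
    "(a, b) \<in> parcs G \<Longrightarrow> q \<in> pverts G \<Longrightarrow>
       Poly_Mapping.keys (R1_elt G q (a, b) :: ('a, 'k) dbl_elt) \<subseteq> {(u, p, v). Q.awalk u p v}"
    "p \<in> pverts G \<Longrightarrow> q \<in> pverts G \<Longrightarrow>
       Poly_Mapping.keys (u_elt p q :: ('a, 'k) dbl_elt) \<subseteq> {(u, p, v). Q.awalk u p v}"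
    for a b c d p q
    unfolding L2_elt_def R2_elt_def L1_elt_def R1_elt_def prod.case
    by (rule arr; simp add: double_def; blast)+
       (auto simp: u_elt_def vertex_idem_def Q.awalk_Nil_iff, simp add: double_def)
  have mult: "Poly_Mapping.keys (x \<bullet>\<^sub>p y) \<subseteq> {(u, p, v). Q.awalk u p v}"
    if "Poly_Mapping.keys x \<subseteq> {(u, p, v). Q.awalk u p v}"
       "Poly_Mapping.keys y \<subseteq> {(u, p, v). Q.awalk u p v}"
    for x y :: "('a, 'k) dbl_elt"
    unfolding path_mult_def
    by (rule keys_basis_mult[OF _ that]) (auto simp: path_comp_def split: if_splits)
  have sum: "Poly_Mapping.keys (\<Sum>i\<in>I. g i) \<subseteq> {(u, p, v). Q.awalk u p v}"
    if "\<And>i. i \<in> I \<Longrightarrow> Poly_Mapping.keys (g i) \<subseteq> {(u, p, v). Q.awalk u p v}"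
    for g :: "'a \<Rightarrow> ('a, 'k) dbl_elt" and I
    using that by (intro order.trans[OF keys_sum] UN_least)
  have [simp]: "carrier (path_alg (double G) :: ('k, _) module) = {x. Poly_Mapping.keys x \<subseteq> {(u, p, v). Q.awalk u p v}}"
    by (simp add: path_alg_def basis_alg_def)
  show "l \<in> carrier (path_alg (double G))" "r \<in> carrier (path_alg (double G))"
    using assms
    by (cases; simp; intro sum mult gens impI; (simp add: wellformed' | (auto dest: in_arcsD1 in_arcsD2; fail)))+
qed

lemma coord_space_closed:
  "f \<in> coord_space S \<Longrightarrow> g \<in> coord_space S \<Longrightarrow> f + g \<in> coord_space S"
  "f \<in> coord_space S \<Longrightarrow> scale k f \<in> coord_space S"
  "f \<in> coord_space S \<Longrightarrow> g \<in> coord_space S \<Longrightarrow> f * g \<in> coord_space S"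
  "i \<in> S \<Longrightarrow> basis_vec i \<in> coord_space S"
  "i \<in> S \<Longrightarrow> - basis_vec i \<in> coord_space S"
  "one_A D \<in> fun_A D"
  "x \<in> vfields D \<Longrightarrow> vf_lact a x \<in> vfields D"
  "x \<in> vfields D \<Longrightarrow> vf_ract x a \<in> vfields D"
  by (auto simp: coord_space_def scale_def basis_vec_def one_A_def vf_lact_def vf_ract_def)

lemma (in pair_digraph) ev_closed: "ev G x w \<in> fun_A G" "ev_u G w x \<in> fun_A G"
proof -
  have "{a. (a, v) \<in> parcs G} = {}" "{a. (v, a) \<in> parcs G} = {}" if "v \<notin> pverts G" for v
    using that by (auto dest: in_arcsD1 in_arcsD2)
  then show "ev G x w \<in> fun_A G" "ev_u G w x \<in> fun_A G"
    by (auto simp: coord_space_def ev_def ev_u_def)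
qed

lemma (in pair_digraph) hx_rel_carrier:
  fixes l r :: "('a, 'k::field) hx_elt"
  assumes "hx_rel G l r"
  shows "l \<in> carrier (free_alg (hx_gens G))" "r \<in> carrier (free_alg (hx_gens G))"
proof -
  let ?K = "\<lambda>x :: ('a, 'k) hx_elt. Poly_Mapping.keys x \<subseteq> lists (hx_gens G)"
  have gens: "a \<in> fun_A G \<Longrightarrow> ?K (hA a)" "a \<in> fun_A G \<Longrightarrow> ?K (hAbar a)"
     "x \<in> vfields G \<Longrightarrow> ?K (hX x)" "x \<in> vfields G \<Longrightarrow> ?K (hXbar x)" "?K free_one" for a x
    by (auto simp: hA_def hAbar_def hX_def hXbar_def free_gen_def free_one_def hx_gens_def)
  have add: "?K (x + y)" if "?K x" "?K y" for x y
    using keys_add[of x y] that by blast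
  have scale: "?K (basis_smult k x)" if "?K x" for k x
    using that by (auto simp: basis_smult_def in_keys_iff Poly_Mapping.map.rep_eq when_def subset_iff)
  have mult: "?K (x \<bullet> y)" if "?K x" "?K y" for x y
    unfolding free_mult_def by (rule keys_basis_mult[OF _ that]) auto
  have comm: "?K (free_comm x y)" if "?K x" "?K y" for x y
    using mult[OF that] mult[OF that(2,1)] keys_diff[of "x \<bullet> y" "y \<bullet> x"]
    unfolding free_comm_def by blast
  have sum: "?K (\<Sum>i\<in>I. g i)" if "\<And>i. i \<in> I \<Longrightarrow> ?K (g i)" for I :: "('a \<times> 'a) set" and g
    using that by (intro order.trans[OF keys_sum] UN_least)
  have slist: "?K (\<Sum>(r, s)\<leftarrow>ms. g r s)" if "\<And>r s. (r, s) \<in> set ms \<Longrightarrow> ?K (g r s)"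
    for ms :: "(('a \<Rightarrow> 'k) \<times> ('a \<Rightarrow> 'k)) list" and g
    using that
  proof (induction ms)
    case (Cons m ms)
    then have "?K (g (fst m) (snd m))" "?K (\<Sum>(r, s)\<leftarrow>ms. g r s)" by (cases m; auto)+
    then show ?case by (cases m) (simp add: add)
  qed simp
  have coev: "coev_b i \<in> fun_A G" "coev_c i \<in> fun_A G" "coev_x i \<in> vfields G" "coev_y i \<in> vfields G"
    if "i \<in> parcs G" for i
    using that arc_fst_in_verts[OF that] arc_snd_in_verts[OF that]
    by (auto simp: coev_b_def coev_c_def coev_x_def coev_y_def intro: coord_space_closed)
  have carr: "carrier (free_alg (hx_gens G)) = {x. ?K x}"
    by (simp add: free_alg_def basis_alg_def)
  show "l \<in> carrier (free_alg (hx_gens G))"  "r \<in> carrier (free_alg (hx_gens G))"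
    using assms
    by (cases; simp only: carr mem_Collect_eq; (simp; fail)?;
        (intro gens add scale mult comm sum slist coev coord_space_closed ev_closed; (assumption | (auto; fail))))+
qed
end

theory Submission
  imports Defs
begin

text \<open>
  The two algebras are compared through the homomorphisms that leave them. For every algebra \<open>S\<close>, a
  homomorphism into \<open>S\<close> from $H\mathfrak{X}^1$, and likewise one from the quotient of the path algebra
  of the double, amounts to one and the same collection of elements of \<open>S\<close>, recorded by the locale
  \<open>hx_frame\<close>. Applying this to the two algebras themselves gives homomorphisms in both directions,
  and these are mutually inverse because they agree on generators.

  The collection consists of two families of orthogonal idempotents with sum \<open>1\<close>, \<open>f p\<close> and \<open>g q\<close>,
  the first commuting with the second, and of elements \<open>X a b\<close>, \<open>Z c d\<close> for the arcs, with
  \<open>X a b\<close> in \<open>f b S f a\<close> and \<open>Z c d\<close> in \<open>g c S g d\<close>. Seen from $H\mathfrak{X}^1$, they are the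
  images of $f_p$, $\overline{f_q}$, $e_{b\leftarrow a}-f_b$ and
  $-(\overline{e_{d\leftarrow c}}+\overline{f_c})$. The shift by $f_b$ and $\overline{f_c}$ absorbs the
  evaluation terms: for an arc $a\to b$ the relation for $x\bullet f_a$ reads
  $e_{b\leftarrow a}\bullet f_a=e_{b\leftarrow a}-f_b$, which together with
  $f_b\bullet e_{b\leftarrow a}=e_{b\leftarrow a}$ says exactly that \<open>X a b\<close> lies in \<open>f b S f a\<close>.

  A tensor $\sum r_m\otimes s_m$ is the same as the function $t(p,q)=\sum r_m(p)s_m(q)$ on
  $V\times V$. The condition $\sum r_ms_m=0$ says that $t$ vanishes on the diagonal, and then
  $\sum r_m\,ds_m=0$ says that it vanishes on the edges. So the relations indexed by such
  tensors say that \<open>g d \<otimes> X a b \<otimes> g c\<close> and \<open>f c \<otimes> Z a b \<otimes> f d\<close> vanish unless \<open>c = d\<close> or $c\to d$ is an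
  edge. The remaining corners of \<open>X\<close> and \<open>Z\<close> are, up to sign, the images of the arrows of the double:
  those with \<open>c = d\<close> of the arrows $L^{ab}_q$ and $R^p_{cd}$, those with an edge $c\to d$ of the arrows
  $L^{ab}_{cd}$ and $R^{ab}_{cd}$. Conversely \<open>X\<close> and \<open>Z\<close> are the sums of their corners, and
  \<open>f p \<otimes> g q\<close> is the image of $u_{p,q}$.

  It remains to compare the relations. Each of the four sum relations of $H\mathfrak{X}^1$ is linear in $x$
  and $a$, so it may be stated for basis vectors, and it may be tested after multiplication with
  the idempotents \<open>f q\<close> and \<open>g s\<close>. Each of the two inverse relations (\<open>inv_rel\<close>, \<open>inv_rel'\<close>) becomes two
  relations of the double: the formula for $R^q_{st}$ or $L^{st}_q$, and one whose right-hand side has a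
  $\delta_{a,p}$. The two evaluation relations (\<open>ev_rel\<close>, \<open>ev_rel'\<close>) become
  the other two of the latter kind; see \<open>inv_rel_iff\<close>, \<open>ev_rel_iff\<close> and their primed versions.
  Exchanging \<open>f\<close> with \<open>g\<close> and \<open>X\<close> with \<open>Z\<close> and reversing all arcs preserves the axioms and interchanges
  the primed and unprimed relations, which leaves two of the four to be computed.
\<close>

section \<open>Algebras over a field and their homomorphisms\<close>

locale alg = ring S for S :: "('k::field, 'a) module" (structure) +
  assumes smult_closed [simp, intro]: "x \<in> carrier S \<Longrightarrow> k \<odot> x \<in> carrier S"
    and smult_add_left: "x \<in> carrier S \<Longrightarrow> (k + l) \<odot> x = k \<odot> x \<oplus> l \<odot> x"
    and smult_add_right: "x \<in> carrier S \<Longrightarrow> y \<in> carrier S \<Longrightarrow> k \<odot> (x \<oplus> y) = k \<odot> x \<oplus> k \<odot> y"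
    and smult_smult: "x \<in> carrier S \<Longrightarrow> k \<odot> (l \<odot> x) = (k * l) \<odot> x"
    and smult_one [simp]: "x \<in> carrier S \<Longrightarrow> 1 \<odot> x = x"
    and smult_mult_left: "x \<in> carrier S \<Longrightarrow> y \<in> carrier S \<Longrightarrow> (k \<odot> x) \<otimes> y = k \<odot> (x \<otimes> y)"
    and smult_mult_right: "x \<in> carrier S \<Longrightarrow> y \<in> carrier S \<Longrightarrow> x \<otimes> (k \<odot> y) = k \<odot> (x \<otimes> y)"
begin

lemma smult_0_left [simp]: "x \<in> carrier S \<Longrightarrow> 0 \<odot> x = \<zero>"
  using smult_add_left[of x 0 0] by (metis add.l_cancel_one' add_0 smult_closed)

lemma smult_0_right [simp]: "k \<odot> \<zero> = \<zero>"
  using smult_add_right[of \<zero> \<zero> k] by (metis add.l_cancel_one' l_zero smult_closed zero_closed)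

lemma smult_minus_left: "x \<in> carrier S \<Longrightarrow> (- k) \<odot> x = \<ominus> (k \<odot> x)"
  using smult_add_left[of x "- k" k] by (simp add: minus_equality)

lemma smult_minus_right: "x \<in> carrier S \<Longrightarrow> k \<odot> (\<ominus> x) = \<ominus> (k \<odot> x)"
  using smult_add_right[of "\<ominus> x" x k] by (simp add: minus_equality l_neg)

lemma smult_diff_left: "x \<in> carrier S \<Longrightarrow> (k - l) \<odot> x = k \<odot> x \<ominus> l \<odot> x"
  using smult_add_left[of x k "- l"] by (simp add: smult_minus_left minus_eq)

lemma smult_finsum:
  "f \<in> I \<rightarrow> carrier S \<Longrightarrow> k \<odot> (\<Oplus>i\<in>I. f i) = (\<Oplus>i\<in>I. k \<odot> f i)"
  by (induction I rule: infinite_finite_induct) (simp_all add: smult_add_right Pi_def)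

end

definition alg_hom :: "('k, 'a) module \<Rightarrow> ('k, 'b) module \<Rightarrow> ('a \<Rightarrow> 'b) set" where
  "alg_hom R S = {h \<in> ring_hom R S. \<forall>k. \<forall>x\<in>carrier R. h (k \<odot>\<^bsub>R\<^esub> x) = k \<odot>\<^bsub>S\<^esub> h x}"

lemma alg_homI:
  assumes "\<And>x. x \<in> carrier R \<Longrightarrow> h x \<in> carrier S"
    and "\<And>x y. x \<in> carrier R \<Longrightarrow> y \<in> carrier R \<Longrightarrow> h (x \<otimes>\<^bsub>R\<^esub> y) = h x \<otimes>\<^bsub>S\<^esub> h y"
    and "\<And>x y. x \<in> carrier R \<Longrightarrow> y \<in> carrier R \<Longrightarrow> h (x \<oplus>\<^bsub>R\<^esub> y) = h x \<oplus>\<^bsub>S\<^esub> h y"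
    and "h \<one>\<^bsub>R\<^esub> = \<one>\<^bsub>S\<^esub>"
    and "\<And>k x. x \<in> carrier R \<Longrightarrow> h (k \<odot>\<^bsub>R\<^esub> x) = k \<odot>\<^bsub>S\<^esub> h x"
  shows "h \<in> alg_hom R S"
  using assms by (auto simp: alg_hom_def ring_hom_def)

lemma alg_hom_comp:
  assumes "h \<in> alg_hom R S" "g \<in> alg_hom S T"
  shows "g \<circ> h \<in> alg_hom R T"
  using assms by (auto simp: alg_hom_def ring_hom_def Pi_def)

locale alg_morphism = R: alg R + S: alg S
  for R :: "('k::field, 'a) module" and S :: "('k, 'b) module" +
  fixes h assumes hom: "h \<in> alg_hom R S"
begin

lemma closed [simp]: "x \<in> carrier R \<Longrightarrow> h x \<in> carrier S"
  and mult: "x \<in> carrier R \<Longrightarrow> y \<in> carrier R \<Longrightarrow> h (x \<otimes>\<^bsub>R\<^esub> y) = h x \<otimes>\<^bsub>S\<^esub> h y"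
  and add: "x \<in> carrier R \<Longrightarrow> y \<in> carrier R \<Longrightarrow> h (x \<oplus>\<^bsub>R\<^esub> y) = h x \<oplus>\<^bsub>S\<^esub> h y"
  and one: "h \<one>\<^bsub>R\<^esub> = \<one>\<^bsub>S\<^esub>"
  and smult: "x \<in> carrier R \<Longrightarrow> h (k \<odot>\<^bsub>R\<^esub> x) = k \<odot>\<^bsub>S\<^esub> h x"
  using hom by (auto simp: alg_hom_def ring_hom_def)

sublocale ring_hom_ring R S h
  by (rule ring_hom_ringI) (simp_all add: R.ring_axioms S.ring_axioms mult add one)

lemma minus:
  assumes "x \<in> carrier R" "y \<in> carrier R"
  shows "h (x \<ominus>\<^bsub>R\<^esub> y) = h x \<ominus>\<^bsub>S\<^esub> h y"
  using assms by (simp add: R.minus_eq S.minus_eq)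

lemma finsum:
  "f \<in> I \<rightarrow> carrier R \<Longrightarrow> h (finsum R f I) = finsum S (\<lambda>i. h (f i)) I"
  by (induction I rule: infinite_finite_induct) (simp_all add: Pi_def)

lemma finsum_image:
  assumes "\<And>i. i \<in> I \<Longrightarrow> t i \<in> carrier R" "\<And>i. i \<in> I \<Longrightarrow> h (t i) = t' i"
  shows "h (\<Oplus>\<^bsub>R\<^esub>i\<in>I. t i) = (\<Oplus>\<^bsub>S\<^esub>i\<in>I. t' i)"
proof -
  have "h (\<Oplus>\<^bsub>R\<^esub>i\<in>I. t i) = (\<Oplus>\<^bsub>S\<^esub>i\<in>I. h (t i))" using assms(1) by (intro finsum) auto
  also have "\<dots> = (\<Oplus>\<^bsub>S\<^esub>i\<in>I. t' i)"
  proof (rule S.finsum_cong'[OF refl])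
    show "t' \<in> I \<rightarrow> carrier S" using assms closed by (metis Pi_I)
  qed (rule assms(2))
  finally show ?thesis .
qed

end

subsection \<open>Quotients\<close>

locale alg_ideal = alg R + ideal I R for R :: "('k::field, 'a) module" (structure) and I
begin

abbreviation "Q \<equiv> quot_alg R I"

lemma carrier_Q: "carrier Q = (\<lambda>x. I +> x) ` carrier R"
  by (auto simp: quot_alg_def FactRing_def A_RCOSETS_def')

lemma cls_eq_iff:
  assumes "x \<in> carrier R" "y \<in> carrier R"
  shows "I +> x = I +> y \<longleftrightarrow> x \<ominus> y \<in> I"
  using quotient_eq_iff_same_a_r_cos[OF is_ideal assms] by blast

lemma ring_Q: "ring Q"
proof -
  interpret Q: ring "R Quot I" by (rule quotient_is_ring)
  show ?thesis
  proof (rule ringI)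
    show "abelian_group Q"
      by (rule abelian_groupI)
         (use Q.add.l_inv_ex in \<open>auto simp: quot_alg_def Q.a_ac\<close>)
    show "Group.monoid Q"
      by (rule monoidI) (simp_all add: quot_alg_def Q.m_assoc)
  qed (simp_all add: quot_alg_def Q.l_distr Q.r_distr)
qed

text \<open>
  An ideal is closed under scalars because \<open>k \<odot> i = (k \<odot> \<one>) \<otimes> i\<close>. So the union
  that defines the scalar multiplication of a quotient runs over equal cosets.
\<close>

lemma cls_smult:
  assumes x: "x \<in> carrier R"
  shows "k \<odot>\<^bsub>Q\<^esub> (I +> x) = I +> (k \<odot> x)"
proof -
  have "I +> (k \<odot> y) = I +> (k \<odot> x)" if y: "y \<in> I +> x" for y
  proof -
    obtain i where i: "i \<in> I" "y = i \<oplus> x" using y by (auto simp: a_r_coset_def')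
    have "k \<odot> i = (k \<odot> \<one>) \<otimes> i" using i by (simp add: smult_mult_left a_Hcarr)
    then have "k \<odot> i \<in> I" using I_l_closed[OF i(1), of "k \<odot> \<one>"] by simp
    moreover have "k \<odot> y \<ominus> k \<odot> x = k \<odot> i"
      using i x by (simp add: smult_add_right a_Hcarr minus_eq a_assoc r_neg)
    ultimately show ?thesis
      using i x by (subst cls_eq_iff) (simp_all add: a_Hcarr)
  qed
  then have "(\<lambda>y. I +> (k \<odot> y)) ` (I +> x) = {I +> (k \<odot> x)}"
    using a_rcos_self[OF x] by blast
  then show ?thesis by (simp add: quot_alg_def)
qed

lemma cls_ring_hom: "(\<lambda>x. I +> x) \<in> ring_hom R Q"
  using rcos_ring_hom by (simp add: ring_hom_def quot_alg_def)

lemmas cls_simps =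
  ring_hom_closed[OF cls_ring_hom] ring_hom_mult[OF cls_ring_hom, symmetric]
  ring_hom_add[OF cls_ring_hom, symmetric]

lemma alg_Q: "alg Q"
proof -
  interpret Q: ring Q by (rule ring_Q)
  have cl: "X \<in> carrier Q \<Longrightarrow> (\<And>x. x \<in> carrier R \<Longrightarrow> X = I +> x \<Longrightarrow> P) \<Longrightarrow> P" for X P
    by (auto simp: carrier_Q)
  show ?thesis
  proof (intro alg.intro alg_axioms.intro ring_Q, goal_cases)
    case (1 x k) then show ?case by (elim cl) (simp add: cls_smult cls_simps)
  next
    case (2 x k l) then show ?case by (elim cl) (simp add: cls_smult cls_simps smult_add_left)
  next
    case (3 x y k) then show ?case by (elim cl) (simp add: cls_smult cls_simps smult_add_right)
  next
    case (4 x k l) then show ?case by (elim cl) (simp add: cls_smult cls_simps smult_smult)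
  next
    case (5 x) then show ?case by (elim cl) (simp add: cls_smult cls_simps)
  next
    case (6 x y k) then show ?case by (elim cl) (simp add: cls_smult cls_simps smult_mult_left)
  next
    case (7 x y k) then show ?case by (elim cl) (simp add: cls_smult cls_simps smult_mult_right)
  qed
qed

lemma cls_alg_hom: "(\<lambda>x. I +> x) \<in> alg_hom R Q"
  unfolding alg_hom_def
  by (intro CollectI conjI allI ballI cls_ring_hom cls_smult[symmetric])

end

text \<open>
  The universal property of a quotient by generators: the kernel is an ideal, so it contains the ideal generated
  by \<open>G\<close> as soon as it contains \<open>G\<close>.
\<close>

lemma quot_factor:
  fixes R :: "('k::field, 'a) module"
  assumes "alg R" "alg S" "h \<in> alg_hom R S" "G \<subseteq> carrier R"
    and zero: "\<And>x. x \<in> G \<Longrightarrow> h x = \<zero>\<^bsub>S\<^esub>"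
  obtains h' where "h' \<in> alg_hom (quot_alg R (genideal R G)) S"
    and "\<And>x. x \<in> carrier R \<Longrightarrow> h' (genideal R G +>\<^bsub>R\<^esub> x) = h x"
proof -
  interpret alg_morphism R S h
    by (intro alg_morphism.intro alg_morphism_axioms.intro assms)
  interpret alg_ideal R "genideal R G"
    by (intro alg_ideal.intro R.alg_axioms R.genideal_ideal assms(4))
  define h' where "h' X = the_elem (h ` X)" for X
  have ker: "genideal R G \<subseteq> a_kernel R S h"
  proof (rule R.genideal_minimal[OF kernel_is_ideal], rule subsetI)
    fix x assume "x \<in> G"
    then show "x \<in> a_kernel R S h" using zero assms(4) unfolding a_kernel_def' by blast
  qed
  have h': "h' (genideal R G +>\<^bsub>R\<^esub> x) = h x" if x: "x \<in> carrier R" for x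
  proof -
    have "h y = h x" if y: "y \<in> genideal R G +>\<^bsub>R\<^esub> x" for y
    proof -
      obtain i where i: "i \<in> genideal R G" "y = i \<oplus>\<^bsub>R\<^esub> x" using y by (auto simp: a_r_coset_def')
      then have "h i = \<zero>\<^bsub>S\<^esub>" "i \<in> carrier R" using ker unfolding a_kernel_def' by blast+
      then show ?thesis using x i(2) by (simp add: add)
    qed
    then have "h ` (genideal R G +>\<^bsub>R\<^esub> x) = {h x}"
      using a_rcos_self[OF x] by blast
    then show ?thesis by (simp add: h'_def)
  qed
  have cl: "X \<in> carrier Q \<Longrightarrow> (\<And>x. x \<in> carrier R \<Longrightarrow> X = genideal R G +>\<^bsub>R\<^esub> x \<Longrightarrow> P) \<Longrightarrow> P" for X P
    by (auto simp: carrier_Q)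
  have "h' \<in> alg_hom Q S"
  proof (rule alg_homI)
    show "h' \<one>\<^bsub>Q\<^esub> = \<one>\<^bsub>S\<^esub>"
      using h'[of "\<one>\<^bsub>R\<^esub>"] ring_hom_one[OF cls_ring_hom] by simp
  next
    fix X assume "X \<in> carrier Q"
    then show "h' X \<in> carrier S" by (elim cl) (simp add: h')
  next
    fix X Y assume "X \<in> carrier Q" "Y \<in> carrier Q"
    then show "h' (X \<otimes>\<^bsub>Q\<^esub> Y) = h' X \<otimes>\<^bsub>S\<^esub> h' Y" "h' (X \<oplus>\<^bsub>Q\<^esub> Y) = h' X \<oplus>\<^bsub>S\<^esub> h' Y"
      by (elim cl; simp add: cls_simps h' mult add)+
  next
    fix X k assume "X \<in> carrier Q"
    then show "h' (k \<odot>\<^bsub>Q\<^esub> X) = k \<odot>\<^bsub>S\<^esub> h' X"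
      by (elim cl) (simp add: cls_smult h' smult)
  qed
  then show ?thesis using h' that by blast
qed

lemma alg_isoI:
  fixes R :: "('k::field, 'a) module"
  assumes "\<phi> \<in> alg_hom R S" "\<psi> \<in> alg_hom S R"
    and "\<And>x. x \<in> carrier R \<Longrightarrow> \<psi> (\<phi> x) = x" "\<And>y. y \<in> carrier S \<Longrightarrow> \<phi> (\<psi> y) = y"
  shows "\<phi> \<in> alg_iso R S"
proof -
  have "bij_betw \<phi> (carrier R) (carrier S)"
    using assms by (intro bij_betwI[where g = \<psi>]) (auto simp: alg_hom_def ring_hom_def)
  then show ?thesis using assms(1) by (auto simp: alg_iso_def ring_iso_def alg_hom_def)
qed

subsection \<open>Algebras with a multiplicative basis\<close>

lemma lookup_basis_smult [simp]:
  "Poly_Mapping.lookup (basis_smult k x) p = k * Poly_Mapping.lookup x p"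
  by (simp add: basis_smult_def Poly_Mapping.map.rep_eq when_def)

lemma basis_smult_add: "basis_smult k (x + y) = basis_smult k x + basis_smult k y"
  by (intro poly_mapping_eqI) (simp add: lookup_add distrib_left)

lemma basis_smult_single [simp]:
  "basis_smult k (Poly_Mapping.single p l) = Poly_Mapping.single p (k * l)"
  by (intro poly_mapping_eqI) (simp add: lookup_single when_def)

lemma basis_smult_opt_single [simp]: "basis_smult k (opt_single r l) = opt_single r (k * l)"
  by (cases r) (auto simp: opt_single_def intro!: poly_mapping_eqI)

lemma basis_smult_0 [simp]: "basis_smult k 0 = 0"
  by (intro poly_mapping_eqI) simp

lemma keys_basis_smult: "Poly_Mapping.keys (basis_smult k x) \<subseteq> Poly_Mapping.keys x"
  by (auto simp: in_keys_iff)

lemma basis_mult_smult: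
  fixes x y :: "'p \<Rightarrow>\<^sub>0 'k::field"
  shows "basis_mult c (basis_smult k x) y = basis_smult k (basis_mult c x y)"
    "basis_mult c x (basis_smult k y) = basis_smult k (basis_mult c x y)"
proof -
  have sum: "basis_smult k (\<Sum>i\<in>I. f i) = (\<Sum>i\<in>I. basis_smult k (f i))" for I :: "'p set" and f :: "'p \<Rightarrow> 'p \<Rightarrow>\<^sub>0 'k"
    by (induction I rule: infinite_finite_induct) (simp_all add: basis_smult_add)
  note s = basis_mult_sum[where S = "Poly_Mapping.keys x" and T = "Poly_Mapping.keys y"]
  show "basis_mult c (basis_smult k x) y = basis_smult k (basis_mult c x y)"
    by (simp add: s keys_basis_smult sum mult.assoc)
  show "basis_mult c x (basis_smult k y) = basis_smult k (basis_mult c x y)"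
    by (simp add: s keys_basis_smult sum mult.left_commute)
qed

lemma basis_alg_uminus:
  fixes x :: "'p \<Rightarrow>\<^sub>0 'k::field"
  assumes "ring (basis_alg B c U :: ('k, 'p \<Rightarrow>\<^sub>0 'k) module)" "x \<in> carrier (basis_alg B c U)"
  shows "\<ominus>\<^bsub>basis_alg B c U\<^esub> x = - x" "- x \<in> carrier (basis_alg B c U)"
proof -
  interpret ring "basis_alg B c U :: ('k, 'p \<Rightarrow>\<^sub>0 'k) module" by fact
  show *: "- x \<in> carrier (basis_alg B c U)" using assms(2) by (simp add: basis_alg_def)
  show "\<ominus>\<^bsub>basis_alg B c U\<^esub> x = - x"
    by (rule minus_equality) (use assms * in \<open>simp_all add: basis_alg_def\<close>)
qed

lemma basis_alg_diff:
  fixes x y :: "'p \<Rightarrow>\<^sub>0 'k::field"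
  assumes "ring (basis_alg B c U :: ('k, 'p \<Rightarrow>\<^sub>0 'k) module)" "y \<in> carrier (basis_alg B c U)"
  shows "x \<ominus>\<^bsub>basis_alg B c U\<^esub> y = x - y"
  unfolding a_minus_def basis_alg_uminus(1)[OF assms] by (simp add: basis_alg_def)

lemma alg_basis_alg:
  assumes "ring (basis_alg B c U :: ('k::field, 'p \<Rightarrow>\<^sub>0 'k) module)"
  shows "alg (basis_alg B c U :: ('k::field, 'p \<Rightarrow>\<^sub>0 'k) module)"
proof -
  interpret ring "basis_alg B c U :: ('k::field, 'p \<Rightarrow>\<^sub>0 'k) module" by fact
  show ?thesis
    by unfold_locales
       (use keys_basis_smult in \<open>auto intro!: poly_mapping_eqI
          simp: basis_alg_def basis_mult_smult basis_smult_add lookup_add algebra_simps subset_iff in_keys_iff\<close>)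
qed

text \<open>
  The linear extension of \<open>m\<close> is multiplicative because both sides of the equation are bilinear, so
  that it is enough to compare products of basis elements. Setting \<open>m\<close> to \<open>\<zero>\<close> outside the basis makes
  the extension a total function with values in the carrier.
\<close>

lemma (in alg) basis_alg_lift:
  assumes m: "\<And>p. p \<in> B \<Longrightarrow> m p \<in> carrier S"
    and U: "finite U" "U \<subseteq> B" "(\<Oplus>u\<in>U. m u) = \<one>"
    and closed: "\<And>p q r. p \<in> B \<Longrightarrow> q \<in> B \<Longrightarrow> c p q = Some r \<Longrightarrow> r \<in> B"
    and mult: "\<And>p q. p \<in> B \<Longrightarrow> q \<in> B \<Longrightarrow>
      m p \<otimes> m q = (case c p q of None \<Rightarrow> \<zero> | Some r \<Rightarrow> m r)"
  obtains h where "h \<in> alg_hom (basis_alg B c U) S"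
    and "\<And>p. p \<in> B \<Longrightarrow> h (Poly_Mapping.single p 1) = m p"
proof -
  define n where "n p = (if p \<in> B then m p else \<zero>)" for p
  have n: "n p \<in> carrier S" for p by (simp add: n_def m)
  define h where "h x = (\<Oplus>p\<in>Poly_Mapping.keys x. Poly_Mapping.lookup x p \<odot> n p)" for x :: "'b \<Rightarrow>\<^sub>0 'k"
  have sum: "h x = (\<Oplus>p\<in>T. Poly_Mapping.lookup x p \<odot> n p)" if "finite T" "Poly_Mapping.keys x \<subseteq> T" for x T
    unfolding h_def
    by (rule add.finprod_mono_neutral_cong_left) (use that n in \<open>auto simp: in_keys_iff\<close>)
  have cl: "h x \<in> carrier S" for x using n by (auto simp: h_def)
  have add: "h (x + y) = h x \<oplus> h y" for x y
  proof -
    let ?T = "Poly_Mapping.keys x \<union> Poly_Mapping.keys y"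
    have "h (x + y) = (\<Oplus>p\<in>?T. Poly_Mapping.lookup (x + y) p \<odot> n p)" by (intro sum keys_add) simp
    also have "\<dots> = (\<Oplus>p\<in>?T. Poly_Mapping.lookup x p \<odot> n p \<oplus> Poly_Mapping.lookup y p \<odot> n p)"
      using n by (intro finsum_cong') (auto simp: lookup_add smult_add_left)
    also have "\<dots> = (\<Oplus>p\<in>?T. Poly_Mapping.lookup x p \<odot> n p) \<oplus> (\<Oplus>p\<in>?T. Poly_Mapping.lookup y p \<odot> n p)"
      using n by (intro finsum_addf) auto
    also have "\<dots> = h x \<oplus> h y" by (subst (1 2) sum[where T = ?T]) auto
    finally show ?thesis .
  qed
  have scale: "h (basis_smult k x) = k \<odot> h x" for k x
  proof -
    have "h (basis_smult k x) = (\<Oplus>p\<in>Poly_Mapping.keys x. k \<odot> (Poly_Mapping.lookup x p \<odot> n p))"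
      using n by (subst sum[where T = "Poly_Mapping.keys x"]) (auto simp: keys_basis_smult smult_smult)
    then show ?thesis unfolding h_def using n by (subst smult_finsum) auto
  qed
  have single: "h (Poly_Mapping.single p k) = k \<odot> n p" for p k
    using n by (subst sum[where T = "{p}"]) auto
  have opt: "h (opt_single (c p q) k) = k \<odot> (n p \<otimes> n q)" if "p \<in> B" "q \<in> B" for p q k
    using that mult[OF that] closed[OF that] sum[of "{}" 0]
    by (auto simp: opt_single_def single n_def split: option.split)
  have 1: "h (basis_mult c (Poly_Mapping.single p k) y) = h (Poly_Mapping.single p k) \<otimes> h y"
    if p: "p \<in> B" and y: "Poly_Mapping.keys y \<subseteq> B" for p k y
    using y
  proof (rule finsupp_induct)
    fix q l z
    assume "q \<in> B" "h (basis_mult c (Poly_Mapping.single p k) z) = h (Poly_Mapping.single p k) \<otimes> h z"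
    then show "h (basis_mult c (Poly_Mapping.single p k) (Poly_Mapping.single q l + z))
        = h (Poly_Mapping.single p k) \<otimes> h (Poly_Mapping.single q l + z)"
      using p n by (simp add: basis_mult_add_right add cl r_distr)
        (simp add: basis_mult_single opt single smult_mult_left smult_mult_right smult_smult mult.commute)
  qed (use cl[of "Poly_Mapping.single p k"] sum[of "{}" 0] in simp)
  have 2: "h (basis_mult c x y) = h x \<otimes> h y"
    if x: "Poly_Mapping.keys x \<subseteq> B" and y: "Poly_Mapping.keys y \<subseteq> B" for x y
    using x
  proof (rule finsupp_induct)
    fix q l z assume "q \<in> B" "h (basis_mult c z y) = h z \<otimes> h y"
    then show "h (basis_mult c (Poly_Mapping.single q l + z) y) = h (Poly_Mapping.single q l + z) \<otimes> h y"
      using y by (simp add: basis_mult_add_left add cl 1 l_distr)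
  qed (use cl[of y] sum[of "{}" 0] in simp)
  have one: "h (\<Sum>u\<in>W. Poly_Mapping.single u 1) = (\<Oplus>u\<in>W. n u)" if "finite W" for W
    using that by induction (use n sum[of "{}" 0] in \<open>simp_all add: add single Pi_def\<close>)
  have "(\<Oplus>u\<in>U. n u) = \<one>"
    unfolding U(3)[symmetric] using U(2) m by (intro finsum_cong') (auto simp: n_def)
  then have "h \<in> alg_hom (basis_alg B c U) S"
    by (intro alg_homI) (simp_all add: basis_alg_def cl add 2 scale one U(1))
  moreover have "h (Poly_Mapping.single p 1) = m p" if "p \<in> B" for p
    using that m by (simp add: single n_def)
  ultimately show ?thesis using that by blast
qed

lemma basis_alg_hom_eqI:
  fixes h h' :: "('p \<Rightarrow>\<^sub>0 'k::field) \<Rightarrow> 'a"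
  assumes R: "alg (basis_alg B c U :: ('k, 'p \<Rightarrow>\<^sub>0 'k) module)" and S: "alg S"
    and h: "h \<in> alg_hom (basis_alg B c U) S" "h' \<in> alg_hom (basis_alg B c U) S"
    and eq: "\<And>p. p \<in> B \<Longrightarrow> h (Poly_Mapping.single p 1) = h' (Poly_Mapping.single p 1)"
    and x: "x \<in> carrier (basis_alg B c U)"
  shows "h x = h' x"
proof -
  interpret h: alg_morphism "basis_alg B c U" S h using R S h by (simp add: alg_morphism_def alg_morphism_axioms_def)
  interpret h': alg_morphism "basis_alg B c U" S h' using R S h by (simp add: alg_morphism_def alg_morphism_axioms_def)
  note hs = h.add h.smult h.hom_zero and hs' = h'.add h'.smult h'.hom_zero
  have sgl: "h (Poly_Mapping.single p k) = h' (Poly_Mapping.single p k)" if "p \<in> B" for p k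
    using h.smult[of "Poly_Mapping.single p 1" k] h'.smult[of "Poly_Mapping.single p 1" k] that eq[OF that]
    by (simp add: basis_alg_def)
  have "Poly_Mapping.keys x \<subseteq> B" using x by (simp add: basis_alg_def)
  then have "Poly_Mapping.keys x \<subseteq> B \<and> h x = h' x"
  proof (rule finsupp_induct)
    show "Poly_Mapping.keys 0 \<subseteq> B \<and> h 0 = h' 0"
      using h.hom_zero h'.hom_zero by (simp add: basis_alg_def)
  next
    fix p k y assume p: "p \<in> B" and IH: "Poly_Mapping.keys y \<subseteq> B \<and> h y = h' y"
    have "Poly_Mapping.keys (Poly_Mapping.single p k + y) \<subseteq> B"
      using p IH keys_add[of "Poly_Mapping.single p k" y] by (auto split: if_splits)
    moreover have "Poly_Mapping.single p k \<in> carrier (basis_alg B c U)" "y \<in> carrier (basis_alg B c U)"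
      using p IH by (auto simp: basis_alg_def)
    ultimately show "Poly_Mapping.keys (Poly_Mapping.single p k + y) \<subseteq> B
        \<and> h (Poly_Mapping.single p k + y) = h' (Poly_Mapping.single p k + y)"
      using h.add h'.add IH sgl[OF p] by (simp add: basis_alg_def)
  qed
  then show ?thesis by simp
qed

subsection \<open>Homomorphisms from free algebras and path algebras\<close>

lemma free_gen_in_free_alg: "x \<in> G \<Longrightarrow> free_gen x \<in> carrier (free_alg G)"
  by (simp add: free_alg_def basis_alg_def free_gen_def)

lemma alg_free_alg: "alg (free_alg G)"
  using ring_free_alg alg_basis_alg unfolding free_alg_def by blast

text \<open>
  A word goes to the product of the images of its letters.
\<close>

lemma (in alg) free_alg_lift:
  assumes g: "\<And>x. x \<in> G \<Longrightarrow> g x \<in> carrier S"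
  obtains h where "h \<in> alg_hom (free_alg G) S" "\<And>x. x \<in> G \<Longrightarrow> h (free_gen x) = g x"
proof -
  define m where "m = (\<lambda>w. foldr (\<lambda>x y. g x \<otimes> y) w \<one>)"
  have cl: "m w \<in> carrier S" if "w \<in> lists G" for w
    using that by induction (simp_all add: m_def g)
  have app: "m v \<otimes> m w = m (v @ w)" if "v \<in> lists G" "w \<in> lists G" for v w
    using that(1)
  proof induction
    case Nil show ?case using cl[OF that(2)] by (simp add: m_def)
  next
    case (Cons x v)
    then show ?case using cl[OF that(2)] cl[OF Cons(2)] by (simp add: m_def g m_assoc)
  qed
  obtain h where "h \<in> alg_hom (free_alg G) S" "\<And>w. w \<in> lists G \<Longrightarrow> h (Poly_Mapping.single w 1) = m w"
    unfolding free_alg_def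
    by (rule basis_alg_lift[of "lists G" m "{[]}" "\<lambda>v w. Some (v @ w)"]) (auto simp: cl app, simp add: m_def)
  then show ?thesis using that by (simp add: free_gen_def m_def g)
qed

lemma free_alg_hom_eqI:
  assumes S: "alg S" and h: "h \<in> alg_hom (free_alg G) S" "h' \<in> alg_hom (free_alg G) S"
    and eq: "\<And>x. x \<in> G \<Longrightarrow> h (free_gen x) = h' (free_gen x)"
    and x: "x \<in> carrier (free_alg G)"
  shows "h x = h' x"
proof -
  interpret h: alg_morphism "free_alg G" S h
    by (intro alg_morphism.intro alg_morphism_axioms.intro alg_free_alg S h)
  interpret h': alg_morphism "free_alg G" S h'
    by (intro alg_morphism.intro alg_morphism_axioms.intro alg_free_alg S h)
  have word: "h (Poly_Mapping.single w 1) = h' (Poly_Mapping.single w 1)" if "w \<in> lists G" for w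
    using that
  proof induction
    case Nil show ?case using h.one h'.one by (simp add: free_alg_def basis_alg_def)
  next
    case (Cons x w)
    have "Poly_Mapping.single (x # w) 1 = free_gen x \<otimes>\<^bsub>free_alg G\<^esub> Poly_Mapping.single w 1"
      by (simp add: free_alg_def basis_alg_def basis_mult_single free_gen_def opt_single_def)
    moreover have "Poly_Mapping.single w 1 \<in> carrier (free_alg G)" using Cons(2)
      by (simp add: free_alg_def basis_alg_def)
    ultimately show ?case using Cons eq h.mult h'.mult free_gen_in_free_alg by metis
  qed
  show ?thesis
    using basis_alg_hom_eqI[OF _ S, of "lists G" "\<lambda>v w. Some (v @ w)" "{[]}"]
      alg_free_alg h word x unfolding free_alg_def by blast
qed

lemma alg_path_alg: "fin_digraph Q \<Longrightarrow> alg (path_alg Q)"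
  using ring_path_alg alg_basis_alg unfolding path_alg_def by blast

lemma path_alg_gens:
  assumes "fin_digraph Q"
  shows "v \<in> verts Q \<Longrightarrow> vertex_idem v \<in> carrier (path_alg Q)"
    and "e \<in> arcs Q \<Longrightarrow> arrow_elt Q e \<in> carrier (path_alg Q)"
proof -
  interpret fin_digraph Q by fact
  show "v \<in> verts Q \<Longrightarrow> vertex_idem v \<in> carrier (path_alg Q)"
    by (simp add: path_alg_def basis_alg_def vertex_idem_def awalk_Nil_iff)
  show "e \<in> arcs Q \<Longrightarrow> arrow_elt Q e \<in> carrier (path_alg Q)"
    by (simp add: path_alg_def basis_alg_def arrow_elt_def arc_implies_awalk)
qed

lemma (in wf_digraph) awalk_snocE:
  assumes "awalk u (p @ [e]) v"
  obtains "awalk u p (tail G e)" "e \<in> arcs G" "v = head G e"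
  using assms by (auto simp: awalk_append_iff awalk_Cons_iff awalk_Nil_iff)

text \<open>
  A path goes to the product of the images of its arrows, the first arrow being the rightmost factor, which multiplies the
  idempotent of the source. When two paths cannot be composed, the product of their images is \<open>\<zero>\<close>,
  since it contains a product of two distinct idempotents.
\<close>

lemma (in alg) path_alg_lift:
  assumes Q: "fin_digraph Q"
    and U: "\<And>v. v \<in> verts Q \<Longrightarrow> U v \<in> carrier S"
    and orth: "\<And>v w. v \<in> verts Q \<Longrightarrow> w \<in> verts Q \<Longrightarrow> U v \<otimes> U w = (if v = w then U v else \<zero>)"
    and sum: "(\<Oplus>v\<in>verts Q. U v) = \<one>"
    and arr: "\<And>e. e \<in> arcs Q \<Longrightarrow> \<alpha> e \<in> carrier S"
      "\<And>e. e \<in> arcs Q \<Longrightarrow> U (head Q e) \<otimes> \<alpha> e = \<alpha> e"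
      "\<And>e. e \<in> arcs Q \<Longrightarrow> \<alpha> e \<otimes> U (tail Q e) = \<alpha> e"
  obtains h where "h \<in> alg_hom (path_alg Q) S" "\<And>v. v \<in> verts Q \<Longrightarrow> h (vertex_idem v) = U v"
    "\<And>e. e \<in> arcs Q \<Longrightarrow> h (arrow_elt Q e) = \<alpha> e"
proof -
  interpret Q: fin_digraph Q by fact
  define m where "m = (\<lambda>(u, p, v::'b). foldl (\<lambda>x e. \<alpha> e \<otimes> x) (U u) p)"
  have m0: "m (u, [], v) = U u" and m1: "m (u, p @ [e], v) = \<alpha> e \<otimes> m (u, p, w)" for u p e v w
    by (simp_all add: m_def)
  have val: "m (u, p, v) \<in> carrier S \<and> U v \<otimes> m (u, p, v) = m (u, p, v) \<and> m (u, p, v) \<otimes> U u = m (u, p, v)"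
    if "Q.awalk u p v" for u p v
    using that
  proof (induction p arbitrary: v rule: rev_induct)
    case Nil
    then have "u = v" "v \<in> verts Q" by (auto simp: Q.awalk_Nil_iff)
    then show ?case using orth[of v v] by (simp add: m0 U)
  next
    case (snoc e p)
    from snoc.prems show ?case
    proof (rule Q.awalk_snocE)
      assume w: "Q.awalk u p (tail Q e)" and e: "e \<in> arcs Q" and v: "v = head Q e"
      note IH = snoc.IH[OF w]
      have "u \<in> verts Q" using w by auto
      then show ?thesis
        using IH e arr[OF e] U v
        by (simp add: m1[where w = "tail Q e"] m_assoc[symmetric]) (simp add: m_assoc)
    qed
  qed
  have app: "m (v', p, v) \<otimes> m (u', p', v') = m (u', p' @ p, v)"
    if "Q.awalk v' p v" "Q.awalk u' p' v'" for u' p' v' p v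
    using that(1)
  proof (induction p arbitrary: v rule: rev_induct)
    case Nil
    then show ?case using val[OF that(2)] by (simp add: m0) (simp add: m_def)
  next
    case (snoc e p)
    from snoc.prems show ?case
    proof (rule Q.awalk_snocE)
      assume w: "Q.awalk v' p (tail Q e)" and e: "e \<in> arcs Q" and v: "v = head Q e"
      show ?thesis
        using snoc.IH[OF w] val[OF w] val[OF that(2)] arr(1)[OF e]
        by (simp add: m1[where w = "tail Q e"] m_assoc append.assoc[symmetric] del: append.assoc append_assoc)
    qed
  qed
  obtain h where h: "h \<in> alg_hom (path_alg Q) S"
    "\<And>p. p \<in> {(u, p, v). Q.awalk u p v} \<Longrightarrow> h (Poly_Mapping.single p 1) = m p"
    unfolding path_alg_def
  proof (rule basis_alg_lift[of "{(u, p, v). Q.awalk u p v}" m "(\<lambda>v. (v, [], v)) ` verts Q" path_comp], goal_cases)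
    case (1 p) then show ?case using val by auto
  next
    case 4
    have "(\<Oplus>u\<in>(\<lambda>v. (v, [], v)) ` verts Q. m u) = (\<Oplus>v\<in>verts Q. m (v, [], v))"
      by (rule add.finprod_reindex) (auto simp: m0 U inj_on_def)
    then show ?case using sum by (simp add: m0)
  next
    case (5 p q r) then show ?case by (auto simp: path_comp_def split: if_splits)
  next
    case (6 p q)
    obtain u a v u' b v' where pq: "p = (u, a, v)" "q = (u', b, v')" "Q.awalk u a v" "Q.awalk u' b v'"
      using 6 by auto
    show ?case
    proof (cases "u = v'")
      case True then show ?thesis using pq app by (simp add: path_comp_def)
    next
      case False
      have V: "u \<in> verts Q" "v' \<in> verts Q" using pq by auto
      have c: "m p \<in> carrier S" "m q \<in> carrier S" "m p \<otimes> U u = m p" "U v' \<otimes> m q = m q"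
        using val pq by auto
      have "m p \<otimes> m q = (m p \<otimes> U u) \<otimes> (U v' \<otimes> m q)" using c by simp
      also have "\<dots> = m p \<otimes> ((U u \<otimes> U v') \<otimes> m q)" using c(1,2) V U by (simp add: m_assoc)
      also have "\<dots> = \<zero>" using c V False orth by simp
      finally show ?thesis using pq False by (simp add: path_comp_def)
    qed
  qed (auto simp: Q.awalk_Nil_iff)
  moreover have "h (vertex_idem v) = U v" if "v \<in> verts Q" for v
    using that by (simp add: vertex_idem_def h(2) Q.awalk_Nil_iff m0)
  moreover have "h (arrow_elt Q e) = \<alpha> e" if "e \<in> arcs Q" for e
    using that arr by (simp add: arrow_elt_def h(2) Q.arc_implies_awalk m_def)
  ultimately show ?thesis using that by blast
qed

lemma path_alg_hom_eqI:
  assumes Q: "fin_digraph Q" and S: "alg S"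
    and h: "h \<in> alg_hom (path_alg Q) S" "h' \<in> alg_hom (path_alg Q) S"
    and eqv: "\<And>v. v \<in> verts Q \<Longrightarrow> h (vertex_idem v) = h' (vertex_idem v)"
    and eqa: "\<And>e. e \<in> arcs Q \<Longrightarrow> h (arrow_elt Q e) = h' (arrow_elt Q e)"
    and x: "x \<in> carrier (path_alg Q)"
  shows "h x = h' x"
proof -
  interpret Q: fin_digraph Q by fact
  interpret h: alg_morphism "path_alg Q" S h
    by (intro alg_morphism.intro alg_morphism_axioms.intro alg_path_alg Q S h)
  interpret h': alg_morphism "path_alg Q" S h'
    by (intro alg_morphism.intro alg_morphism_axioms.intro alg_path_alg Q S h)
  have path: "h (Poly_Mapping.single (u, p, v) 1) = h' (Poly_Mapping.single (u, p, v) 1)"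
    if "Q.awalk u p v" for u p v
    using that
  proof (induction p arbitrary: v rule: rev_induct)
    case Nil then show ?case using eqv by (auto simp: Q.awalk_Nil_iff vertex_idem_def)
  next
    case (snoc e p)
    from snoc.prems show ?case
    proof (rule Q.awalk_snocE)
      assume w: "Q.awalk u p (tail Q e)" and e: "e \<in> arcs Q" and v: "v = head Q e"
      have "Poly_Mapping.single (u, p @ [e], v) 1 =
          arrow_elt Q e \<otimes>\<^bsub>path_alg Q\<^esub> Poly_Mapping.single (u, p, tail Q e) 1"
        using v by (simp add: path_alg_def basis_alg_def basis_mult_single arrow_elt_def path_comp_def opt_single_def)
      moreover have "Poly_Mapping.single (u, p, tail Q e) 1 \<in> carrier (path_alg Q)"
        using w by (simp add: path_alg_def basis_alg_def)
      ultimately show ?thesis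
        using snoc.IH[OF w] eqa[OF e] h.mult h'.mult path_alg_gens(2)[OF Q e] by metis
    qed
  qed
  show ?thesis
    using basis_alg_hom_eqI[OF _ S, of "{(u, p, v). Q.awalk u p v}" path_comp "(\<lambda>v. (v, [], v)) ` verts Q"]
      alg_path_alg[OF Q] h path x unfolding path_alg_def by auto
qed

section \<open>Linear maps on coordinate spaces\<close>

lemma basis_vec_coord: "i \<in> I \<Longrightarrow> basis_vec i \<in> coord_space I"
  by (simp add: coord_space_def basis_vec_def)

text \<open>
  The generators \<open>hA a\<close>, \<open>hX x\<close> of the free algebra are indexed by all vectors; once the
  linearity relations hold, this reduces everything about them to basis vectors.
\<close>

lemma (in alg) linear_expand:
  assumes "finite I"
    and T: "\<And>x. x \<in> coord_space I \<Longrightarrow> T x \<in> carrier S"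
    and add: "\<And>x y. x \<in> coord_space I \<Longrightarrow> y \<in> coord_space I \<Longrightarrow> T (x + y) = T x \<oplus> T y"
    and scale: "\<And>k x. x \<in> coord_space I \<Longrightarrow> T (scale k x) = k \<odot> T x"
    and a: "a \<in> coord_space I"
  shows "T a = (\<Oplus>i\<in>I. a i \<odot> T (basis_vec i))"
proof -
  have "T (\<lambda>i. if i \<in> J then a i else 0) = (\<Oplus>i\<in>J. a i \<odot> T (basis_vec i))" if "finite J" "J \<subseteq> I" for J
    using that
  proof (induction J)
    case empty
    have "scale 0 a = (\<lambda>i. 0)" by (simp add: scale_def)
    then show ?case using scale[OF a, of 0] T[OF a] by simp
  next
    case (insert j J)
    have *: "(\<lambda>i. if i \<in> insert j J then a i else 0)
        = scale (a j) (basis_vec j) + (\<lambda>i. if i \<in> J then a i else 0)"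
      using insert by (auto simp: scale_def basis_vec_def fun_eq_iff)
    have "scale (a j) (basis_vec j) \<in> coord_space I" "(\<lambda>i. if i \<in> J then a i else 0) \<in> coord_space I"
      "basis_vec i \<in> coord_space I" if "i \<in> insert j J" for i
      using insert that by (auto simp: coord_space_def scale_def basis_vec_def)
    note c = this
    have t: "T (basis_vec i) \<in> carrier S" if "i \<in> insert j J" for i using T c(3)[OF that] .
    have "T (\<lambda>i. if i \<in> insert j J then a i else 0)
        = a j \<odot> T (basis_vec j) \<oplus> T (\<lambda>i. if i \<in> J then a i else 0)"
      unfolding * using add[OF c(1)[of j] c(2)[of j]] scale[OF c(3)[of j], of "a j"] by simp
    also have "\<dots> = (\<Oplus>i\<in>insert j J. a i \<odot> T (basis_vec i))"
      using insert t by (subst finsum_insert) auto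
    finally show ?case .
  qed
  moreover have "(\<lambda>i. if i \<in> I then a i else 0) = a"
    using a by (auto simp: coord_space_def fun_eq_iff)
  ultimately show ?thesis using \<open>finite I\<close> by (metis subset_refl)
qed

definition (in alg) linear_map :: "'i set \<Rightarrow> (('i \<Rightarrow> 'k) \<Rightarrow> 'a) \<Rightarrow> bool" where
  "linear_map I T \<longleftrightarrow> (\<forall>x\<in>coord_space I. T x \<in> carrier S) \<and>
     (\<forall>x\<in>coord_space I. \<forall>y\<in>coord_space I. T (x + y) = T x \<oplus> T y) \<and>
     (\<forall>k. \<forall>x\<in>coord_space I. T (scale k x) = k \<odot> T x)"

context alg
begin

lemma linear_mapD:
  assumes "linear_map I T"
  shows "x \<in> coord_space I \<Longrightarrow> T x \<in> carrier S"
    "x \<in> coord_space I \<Longrightarrow> y \<in> coord_space I \<Longrightarrow> T (x + y) = T x \<oplus> T y"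
    "x \<in> coord_space I \<Longrightarrow> T (scale k x) = k \<odot> T x"
  using assms by (auto simp: linear_map_def)

lemma linear_eqI:
  assumes I: "finite I" and T: "linear_map I T" "linear_map I T'"
    and eq: "\<And>i. i \<in> I \<Longrightarrow> T (basis_vec i) = T' (basis_vec i)" and x: "x \<in> coord_space I"
  shows "T x = T' x"
proof -
  have "T x = (\<Oplus>i\<in>I. x i \<odot> T (basis_vec i))" using linear_mapD[OF T(1)] x by (intro linear_expand I)
  also have "\<dots> = (\<Oplus>i\<in>I. x i \<odot> T' (basis_vec i))"
    using linear_mapD(1)[OF T(2)] eq by (intro finsum_cong') (auto simp: basis_vec_coord)
  also have "\<dots> = T' x" using linear_mapD[OF T(2)] x by (intro linear_expand[symmetric] I)
  finally show ?thesis .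
qed

lemma linear_map_mult:
  assumes "linear_map I T" "y \<in> carrier S"
  shows "linear_map I (\<lambda>x. y \<otimes> T x)" "linear_map I (\<lambda>x. T x \<otimes> y)"
  using assms by (auto simp: linear_map_def coord_space_closed r_distr l_distr smult_mult_left smult_mult_right)

lemma linear_map_add:
  assumes "linear_map I T" "linear_map I T'"
  shows "linear_map I (\<lambda>x. T x \<oplus> T' x)"
  using assms by (auto simp: linear_map_def coord_space_closed a_ac smult_add_right)

lemma linear_map_minus:
  assumes "linear_map I T"
  shows "linear_map I (\<lambda>x. \<ominus> T x)"
  using assms by (auto simp: linear_map_def coord_space_closed minus_add smult_minus_right)

lemma linear_map_diff:
  assumes "linear_map I T" "linear_map I T'"
  shows "linear_map I (\<lambda>x. T x \<ominus> T' x)"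
  unfolding minus_eq by (intro linear_map_add linear_map_minus assms)

lemma linear_map_finsum:
  fixes T :: "'j \<Rightarrow> ('i \<Rightarrow> 'k) \<Rightarrow> 'a"
  assumes "\<And>j. j \<in> J \<Longrightarrow> linear_map I (T j)"
  shows "linear_map I (\<lambda>x. \<Oplus>j\<in>J. T j x)"
  unfolding linear_map_def
proof (intro conjI ballI allI)
  fix x y :: "'i \<Rightarrow> 'k" and k assume x: "x \<in> coord_space I"
  note T = linear_mapD[OF assms]
  show "(\<Oplus>j\<in>J. T j x) \<in> carrier S" using x T by (intro finsum_closed) auto
  have "(\<Oplus>j\<in>J. T j (scale k x)) = (\<Oplus>j\<in>J. k \<odot> T j x)" using x T by (intro finsum_cong') auto
  also have "\<dots> = k \<odot> (\<Oplus>j\<in>J. T j x)" using x T by (intro smult_finsum[symmetric]) auto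
  finally show "(\<Oplus>j\<in>J. T j (scale k x)) = k \<odot> (\<Oplus>j\<in>J. T j x)" .
  assume y: "y \<in> coord_space I"
  have "(\<Oplus>j\<in>J. T j (x + y)) = (\<Oplus>j\<in>J. T j x \<oplus> T j y)" using x y T by (intro finsum_cong') auto
  also have "\<dots> = (\<Oplus>j\<in>J. T j x) \<oplus> (\<Oplus>j\<in>J. T j y)" using x y T by (intro finsum_addf) auto
  finally show "(\<Oplus>j\<in>J. T j (x + y)) = (\<Oplus>j\<in>J. T j x) \<oplus> (\<Oplus>j\<in>J. T j y)" .
qed

lemma linear_map_comp:
  assumes "linear_map J T"
    and "\<And>x. x \<in> coord_space I \<Longrightarrow> \<phi> x \<in> coord_space J"
    and "\<And>x y. x \<in> coord_space I \<Longrightarrow> y \<in> coord_space I \<Longrightarrow> \<phi> (x + y) = \<phi> x + \<phi> y"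
    and "\<And>k x. x \<in> coord_space I \<Longrightarrow> \<phi> (scale k x) = scale k (\<phi> x)"
  shows "linear_map I (\<lambda>x. T (\<phi> x))"
  using assms by (auto simp: linear_map_def)

definition comb :: "'i set \<Rightarrow> ('i \<Rightarrow> 'a) \<Rightarrow> ('i \<Rightarrow> 'k) \<Rightarrow> 'a" where
  "comb I v x = (\<Oplus>i\<in>I. x i \<odot> v i)"

lemma linear_map_comb:
  assumes "\<And>i. i \<in> I \<Longrightarrow> v i \<in> carrier S"
  shows "linear_map I (comb I v)"
  unfolding linear_map_def comb_def
proof (intro conjI ballI allI)
  fix x y :: "'b \<Rightarrow> 'k" and k
  show "(\<Oplus>i\<in>I. x i \<odot> v i) \<in> carrier S" using assms by (intro finsum_closed) auto
  have "(\<Oplus>i\<in>I. scale k x i \<odot> v i) = (\<Oplus>i\<in>I. k \<odot> (x i \<odot> v i))"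
    using assms by (intro finsum_cong') (auto simp: scale_def smult_smult)
  also have "\<dots> = k \<odot> (\<Oplus>i\<in>I. x i \<odot> v i)" using assms by (intro smult_finsum[symmetric]) auto
  finally show "(\<Oplus>i\<in>I. scale k x i \<odot> v i) = k \<odot> (\<Oplus>i\<in>I. x i \<odot> v i)" .
  have "(\<Oplus>i\<in>I. (x + y) i \<odot> v i) = (\<Oplus>i\<in>I. x i \<odot> v i \<oplus> y i \<odot> v i)"
    using assms by (intro finsum_cong') (auto simp: smult_add_left)
  also have "\<dots> = (\<Oplus>i\<in>I. x i \<odot> v i) \<oplus> (\<Oplus>i\<in>I. y i \<odot> v i)"
    using assms by (intro finsum_addf) auto
  finally show "(\<Oplus>i\<in>I. (x + y) i \<odot> v i) = (\<Oplus>i\<in>I. x i \<odot> v i) \<oplus> (\<Oplus>i\<in>I. y i \<odot> v i)" .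
qed

lemma comb_basis:
  assumes "finite I" "j \<in> I" "\<And>i. i \<in> I \<Longrightarrow> v i \<in> carrier S"
  shows "comb I v (basis_vec j) = v j"
proof -
  have "v j \<in> carrier S" using assms by auto
  have "comb I v (basis_vec j) = (\<Oplus>i\<in>I. if j = i then v i else \<zero>)"
    unfolding comb_def using assms by (intro finsum_cong') (auto simp: basis_vec_def)
  also have "\<dots> = v j" using assms by (intro add.finprod_singleton) auto
  finally show ?thesis .
qed

end

section \<open>Sums and idempotents in a ring\<close>

context ring
begin

lemma finsum_neg: "F \<in> I \<rightarrow> carrier R \<Longrightarrow> (\<Oplus>i\<in>I. \<ominus> F i) = \<ominus> (\<Oplus>i\<in>I. F i)"
  by (induction I rule: infinite_finite_induct) (simp_all add: minus_add Pi_def)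

lemma neg_inject: "x \<in> carrier R \<Longrightarrow> y \<in> carrier R \<Longrightarrow> \<ominus> x = \<ominus> y \<longleftrightarrow> x = y"
  by (metis minus_minus)

lemma finsum_delta:
  assumes "finite I" "j \<in> I" "x \<in> carrier R"
  shows "(\<Oplus>i\<in>I. if i = j then x else \<zero>) = x"
  using add.finprod_singleton[OF assms(2,1), of "\<lambda>_. x"] assms(3) by (simp add: eq_commute[of j])

text \<open>
  Peirce decomposition: since both families sum to \<open>\<one>\<close>, every \<open>x\<close> is the sum of its corners
  \<open>u p \<otimes> x \<otimes> w q\<close>.
\<close>

lemma eqI_corners:
  assumes fin: "finite I"
    and u: "u \<in> I \<rightarrow> carrier R" "(\<Oplus>p\<in>I. u p) = \<one>" and w: "w \<in> I \<rightarrow> carrier R" "(\<Oplus>p\<in>I. w p) = \<one>"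
    and xy: "x \<in> carrier R" "y \<in> carrier R"
    and eq: "\<And>p q. p \<in> I \<Longrightarrow> q \<in> I \<Longrightarrow> u p \<otimes> x \<otimes> w q = u p \<otimes> y \<otimes> w q"
  shows "x = y"
proof -
  have c: "(\<Oplus>q\<in>I. u p \<otimes> z \<otimes> w q) \<in> carrier R" if "p \<in> I" "z \<in> carrier R" for p z
    using that funcset_mem[OF u(1) that(1)] w by (intro finsum_closed) auto
  have r: "(\<Oplus>p\<in>I. \<Oplus>q\<in>I. u p \<otimes> z \<otimes> w q) = z" if z: "z \<in> carrier R" for z
  proof -
    have "(\<Oplus>q\<in>I. u p \<otimes> z \<otimes> w q) = u p \<otimes> z" if "p \<in> I" for p
      using that z u w fin funcset_mem[OF u(1) that] by (subst finsum_rdistr[symmetric]) auto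
    then have "(\<Oplus>p\<in>I. \<Oplus>q\<in>I. u p \<otimes> z \<otimes> w q) = (\<Oplus>p\<in>I. u p \<otimes> z)"
      using z u by (intro finsum_cong') auto
    also have "\<dots> = z" using z u fin by (subst finsum_ldistr[symmetric]) auto
    finally show ?thesis .
  qed
  have row: "(\<Oplus>q\<in>I. u p \<otimes> x \<otimes> w q) = (\<Oplus>q\<in>I. u p \<otimes> y \<otimes> w q)" if "p \<in> I" for p
    using that eq xy funcset_mem[OF u(1) that] w by (intro finsum_cong') auto
  have "(\<Oplus>p\<in>I. \<Oplus>q\<in>I. u p \<otimes> x \<otimes> w q) = (\<Oplus>p\<in>I. \<Oplus>q\<in>I. u p \<otimes> y \<otimes> w q)"
    by (rule finsum_cong'[OF refl]) (use row xy c in auto)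
  then show ?thesis using r xy by simp
qed

lemma if_mult: "y \<in> carrier R \<Longrightarrow> (if P then x else \<zero>) \<otimes> y = (if P then x \<otimes> y else \<zero>)"
  by simp

lemma conj_sum:
  assumes "finite I" "w \<in> carrier R" "w' \<in> carrier R" "t \<in> I \<rightarrow> carrier R" "j \<in> I"
    and "\<And>i. i \<in> I \<Longrightarrow> w \<otimes> t i \<otimes> w' = (if j = i then t i else \<zero>)"
  shows "w \<otimes> (\<Oplus>i\<in>I. t i) \<otimes> w' = t j"
proof -
  have "w \<otimes> (\<Oplus>i\<in>I. t i) \<otimes> w' = (\<Oplus>i\<in>I. w \<otimes> t i \<otimes> w')"
    using assms(1-4) by (simp add: finsum_rdistr finsum_ldistr Pi_def)
  also have "\<dots> = (\<Oplus>i\<in>I. if j = i then t i else \<zero>)"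
    using assms by (intro finsum_cong') auto
  also have "\<dots> = t j" using assms by (intro add.finprod_singleton) auto
  finally show ?thesis .
qed

lemma conj_sum_0:
  assumes "finite I" "w \<in> carrier R" "w' \<in> carrier R" "t \<in> I \<rightarrow> carrier R"
    and "\<And>i. i \<in> I \<Longrightarrow> w \<otimes> t i \<otimes> w' = \<zero>"
  shows "w \<otimes> (\<Oplus>i\<in>I. t i) \<otimes> w' = \<zero>"
proof -
  have "w \<otimes> (\<Oplus>i\<in>I. t i) \<otimes> w' = (\<Oplus>i\<in>I. w \<otimes> t i \<otimes> w')"
    using assms(1-4) by (simp add: finsum_rdistr finsum_ldistr Pi_def)
  also have "\<dots> = \<zero>"
    using assms by (intro add.finprod_one_eqI) auto
  finally show ?thesis .
qed

lemma finsum_absorb: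
  assumes "t \<in> I \<rightarrow> carrier R" "w \<in> carrier R" "finite I"
  shows "(\<And>i. i \<in> I \<Longrightarrow> w \<otimes> t i = t i) \<Longrightarrow> w \<otimes> (\<Oplus>i\<in>I. t i) = (\<Oplus>i\<in>I. t i)"
    "(\<And>i. i \<in> I \<Longrightarrow> t i \<otimes> w = t i) \<Longrightarrow> (\<Oplus>i\<in>I. t i) \<otimes> w = (\<Oplus>i\<in>I. t i)"
  using assms by (auto simp: finsum_rdistr finsum_ldistr intro!: finsum_cong')

text \<open>
  In the calculus \<open>e a b = X a b \<oplus> f b\<close>, and \<open>f b\<close> commutes with every \<open>g q\<close>; similarly for \<open>z\<close>. Hence
  the commutators in the evaluation relations see only \<open>X\<close> and \<open>Z\<close>.
\<close>

lemma commutator_add_central: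
  assumes "x \<in> carrier R" "y \<in> carrier R" "w \<in> carrier R" "y \<otimes> w = w \<otimes> y"
  shows "(x \<oplus> y) \<otimes> w \<ominus> w \<otimes> (x \<oplus> y) = x \<otimes> w \<ominus> w \<otimes> x"
proof -
  have "b \<oplus> (\<ominus> c \<oplus> \<ominus> b) = \<ominus> c" if "b \<in> carrier R" "c \<in> carrier R" for b c
    using that by (metis a_comm a_inv_closed a_lcomm r_neg r_zero)
  then show ?thesis using assms by (simp add: minus_eq l_distr r_distr minus_add a_assoc)
qed

end

section \<open>Frames\<close>

text \<open>
  The data common to both presentations, before the four sum relations. The elements
  \<open>f p\<close>, \<open>g q\<close> stand for $f_p$, $\overline{f_q}$ and \<open>X a b\<close>, \<open>Z c d\<close> for
  $e_{b\leftarrow a}-f_b$, $-(\overline{e_{d\leftarrow c}}+\overline{f_c})$. In terms of the double,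
  \<open>f p\<close> and \<open>g q\<close> are the sums of $u_{p,q}$ over \<open>q\<close> and over \<open>p\<close>.
\<close>

locale frame = ring S for S :: "('a, 'm) ring_scheme" (structure) +
  fixes V :: "'v set" and E :: "('v \<times> 'v) set"
    and f g :: "'v \<Rightarrow> 'a" and X Z :: "'v \<Rightarrow> 'v \<Rightarrow> 'a"
  assumes fin_V [simp]: "finite V" and E_V: "E \<subseteq> V \<times> V" and E_irrefl: "(a, a) \<notin> E"
    and f_closed [simp]: "p \<in> V \<Longrightarrow> f p \<in> carrier S"
    and g_closed [simp]: "p \<in> V \<Longrightarrow> g p \<in> carrier S"
    and f_orth: "p \<in> V \<Longrightarrow> q \<in> V \<Longrightarrow> f p \<otimes> f q = (if p = q then f p else \<zero>)"
    and g_orth: "p \<in> V \<Longrightarrow> q \<in> V \<Longrightarrow> g p \<otimes> g q = (if p = q then g p else \<zero>)"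
    and f_sum: "(\<Oplus>p\<in>V. f p) = \<one>" and g_sum: "(\<Oplus>p\<in>V. g p) = \<one>"
    and fg: "p \<in> V \<Longrightarrow> q \<in> V \<Longrightarrow> f p \<otimes> g q = g q \<otimes> f p"
    and X_closed [simp]: "(a, b) \<in> E \<Longrightarrow> X a b \<in> carrier S"
    and Z_closed [simp]: "(a, b) \<in> E \<Longrightarrow> Z a b \<in> carrier S"
    and X_left: "(a, b) \<in> E \<Longrightarrow> f b \<otimes> X a b = X a b"
    and X_right: "(a, b) \<in> E \<Longrightarrow> X a b \<otimes> f a = X a b"
    and Z_left: "(c, d) \<in> E \<Longrightarrow> g c \<otimes> Z c d = Z c d"
    and Z_right: "(c, d) \<in> E \<Longrightarrow> Z c d \<otimes> g d = Z c d"
    and X_supp: "(a, b) \<in> E \<Longrightarrow> c \<in> V \<Longrightarrow> d \<in> V \<Longrightarrow> c \<noteq> d \<Longrightarrow> (c, d) \<notin> E \<Longrightarrow>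
      g d \<otimes> X a b \<otimes> g c = \<zero>"
    and Z_supp: "(c, d) \<in> E \<Longrightarrow> a \<in> V \<Longrightarrow> b \<in> V \<Longrightarrow> a \<noteq> b \<Longrightarrow> (a, b) \<notin> E \<Longrightarrow>
      f a \<otimes> Z c d \<otimes> f b = \<zero>"
begin

abbreviation out where "out q \<equiv> {i. (q, i) \<in> E}"
abbreviation into where "into q \<equiv> {i. (i, q) \<in> E}"

text \<open>
  The symmetry of the axioms: exchange the two families of idempotents and reverse all arcs. In terms of the
  double it exchanges the arrows \<open>L\<close> with the arrows \<open>R\<close>.
\<close>

lemma swap: "frame S V (E\<inverse>) g f (\<lambda>a b. Z b a) (\<lambda>a b. X b a)"
  by (unfold_locales; use E_V E_irrefl fin_V f_orth g_orth f_sum g_sum fg X_left X_right Z_left Z_right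
     X_supp Z_supp in auto)

lemma finite_E [simp]: "finite E" using finite_subset[OF E_V] fin_V by simp

lemma E_verts: "(a, b) \<in> E \<Longrightarrow> a \<in> V" "(a, b) \<in> E \<Longrightarrow> b \<in> V" using E_V by auto

lemma E_neq: "(a, b) \<in> E \<Longrightarrow> a \<noteq> b" using E_irrefl by auto

lemma finite_nbrs [simp]: "finite (out q)" "finite (into q)"
  by (rule finite_subset[OF _ fin_V], use E_V in auto)+

lemma X_fl: "(a, b) \<in> E \<Longrightarrow> q \<in> V \<Longrightarrow> f q \<otimes> X a b = (if q = b then X a b else \<zero>)"
  by (metis E_verts(2) X_closed X_left f_closed f_orth l_null m_assoc)

lemma X_fr: "(a, b) \<in> E \<Longrightarrow> q \<in> V \<Longrightarrow> X a b \<otimes> f q = (if q = a then X a b else \<zero>)"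
  by (metis E_verts(1) X_closed X_right f_closed f_orth r_null m_assoc)

lemma Z_gl: "(c, d) \<in> E \<Longrightarrow> q \<in> V \<Longrightarrow> g q \<otimes> Z c d = (if q = c then Z c d else \<zero>)"
  by (metis E_verts(1) Z_closed Z_left g_closed g_orth l_null m_assoc)

lemma Z_gr: "(c, d) \<in> E \<Longrightarrow> q \<in> V \<Longrightarrow> Z c d \<otimes> g q = (if q = d then Z c d else \<zero>)"
  by (metis E_verts(2) Z_closed Z_right g_closed g_orth r_null m_assoc)

lemma resolve_g: "x \<in> carrier S \<Longrightarrow> (\<Oplus>q\<in>V. g q \<otimes> x) = x" "x \<in> carrier S \<Longrightarrow> (\<Oplus>q\<in>V. x \<otimes> g q) = x"
  using fin_V by (simp_all add: finsum_ldistr[symmetric] finsum_rdistr[symmetric] g_sum Pi_def)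

lemma resolve_f: "x \<in> carrier S \<Longrightarrow> (\<Oplus>q\<in>V. f q \<otimes> x) = x" "x \<in> carrier S \<Longrightarrow> (\<Oplus>q\<in>V. x \<otimes> f q) = x"
  using fin_V by (simp_all add: finsum_ldistr[symmetric] finsum_rdistr[symmetric] f_sum Pi_def)

text \<open>
  Multiplying a sum over all arcs by an idempotent keeps only the arcs that start, or end, at one vertex.
\<close>

lemma finsum_edges:
  assumes "\<And>a b. (a, b) \<in> E \<Longrightarrow> F a b \<in> carrier S"
  shows "(\<Oplus>i\<in>E. if fst i = q then F (fst i) (snd i) else \<zero>) = (\<Oplus>i\<in>out q. F q i)"
    and "(\<Oplus>i\<in>E. if snd i = q then F (fst i) (snd i) else \<zero>) = (\<Oplus>i\<in>into q. F i q)"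
proof -
  have "(\<Oplus>i\<in>E. if fst i = q then F (fst i) (snd i) else \<zero>)
      = (\<Oplus>i\<in>(\<lambda>i. (q, i)) ` (out q). F (fst i) (snd i))"
    by (rule add.finprod_mono_neutral_cong_right) (use assms in \<open>auto split: if_splits\<close>)
  also have "\<dots> = (\<Oplus>i\<in>out q. F q i)"
    using assms by (subst add.finprod_reindex) (auto simp: inj_on_def)
  finally show "(\<Oplus>i\<in>E. if fst i = q then F (fst i) (snd i) else \<zero>) = (\<Oplus>i\<in>out q. F q i)" .
  have "(\<Oplus>i\<in>E. if snd i = q then F (fst i) (snd i) else \<zero>)
      = (\<Oplus>i\<in>(\<lambda>i. (i, q)) ` (into q). F (fst i) (snd i))"
    by (rule add.finprod_mono_neutral_cong_right) (use assms in \<open>auto split: if_splits\<close>)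
  also have "\<dots> = (\<Oplus>i\<in>into q. F i q)"
    using assms by (subst add.finprod_reindex) (auto simp: inj_on_def)
  finally show "(\<Oplus>i\<in>E. if snd i = q then F (fst i) (snd i) else \<zero>) = (\<Oplus>i\<in>into q. F i q)" .
qed

lemma assoc_rules:
  assumes "y \<in> carrier S"
  shows "p \<in> V \<Longrightarrow> q \<in> V \<Longrightarrow> f p \<otimes> (g q \<otimes> y) = g q \<otimes> (f p \<otimes> y)"
    and "p \<in> V \<Longrightarrow> q \<in> V \<Longrightarrow> f p \<otimes> (f q \<otimes> y) = (if p = q then f p \<otimes> y else \<zero>)"
    and "p \<in> V \<Longrightarrow> q \<in> V \<Longrightarrow> g p \<otimes> (g q \<otimes> y) = (if p = q then g p \<otimes> y else \<zero>)"
    and "(a, b) \<in> E \<Longrightarrow> q \<in> V \<Longrightarrow> f q \<otimes> (X a b \<otimes> y) = (if q = b then X a b \<otimes> y else \<zero>)"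
    and "(a, b) \<in> E \<Longrightarrow> q \<in> V \<Longrightarrow> X a b \<otimes> (f q \<otimes> y) = (if q = a then X a b \<otimes> y else \<zero>)"
    and "(c, d) \<in> E \<Longrightarrow> q \<in> V \<Longrightarrow> g q \<otimes> (Z c d \<otimes> y) = (if q = c then Z c d \<otimes> y else \<zero>)"
    and "(c, d) \<in> E \<Longrightarrow> q \<in> V \<Longrightarrow> Z c d \<otimes> (g q \<otimes> y) = (if q = d then Z c d \<otimes> y else \<zero>)"
  using assms by (simp_all add: m_assoc[symmetric] f_orth g_orth X_fl X_fr Z_gl Z_gr fg)

text \<open>
  The rules below and the previous ones bring a product into a normal form in which every \<open>g\<close> stands left of the adjacent \<open>f\<close>. In
  this order an idempotent may be separated from the \<open>X\<close> or \<open>Z\<close> that would absorb it by one of the other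
  family; these three rules reach across.
\<close>

lemma skip_rules:
  assumes "y \<in> carrier S" "r \<in> V" "q \<in> V"
  shows "(a, b) \<in> E \<Longrightarrow> X a b \<otimes> (g r \<otimes> (f q \<otimes> y)) = (if q = a then X a b \<otimes> (g r \<otimes> y) else \<zero>)"
    and "(c, d) \<in> E \<Longrightarrow> g r \<otimes> (f q \<otimes> (Z c d \<otimes> y)) = (if r = c then f q \<otimes> (Z c d \<otimes> y) else \<zero>)"
    and "(c, d) \<in> E \<Longrightarrow> g r \<otimes> (f q \<otimes> Z c d) = (if r = c then f q \<otimes> Z c d else \<zero>)"
proof -
  show "X a b \<otimes> (g r \<otimes> (f q \<otimes> y)) = (if q = a then X a b \<otimes> (g r \<otimes> y) else \<zero>)" if "(a, b) \<in> E"
    using that assms assoc_rules(5)[of "g r \<otimes> y" a b q]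
    by (simp only: assoc_rules(1)[OF assms(1,3,2), symmetric] m_closed g_closed)
  show "g r \<otimes> (f q \<otimes> (Z c d \<otimes> y)) = (if r = c then f q \<otimes> (Z c d \<otimes> y) else \<zero>)" if "(c, d) \<in> E"
    using that assms assoc_rules(1)[of "Z c d \<otimes> y" q r] assoc_rules(6)[of y c d r] by auto
  show "g r \<otimes> (f q \<otimes> Z c d) = (if r = c then f q \<otimes> Z c d else \<zero>)" if "(c, d) \<in> E"
    using that assms assoc_rules(1)[of "Z c d" q r] Z_gl[of c d r] by auto
qed

lemmas normalize = m_assoc fg f_orth g_orth X_fl X_fr Z_gl Z_gr assoc_rules skip_rules E_verts

text \<open>
  The candidates for the images of the arrows of the double. For \<open>c \<noteq> d\<close> the summand $f_b$ of
  $e_{b\leftarrow a}$ is killed by the corner, so that \<open>L2 a b c d\<close> is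
  $-\overline{f_d}\bullet e_{b\leftarrow a}\bullet\overline{f_c}$; at \<open>c = d\<close> it survives and
  gives the second term of $L^{ab}_q$. Since \<open>Z\<close> carries a sign itself, the
  formulas for \<open>R2\<close> and \<open>R1\<close> have none in terms of $\overline{e_{d\leftarrow c}}$.
\<close>

definition L2 where "L2 a b c d = \<ominus> (g d \<otimes> X a b \<otimes> g c)"
definition L1 where "L1 a b q = g q \<otimes> X a b \<otimes> g q"
definition R2 where "R2 a b c d = \<ominus> (f a \<otimes> Z c d \<otimes> f b)"
definition R1 where "R1 p c d = \<ominus> (f p \<otimes> Z c d \<otimes> f p)"

lemma arrows_closed [simp]:
  "(a, b) \<in> E \<Longrightarrow> (c, d) \<in> E \<Longrightarrow> L2 a b c d \<in> carrier S"
  "(a, b) \<in> E \<Longrightarrow> (c, d) \<in> E \<Longrightarrow> R2 a b c d \<in> carrier S"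
  "(a, b) \<in> E \<Longrightarrow> q \<in> V \<Longrightarrow> L1 a b q \<in> carrier S"
  "(c, d) \<in> E \<Longrightarrow> p \<in> V \<Longrightarrow> R1 p c d \<in> carrier S"
  by (auto simp: L2_def R2_def L1_def R1_def E_verts)

lemma swap_arrows:
  "frame.L2 S f (\<lambda>a b. Z b a) a b c d = R2 d c b a"
  "frame.R2 S g (\<lambda>a b. X b a) a b c d = L2 d c b a"
  "(b, a) \<in> E \<Longrightarrow> q \<in> V \<Longrightarrow> frame.L1 S f (\<lambda>a b. Z b a) a b q = \<ominus> R1 q b a"
  "frame.R1 S g (\<lambda>a b. X b a) p c d = \<ominus> L1 d c p"
proof -
  interpret sw: frame S V "E\<inverse>" g f "\<lambda>a b. Z b a" "\<lambda>a b. X b a" by (rule swap)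
  show "frame.L2 S f (\<lambda>a b. Z b a) a b c d = R2 d c b a"
    "frame.R2 S g (\<lambda>a b. X b a) a b c d = L2 d c b a"
    "(b, a) \<in> E \<Longrightarrow> q \<in> V \<Longrightarrow> frame.L1 S f (\<lambda>a b. Z b a) a b q = \<ominus> R1 q b a"
    "frame.R1 S g (\<lambda>a b. X b a) p c d = \<ominus> L1 d c p"
    by (simp_all add: sw.L2_def sw.R2_def sw.L1_def sw.R1_def L2_def R2_def L1_def R1_def)
qed

text \<open>
  By \<open>X_supp\<close> the only nonzero corners of \<open>X a b\<close> between two \<open>g\<close> are those named by an \<open>L1\<close> or an \<open>L2\<close>.
\<close>

lemma X_decomp:
  assumes ab: "(a, b) \<in> E"
  shows "X a b = (\<Oplus>q\<in>V. L1 a b q) \<ominus> (\<Oplus>i\<in>E. L2 a b (fst i) (snd i))"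
proof (rule eqI_corners[where I = V and u = g and w = g])
  fix p q assume p: "p \<in> V" and q: "q \<in> V"
  have 1: "g p \<otimes> (\<Oplus>q\<in>V. L1 a b q) \<otimes> g q = (\<Oplus>r\<in>V. if r = p then (if p = q then g p \<otimes> X a b \<otimes> g q else \<zero>) else \<zero>)"
  proof -
    have "g p \<otimes> (\<Oplus>q\<in>V. L1 a b q) \<otimes> g q = (\<Oplus>r\<in>V. g p \<otimes> L1 a b r \<otimes> g q)"
      using ab p q fin_V by (simp add: finsum_rdistr finsum_ldistr Pi_def)
    also have "\<dots> = (\<Oplus>r\<in>V. if r = p then (if p = q then g p \<otimes> X a b \<otimes> g q else \<zero>) else \<zero>)"
      using ab p q by (intro finsum_cong') (auto simp: L1_def normalize)
    finally show ?thesis .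
  qed
  have 2: "g p \<otimes> (\<Oplus>i\<in>E. L2 a b (fst i) (snd i)) \<otimes> g q
      = (\<Oplus>i\<in>E. if i = (q, p) then \<ominus> (g p \<otimes> X a b \<otimes> g q) else \<zero>)"
  proof -
    have "g p \<otimes> (\<Oplus>i\<in>E. L2 a b (fst i) (snd i)) \<otimes> g q = (\<Oplus>i\<in>E. g p \<otimes> L2 a b (fst i) (snd i) \<otimes> g q)"
      using ab p q by (simp add: finsum_rdistr finsum_ldistr Pi_def)
    also have "\<dots> = (\<Oplus>i\<in>E. if i = (q, p) then \<ominus> (g p \<otimes> X a b \<otimes> g q) else \<zero>)"
      using ab p q by (intro finsum_cong') (auto simp: L2_def normalize l_minus r_minus split: if_splits)
    finally show ?thesis .
  qed
  have 3: "(\<Oplus>i\<in>E. if i = (q, p) then \<ominus> (g p \<otimes> X a b \<otimes> g q) else \<zero>)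
      = (if (q, p) \<in> E then \<ominus> (g p \<otimes> X a b \<otimes> g q) else \<zero>)"
    using ab p q by (auto simp: finsum_delta intro!: add.finprod_one_eqI)
  have 4: "(\<Oplus>r\<in>V. if r = p then (if p = q then g p \<otimes> X a b \<otimes> g q else \<zero>) else \<zero>)
      = (if p = q then g p \<otimes> X a b \<otimes> g q else \<zero>)"
    using ab p q fin_V by (intro finsum_delta) auto
  have "g p \<otimes> ((\<Oplus>q\<in>V. L1 a b q) \<ominus> (\<Oplus>i\<in>E. L2 a b (fst i) (snd i))) \<otimes> g q
     = g p \<otimes> (\<Oplus>q\<in>V. L1 a b q) \<otimes> g q \<ominus> g p \<otimes> (\<Oplus>i\<in>E. L2 a b (fst i) (snd i)) \<otimes> g q"
    using ab p q by (simp add: minus_eq r_distr l_distr l_minus r_minus Pi_def)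
  also have "\<dots> = g p \<otimes> X a b \<otimes> g q"
    unfolding 1 2 3 4 using ab p q X_supp[of a b q p] E_neq[of q p] by (auto simp: minus_eq)
  finally show "g p \<otimes> X a b \<otimes> g q
      = g p \<otimes> ((\<Oplus>q\<in>V. L1 a b q) \<ominus> (\<Oplus>i\<in>E. L2 a b (fst i) (snd i))) \<otimes> g q" by simp
qed (use ab g_sum in auto)

text \<open>
  The row of \<open>Z c d\<close> at \<open>f p\<close>, written as the sum of its corners that \<open>Z_supp\<close> leaves.
\<close>

lemma Z_row:
  assumes cd: "(c, d) \<in> E" and p: "p \<in> V"
  shows "f p \<otimes> Z c d = f p \<otimes> Z c d \<otimes> f p \<oplus> (\<Oplus>i\<in>out p. f p \<otimes> Z c d \<otimes> f i)"
proof (rule eqI_corners[where I = V and u = f and w = f])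
  fix r q assume r: "r \<in> V" and q: "q \<in> V"
  let ?I = "(out p)"
  have "f r \<otimes> (\<Oplus>i\<in>?I. f p \<otimes> Z c d \<otimes> f i) \<otimes> f q = (\<Oplus>i\<in>?I. f r \<otimes> (f p \<otimes> Z c d \<otimes> f i) \<otimes> f q)"
    using cd p r q by (simp add: finsum_rdistr finsum_ldistr Pi_def E_verts)
  also have "\<dots> = (\<Oplus>i\<in>?I. if i = q then (if r = p then f p \<otimes> Z c d \<otimes> f q else \<zero>) else \<zero>)"
    using cd p q r by (intro finsum_cong') (auto simp: normalize)
  also have "\<dots> = (if (p, q) \<in> E \<and> r = p then f p \<otimes> Z c d \<otimes> f q else \<zero>)"
    using cd p q r by (auto simp: finsum_delta intro!: add.finprod_one_eqI)
  finally have "f r \<otimes> (f p \<otimes> Z c d \<otimes> f p \<oplus> (\<Oplus>i\<in>?I. f p \<otimes> Z c d \<otimes> f i)) \<otimes> f q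
      = f r \<otimes> (f p \<otimes> Z c d \<otimes> f p) \<otimes> f q \<oplus> (if (p, q) \<in> E \<and> r = p then f p \<otimes> Z c d \<otimes> f q else \<zero>)"
    using cd p q r by (simp add: r_distr l_distr Pi_def E_verts)
  also have "\<dots> = f r \<otimes> (f p \<otimes> Z c d) \<otimes> f q"
    using cd p q r Z_supp[of c d p q] E_neq[of p q] by (auto simp: normalize)
  finally show "f r \<otimes> (f p \<otimes> Z c d) \<otimes> f q
      = f r \<otimes> (f p \<otimes> Z c d \<otimes> f p \<oplus> (\<Oplus>i\<in>?I. f p \<otimes> Z c d \<otimes> f i)) \<otimes> f q" by simp
qed (use cd p f_sum in \<open>auto simp: E_verts\<close>)

lemma R2_L1:
  assumes "(q, i) \<in> E" "(c, d) \<in> E"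
  shows "R2 q i c d \<otimes> L1 q i d = \<ominus> (f q \<otimes> Z c d \<otimes> X q i \<otimes> g d)"
  using assms by (simp add: R2_def L1_def normalize l_minus)

lemma R2_L2:
  assumes "(q, i) \<in> E" "(c, d) \<in> E" "(s, d) \<in> E"
  shows "R2 q i c d \<otimes> L2 q i s d = f q \<otimes> Z c d \<otimes> X q i \<otimes> g s"
  using assms by (simp add: R2_def L2_def normalize l_minus r_minus)

lemma L2_R2:
  assumes "(i, q) \<in> E" "(c, t) \<in> E" "(c, d) \<in> E"
  shows "L2 i q c t \<otimes> R2 i q c d = g t \<otimes> X i q \<otimes> Z c d \<otimes> f q"
  using assms by (simp add: R2_def L2_def normalize l_minus r_minus)

text \<open>
  The image of $e_{b\leftarrow a}$, and the negative of the image of $\overline{e_{d\leftarrow c}}$.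
\<close>

definition e where "e a b = X a b \<oplus> f b"
definition z where "z c d = Z c d \<oplus> g c"

lemma ez_closed [simp]: "(a, b) \<in> E \<Longrightarrow> e a b \<in> carrier S" "(a, b) \<in> E \<Longrightarrow> z a b \<in> carrier S"
  by (auto simp: e_def z_def E_verts)

text \<open>
  The relations $[\overline x,b_i]\bullet x_i=\overline x$ and
  $[y_j,\overline a]\bullet[\overline x,c_j]=\overline{\mathrm{ev}(x\otimes da)}$ for
  $x=e_{d\leftarrow c}$ and $a=f_r$. In the first, $\overline x=-z$ and $b_{a\to b}=-f_a$ contribute the
  signs; in the second, $da=df_r$ takes the value $\delta_{r,d}-\delta_{r,c}$ on $c\to d$ and the
  sign comes from $\overline x=-z$.
\<close>

definition inv_rel where
  "inv_rel c d \<longleftrightarrow> (\<Oplus>i\<in>E. (z c d \<otimes> f (fst i) \<ominus> f (fst i) \<otimes> z c d) \<otimes> e (fst i) (snd i)) = \<ominus> z c d"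

definition ev_rel where
  "ev_rel c d \<longleftrightarrow> (\<forall>r\<in>V. (\<Oplus>i\<in>E. (e (fst i) (snd i) \<otimes> g r \<ominus> g r \<otimes> e (fst i) (snd i))
        \<otimes> (z c d \<otimes> f (snd i) \<ominus> f (snd i) \<otimes> z c d))
      = (if r = c then g d else \<zero>) \<ominus> (if r = d then g d else \<zero>))"

text \<open>
  Since \<open>f a \<otimes> e a b = \<zero>\<close> for an arc, the commutator contributes only \<open>\<ominus> f a \<otimes> Z c d \<otimes> e a b\<close>.
  The relation is thus that the sum of these elements, without the sign, is \<open>z c d\<close>. The corner at \<open>f q\<close> and \<open>g s\<close>
  has, besides the sum on the left, the terms \<open>f q \<otimes> Z c d \<otimes> f i\<close> that come from the
  summand \<open>f i\<close> of \<open>e q i\<close>. By \<open>Z_row\<close> they are the part of \<open>f q \<otimes> Z c d\<close> outside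
  \<open>f q \<otimes> Z c d \<otimes> f q\<close>, and cancel against the other side.
\<close>

lemma inv_rel_iff_corners:
  assumes cd: "(c, d) \<in> E"
  shows "inv_rel c d \<longleftrightarrow> (\<forall>q\<in>V. \<forall>s\<in>V. (\<Oplus>i\<in>out q. f q \<otimes> Z c d \<otimes> X q i \<otimes> g s)
     = (if s = d then f q \<otimes> Z c d \<otimes> f q else \<zero>) \<oplus> (if s = c then f q \<otimes> g c else \<zero>))"
proof -
  let ?T = "\<Oplus>i\<in>E. f (fst i) \<otimes> Z c d \<otimes> e (fst i) (snd i)"
  have "(\<Oplus>i\<in>E. (z c d \<otimes> f (fst i) \<ominus> f (fst i) \<otimes> z c d) \<otimes> e (fst i) (snd i))
      = (\<Oplus>i\<in>E. \<ominus> (f (fst i) \<otimes> Z c d \<otimes> e (fst i) (snd i)))"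
    using cd by (intro finsum_cong')
      (auto simp: e_def z_def normalize E_neq minus_eq l_distr r_distr l_minus r_minus minus_add)
  also have "\<dots> = \<ominus> ?T"
    using cd by (intro finsum_neg) (auto simp: E_verts)
  finally have "inv_rel c d \<longleftrightarrow> \<ominus> ?T = \<ominus> z c d" by (simp add: inv_rel_def)
  also have "\<dots> \<longleftrightarrow> ?T = z c d"
  proof -
    have "?T \<in> carrier S" using cd by (intro finsum_closed) (auto simp: E_verts)
    then show ?thesis using cd by (intro neg_inject) auto
  qed
  also have "\<dots> \<longleftrightarrow> (\<forall>q\<in>V. \<forall>s\<in>V. f q \<otimes> ?T \<otimes> g s = f q \<otimes> z c d \<otimes> g s)"
  proof
    assume eq: "\<forall>q\<in>V. \<forall>s\<in>V. f q \<otimes> ?T \<otimes> g s = f q \<otimes> z c d \<otimes> g s"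
    show "?T = z c d"
      by (rule eqI_corners[where I = V and u = f and w = g])
         (use eq cd f_sum g_sum in \<open>auto simp: E_verts intro!: finsum_closed\<close>)
  qed simp
  also have "\<dots> \<longleftrightarrow> (\<forall>q\<in>V. \<forall>s\<in>V. (\<Oplus>i\<in>out q. f q \<otimes> Z c d \<otimes> X q i \<otimes> g s)
     = (if s = d then f q \<otimes> Z c d \<otimes> f q else \<zero>) \<oplus> (if s = c then f q \<otimes> g c else \<zero>))"
  proof (intro ball_cong refl)
    fix q s assume q: "q \<in> V" and s: "s \<in> V"
    let ?I = "(out q)"
    let ?K = "\<Oplus>i\<in>?I. f q \<otimes> Z c d \<otimes> X q i \<otimes> g s" and ?N = "\<Oplus>i\<in>?I. f q \<otimes> Z c d \<otimes> f i"
    have "f q \<otimes> ?T \<otimes> g s = (\<Oplus>i\<in>E. f q \<otimes> (f (fst i) \<otimes> Z c d \<otimes> e (fst i) (snd i)) \<otimes> g s)"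
      using cd q s by (simp add: finsum_rdistr finsum_ldistr Pi_def E_verts)
    also have "\<dots> = (\<Oplus>i\<in>E. if fst i = q then f (fst i) \<otimes> Z c d \<otimes> e (fst i) (snd i) \<otimes> g s else \<zero>)"
      using cd q s by (intro finsum_cong') (auto simp: normalize)
    also have "\<dots> = (\<Oplus>i\<in>?I. f q \<otimes> Z c d \<otimes> e q i \<otimes> g s)"
      using cd q s by (intro finsum_edges(1)) (auto simp: E_verts)
    also have "\<dots> = (\<Oplus>i\<in>?I. f q \<otimes> Z c d \<otimes> X q i \<otimes> g s \<oplus> f q \<otimes> Z c d \<otimes> f i \<otimes> g s)"
      using cd q s by (intro finsum_cong') (auto simp: e_def E_verts r_distr l_distr)
    also have "\<dots> = ?K \<oplus> (\<Oplus>i\<in>?I. f q \<otimes> Z c d \<otimes> f i \<otimes> g s)"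
      using cd q s by (intro finsum_addf) (auto simp: E_verts)
    also have "(\<Oplus>i\<in>?I. f q \<otimes> Z c d \<otimes> f i \<otimes> g s) = ?N \<otimes> g s"
      using cd q s by (intro finsum_ldistr[symmetric]) (auto simp: E_verts)
    also have "?N \<otimes> g s = (if s = d then ?N else \<zero>)"
    proof -
      have "?N \<otimes> g s = (\<Oplus>i\<in>?I. f q \<otimes> Z c d \<otimes> f i \<otimes> g s)"
        using cd q s by (intro finsum_ldistr) (auto simp: E_verts)
      also have "\<dots> = (\<Oplus>i\<in>?I. if s = d then f q \<otimes> Z c d \<otimes> f i else \<zero>)"
        using cd q s by (intro finsum_cong') (auto simp: normalize)
      finally show ?thesis by simp
    qed
    finally have L: "f q \<otimes> ?T \<otimes> g s = ?K \<oplus> (if s = d then ?N else \<zero>)" .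
    have "f q \<otimes> z c d \<otimes> g s = (if s = d then f q \<otimes> Z c d else \<zero>) \<oplus> (if s = c then f q \<otimes> g c else \<zero>)"
      using cd q s by (auto simp: z_def normalize r_distr l_distr)
    also have "\<dots> = (if s = d then f q \<otimes> Z c d \<otimes> f q else \<zero>) \<oplus> (if s = c then f q \<otimes> g c else \<zero>)
        \<oplus> (if s = d then ?N else \<zero>)"
      using cd q s E_neq[OF cd] Z_row[OF cd q] by (auto simp: E_verts Pi_def)
    finally have R: "f q \<otimes> z c d \<otimes> g s = (if s = d then f q \<otimes> Z c d \<otimes> f q else \<zero>)
        \<oplus> (if s = c then f q \<otimes> g c else \<zero>) \<oplus> (if s = d then ?N else \<zero>)" .
    show "(f q \<otimes> ?T \<otimes> g s = f q \<otimes> z c d \<otimes> g s) \<longleftrightarrow>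
       ?K = (if s = d then f q \<otimes> Z c d \<otimes> f q else \<zero>) \<oplus> (if s = c then f q \<otimes> g c else \<zero>)"
      unfolding L R using cd q s by (intro add.right_cancel) (auto simp: E_verts)
  qed
  finally show ?thesis .
qed

text \<open>
  The corner at \<open>s = d\<close> is the formula for \<open>R1 q c d\<close>, and the corners with \<open>(s, d) \<in> E\<close>, among them
  \<open>s = c\<close>, are the relations whose right-hand side is $\delta_{c,s}u_{q,c}$. At all other \<open>s\<close> both sides vanish by \<open>X_supp\<close>.
\<close>

lemma inv_rel_iff:
  assumes cd: "(c, d) \<in> E"
  shows "inv_rel c d \<longleftrightarrow>
    (\<forall>q\<in>V. R1 q c d = (\<Oplus>i\<in>out q. R2 q i c d \<otimes> L1 q i d)) \<and>
    (\<forall>q\<in>V. \<forall>s. (s, d) \<in> E \<longrightarrow> (\<Oplus>i\<in>out q. R2 q i c d \<otimes> L2 q i s d)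
        = (if c = s then f q \<otimes> g c else \<zero>))"
proof -
  let ?K = "\<lambda>q s. \<Oplus>i\<in>out q. f q \<otimes> Z c d \<otimes> X q i \<otimes> g s"
  have 1: "(\<Oplus>i\<in>out q. R2 q i c d \<otimes> L1 q i d) = \<ominus> ?K q d" if "q \<in> V" for q
  proof -
    have "(\<Oplus>i\<in>out q. R2 q i c d \<otimes> L1 q i d)
        = (\<Oplus>i\<in>out q. \<ominus> (f q \<otimes> Z c d \<otimes> X q i \<otimes> g d))"
      using that cd by (intro finsum_cong') (auto simp: R2_L1 E_verts)
    also have "\<dots> = \<ominus> ?K q d"
      using that cd by (intro finsum_neg) (auto simp: E_verts)
    finally show ?thesis .
  qed
  have 2: "(\<Oplus>i\<in>out q. R2 q i c d \<otimes> L2 q i s d) = ?K q s" if "q \<in> V" "(s, d) \<in> E" for q s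
    using that cd by (intro finsum_cong') (auto simp: R2_L2 E_verts)
  have 3: "?K q s = \<zero>" if "q \<in> V" "s \<in> V" "s \<noteq> d" "(s, d) \<notin> E" for q s
  proof -
    have "f q \<otimes> Z c d \<otimes> X q i \<otimes> g s = \<zero>" if i: "(q, i) \<in> E" for i
    proof -
      have "f q \<otimes> Z c d \<otimes> X q i \<otimes> g s = f q \<otimes> Z c d \<otimes> (g d \<otimes> X q i \<otimes> g s)"
        using that cd \<open>s \<in> V\<close> \<open>q \<in> V\<close> by (simp add: normalize)
      then show ?thesis using X_supp[OF i, of s d] that cd \<open>s \<in> V\<close> \<open>q \<in> V\<close> \<open>s \<noteq> d\<close> \<open>(s, d) \<notin> E\<close>
        by (simp add: E_verts)
    qed
    then show ?thesis by (intro add.finprod_one_eqI) auto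
  qed
  have K: "?K q s \<in> carrier S" if "q \<in> V" "s \<in> V" for q s
    using that cd by (intro finsum_closed) (auto simp: E_verts)
  have "inv_rel c d \<longleftrightarrow> (\<forall>q\<in>V. \<forall>s\<in>V. ?K q s = (if s = d then f q \<otimes> Z c d \<otimes> f q else \<zero>) \<oplus> (if s = c then f q \<otimes> g c else \<zero>))"
    by (rule inv_rel_iff_corners[OF cd])
  also have "\<dots> \<longleftrightarrow> (\<forall>q\<in>V. ?K q d = f q \<otimes> Z c d \<otimes> f q) \<and>
     (\<forall>q\<in>V. \<forall>s. (s, d) \<in> E \<longrightarrow> ?K q s = (if c = s then f q \<otimes> g c else \<zero>))" (is "?A \<longleftrightarrow> ?B \<and> ?C")
  proof (intro iffI conjI ballI allI impI)
    fix q assume "?A" "q \<in> V"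
    then show "?K q d = f q \<otimes> Z c d \<otimes> f q"
      using bspec[OF bspec[of V _ q], of "\<lambda>q. V" _ d] cd E_neq[OF cd] by (auto simp: E_verts)
  next
    fix q s assume "?A" "q \<in> V" "(s, d) \<in> E"
    then show "?K q s = (if c = s then f q \<otimes> g c else \<zero>)"
      using E_neq[of s d] cd by (auto simp: E_verts)
  next
    fix q s assume BC: "?B \<and> ?C" and q: "q \<in> V" and s: "s \<in> V"
    consider "s = d" | "(s, d) \<in> E" | "s \<noteq> d" "(s, d) \<notin> E" by blast
    then show "?K q s = (if s = d then f q \<otimes> Z c d \<otimes> f q else \<zero>) \<oplus> (if s = c then f q \<otimes> g c else \<zero>)"
    proof cases
      case 1 then show ?thesis using BC q cd E_neq[OF cd] by (auto simp: E_verts)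
    next
      case 2 then show ?thesis using BC q cd E_neq[of s d] by (auto simp: E_verts)
    next
      case 3 then show ?thesis using q s cd \<open>\<And>s q. q \<in> V \<Longrightarrow> s \<in> V \<Longrightarrow> s \<noteq> d \<Longrightarrow> (s, d) \<notin> E \<Longrightarrow> ?K q s = \<zero>\<close>
        by auto
    qed
  qed
  also have "?B \<longleftrightarrow> (\<forall>q\<in>V. R1 q c d = (\<Oplus>i\<in>out q. R2 q i c d \<otimes> L1 q i d))"
  proof (intro ball_cong refl)
    fix q assume q: "q \<in> V"
    show "?K q d = f q \<otimes> Z c d \<otimes> f q \<longleftrightarrow> R1 q c d = (\<Oplus>i\<in>out q. R2 q i c d \<otimes> L1 q i d)"
      unfolding 1[OF q] R1_def using K[OF q, of d] q cd
      by (metis E_verts(2) Z_closed f_closed m_closed minus_minus)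
  qed
  also have "?C \<longleftrightarrow> (\<forall>q\<in>V. \<forall>s. (s, d) \<in> E \<longrightarrow> (\<Oplus>i\<in>out q. R2 q i c d \<otimes> L2 q i s d)
        = (if c = s then f q \<otimes> g c else \<zero>))"
    using 2 by auto
  finally show ?thesis .
qed

text \<open>
  Put \<open>W = (\<Oplus>i\<in>E. X (fst i) (snd i) \<otimes> Z c d \<otimes> f (snd i))\<close>. As \<open>X a b \<otimes> f b = \<zero>\<close>, the product of the two
  commutators loses the terms with \<open>f b \<otimes> Z c d\<close>, and since \<open>Z c d\<close> starts with \<open>g c\<close> the left-hand side at \<open>r\<close> is
  \<open>W \<ominus> g c \<otimes> W\<close> if \<open>r = c\<close> and \<open>\<ominus> g r \<otimes> W\<close> otherwise. For \<open>r \<noteq> c\<close> the relation thus says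
  that \<open>g r \<otimes> W\<close> is \<open>g d\<close> or \<open>\<zero>\<close>, which is automatic unless \<open>(c, r) \<in> E\<close>, and the relation at \<open>r = c\<close> is the sum
  of the others. Cutting with \<open>f q\<close> gives the relation of the double.
\<close>

lemma ev_rel_iff:
  assumes cd: "(c, d) \<in> E"
  shows "ev_rel c d \<longleftrightarrow>
    (\<forall>q\<in>V. \<forall>t. (c, t) \<in> E \<longrightarrow> (\<Oplus>i\<in>into q. L2 i q c t \<otimes> R2 i q c d)
        = (if t = d then f q \<otimes> g t else \<zero>))"
proof -
  define W where "W = (\<Oplus>i\<in>E. X (fst i) (snd i) \<otimes> Z c d \<otimes> f (snd i))"
  have W: "W \<in> carrier S" unfolding W_def using cd by (intro finsum_closed) (auto simp: E_verts)
  have sum: "(\<Oplus>i\<in>E. (e (fst i) (snd i) \<otimes> g r \<ominus> g r \<otimes> e (fst i) (snd i))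
        \<otimes> (z c d \<otimes> f (snd i) \<ominus> f (snd i) \<otimes> z c d)) = (if r = c then W else \<zero>) \<ominus> g r \<otimes> W"
    if r: "r \<in> V" for r
  proof -
    have "(\<Oplus>i\<in>E. (e (fst i) (snd i) \<otimes> g r \<ominus> g r \<otimes> e (fst i) (snd i))
        \<otimes> (z c d \<otimes> f (snd i) \<ominus> f (snd i) \<otimes> z c d))
      = (\<Oplus>i\<in>E. (if r = c then X (fst i) (snd i) \<otimes> Z c d \<otimes> f (snd i) else \<zero>)
            \<oplus> \<ominus> g r \<otimes> (X (fst i) (snd i) \<otimes> Z c d \<otimes> f (snd i)))"
    proof (rule finsum_cong'[OF refl])
      fix i assume i: "i \<in> E"
      obtain a b where ab: "i = (a, b)" by fastforce
      have "(e a b \<otimes> g r \<ominus> g r \<otimes> e a b) \<otimes> (z c d \<otimes> f b \<ominus> f b \<otimes> z c d)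
          = (X a b \<otimes> g r \<ominus> g r \<otimes> X a b) \<otimes> (Z c d \<otimes> f b \<ominus> f b \<otimes> Z c d)"
        unfolding e_def z_def using i ab cd r
        by (subst (1 2) commutator_add_central) (auto simp: E_verts fg)
      also have "\<dots> = (if r = c then X a b \<otimes> Z c d \<otimes> f b else \<zero>) \<oplus> \<ominus> g r \<otimes> (X a b \<otimes> Z c d \<otimes> f b)"
        using i ab cd r E_neq[of a b]
        by (auto simp: normalize minus_eq l_distr r_distr l_minus r_minus)
      finally show "(e (fst i) (snd i) \<otimes> g r \<ominus> g r \<otimes> e (fst i) (snd i))
        \<otimes> (z c d \<otimes> f (snd i) \<ominus> f (snd i) \<otimes> z c d)
        = (if r = c then X (fst i) (snd i) \<otimes> Z c d \<otimes> f (snd i) else \<zero>)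
            \<oplus> \<ominus> g r \<otimes> (X (fst i) (snd i) \<otimes> Z c d \<otimes> f (snd i))" using ab by simp
    qed (use cd r in \<open>auto simp: E_verts\<close>)
    also have "\<dots> = (\<Oplus>i\<in>E. if r = c then X (fst i) (snd i) \<otimes> Z c d \<otimes> f (snd i) else \<zero>)
        \<oplus> (\<Oplus>i\<in>E. \<ominus> g r \<otimes> (X (fst i) (snd i) \<otimes> Z c d \<otimes> f (snd i)))"
      using cd r by (intro finsum_addf) (auto simp: E_verts)
    also have "(\<Oplus>i\<in>E. \<ominus> g r \<otimes> (X (fst i) (snd i) \<otimes> Z c d \<otimes> f (snd i))) = \<ominus> g r \<otimes> W"
      unfolding W_def using cd r by (intro finsum_rdistr[symmetric]) (auto simp: E_verts)
    finally show ?thesis using r W by (auto simp: W_def minus_eq l_minus)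
  qed
  have supp: "g r \<otimes> W = \<zero>" if "r \<in> V" "r \<noteq> c" "(c, r) \<notin> E" for r
  proof -
    have "g r \<otimes> W = (\<Oplus>i\<in>E. g r \<otimes> (X (fst i) (snd i) \<otimes> Z c d \<otimes> f (snd i)))"
      unfolding W_def using cd that by (intro finsum_rdistr) (auto simp: E_verts)
    also have "\<dots> = \<zero>"
    proof (rule add.finprod_one_eqI)
      fix i assume i: "i \<in> E"
      then have "g r \<otimes> (X (fst i) (snd i) \<otimes> Z c d \<otimes> f (snd i))
          = (g r \<otimes> X (fst i) (snd i) \<otimes> g c) \<otimes> (Z c d \<otimes> f (snd i))"
        using cd that by (cases i) (simp add: normalize)
      then show "g r \<otimes> (X (fst i) (snd i) \<otimes> Z c d \<otimes> f (snd i)) = \<zero>"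
        using X_supp[of "fst i" "snd i" c r] i cd that by (cases i) (auto simp: E_verts)
    qed
    finally show ?thesis .
  qed
  have corner: "(\<Oplus>i\<in>into q. L2 i q c t \<otimes> R2 i q c d) = f q \<otimes> (g t \<otimes> W)"
    if q: "q \<in> V" and t: "(c, t) \<in> E" for q t
  proof -
    have "f q \<otimes> (g t \<otimes> W) = f q \<otimes> g t \<otimes> W" using q t W by (simp add: m_assoc E_verts)
    also have "\<dots> = (\<Oplus>i\<in>E. f q \<otimes> g t \<otimes> (X (fst i) (snd i) \<otimes> Z c d \<otimes> f (snd i)))"
      unfolding W_def using cd q t by (intro finsum_rdistr) (auto simp: E_verts)
    also have "\<dots> = (\<Oplus>i\<in>E. if snd i = q then g t \<otimes> X (fst i) (snd i) \<otimes> Z c d \<otimes> f (snd i) else \<zero>)"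
      using cd q t by (intro finsum_cong') (auto simp: normalize)
    also have "\<dots> = (\<Oplus>i\<in>into q. g t \<otimes> X i q \<otimes> Z c d \<otimes> f q)"
      using cd q t by (intro finsum_edges(2)) (auto simp: E_verts)
    also have "\<dots> = (\<Oplus>i\<in>into q. L2 i q c t \<otimes> R2 i q c d)"
      using cd q t by (intro finsum_cong') (auto simp: L2_R2 E_verts)
    finally show ?thesis by simp
  qed
  have "ev_rel c d \<longleftrightarrow> (\<forall>r\<in>V. (if r = c then W else \<zero>) \<ominus> g r \<otimes> W
      = (if r = c then g d else \<zero>) \<ominus> (if r = d then g d else \<zero>))"
    unfolding ev_rel_def by (simp add: sum)
  also have "\<dots> \<longleftrightarrow> (\<forall>t. (c, t) \<in> E \<longrightarrow> g t \<otimes> W = (if t = d then g d else \<zero>))"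
  proof (intro iffI allI impI ballI)
    fix t assume A: "\<forall>r\<in>V. (if r = c then W else \<zero>) \<ominus> g r \<otimes> W
      = (if r = c then g d else \<zero>) \<ominus> (if r = d then g d else \<zero>)" and t: "(c, t) \<in> E"
    then have "\<ominus> (g t \<otimes> W) = \<ominus> (if t = d then g d else \<zero>)"
      using bspec[OF A, of t] E_neq[OF t] cd W by (auto simp: E_verts minus_eq)
    then show "g t \<otimes> W = (if t = d then g d else \<zero>)"
      using t cd W neg_inject[of "g t \<otimes> W" "if t = d then g d else \<zero>"] by (auto simp: E_verts)
  next
    fix r assume A: "\<forall>t. (c, t) \<in> E \<longrightarrow> g t \<otimes> W = (if t = d then g d else \<zero>)" and r: "r \<in> V"
    have gW: "g r \<otimes> W = (if r = d then g d else \<zero>)" if "r \<in> V" "r \<noteq> c" for r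
      using that A supp[of r] cd by (cases "(c, r) \<in> E") auto
    have "W = (\<Oplus>r\<in>V. g r \<otimes> W)" using W by (simp add: resolve_g)
    also have "\<dots> = (\<Oplus>r\<in>V. (if r = c then g c \<otimes> W else \<zero>) \<oplus> (if r = d then g d else \<zero>))"
      using W gW cd E_neq[OF cd] by (intro finsum_cong') (auto simp: E_verts)
    also have "\<dots> = (\<Oplus>r\<in>V. if r = c then g c \<otimes> W else \<zero>) \<oplus> (\<Oplus>r\<in>V. if r = d then g d else \<zero>)"
      using W cd by (intro finsum_addf) (auto simp: E_verts)
    also have "\<dots> = g c \<otimes> W \<oplus> g d"
      using W cd fin_V by (simp add: finsum_delta E_verts)
    finally have Wc: "W = g c \<otimes> W \<oplus> g d" .
    have "g c \<otimes> W \<oplus> g d \<ominus> g c \<otimes> W = g d"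
      using W cd by (simp add: minus_eq a_comm[of "g c \<otimes> W"] a_assoc r_neg E_verts)
    then have "W \<ominus> g c \<otimes> W = g d" unfolding Wc[symmetric] .
    then show "(if r = c then W else \<zero>) \<ominus> g r \<otimes> W
        = (if r = c then g d else \<zero>) \<ominus> (if r = d then g d else \<zero>)"
      using gW[OF r] E_neq[OF cd] cd W r by (auto simp: E_verts minus_eq)
  qed
  also have "\<dots> \<longleftrightarrow> (\<forall>q\<in>V. \<forall>t. (c, t) \<in> E \<longrightarrow> f q \<otimes> (g t \<otimes> W) = (if t = d then f q \<otimes> g t else \<zero>))"
  proof (intro iffI allI impI ballI)
    fix t assume A: "\<forall>q\<in>V. \<forall>t. (c, t) \<in> E \<longrightarrow> f q \<otimes> (g t \<otimes> W) = (if t = d then f q \<otimes> g t else \<zero>)"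
      and t: "(c, t) \<in> E"
    have "g t \<otimes> W = (\<Oplus>q\<in>V. f q \<otimes> (g t \<otimes> W))" using t W by (simp add: resolve_f E_verts)
    also have "\<dots> = (\<Oplus>q\<in>V. f q \<otimes> (if t = d then g d else \<zero>))"
      using A t W cd by (intro finsum_cong') (auto simp: E_verts)
    also have "\<dots> = (if t = d then g d else \<zero>)" using cd by (simp add: resolve_f E_verts)
    finally show "g t \<otimes> W = (if t = d then g d else \<zero>)" .
  qed auto
  also have "\<dots> \<longleftrightarrow> (\<forall>q\<in>V. \<forall>t. (c, t) \<in> E \<longrightarrow> (\<Oplus>i\<in>into q. L2 i q c t \<otimes> R2 i q c d)
        = (if t = d then f q \<otimes> g t else \<zero>))"
    using corner by auto
  finally show ?thesis .
qed

text \<open>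
  The relations $[x,\overline{c_j}]\bullet\overline{y_j}=x$ and
  $[\overline{x_i},a]\bullet[x,\overline{b_i}]=\underline{\mathrm{ev}}(da\otimes x)$ for
  $x=e_{t\leftarrow s}$ and $a=f_r$. They are \<open>inv_rel t s\<close> and \<open>ev_rel t s\<close> of the frame in \<open>swap\<close>.
\<close>

definition inv_rel' where
  "inv_rel' s t \<longleftrightarrow>
    (\<Oplus>i\<in>E. (e s t \<otimes> g (snd i) \<ominus> g (snd i) \<otimes> e s t) \<otimes> z (fst i) (snd i)) = \<ominus> e s t"

definition ev_rel' where
  "ev_rel' s t \<longleftrightarrow> (\<forall>r\<in>V. (\<Oplus>i\<in>E. (z (fst i) (snd i) \<otimes> f r \<ominus> f r \<otimes> z (fst i) (snd i))
        \<otimes> (e s t \<otimes> g (fst i) \<ominus> g (fst i) \<otimes> e s t))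
      = (if r = t then f s else \<zero>) \<ominus> (if r = s then f s else \<zero>))"

lemma finsum_converse:
  assumes "\<And>i. i \<in> E \<Longrightarrow> F (prod.swap i) \<in> carrier S"
  shows "(\<Oplus>i\<in>E\<inverse>. F i) = (\<Oplus>i\<in>E. F (prod.swap i))"
proof -
  have "E\<inverse> = prod.swap ` E" by force
  then have "(\<Oplus>i\<in>E\<inverse>. F i) = (\<Oplus>i\<in>prod.swap ` E. F i)" by simp
  also have "\<dots> = (\<Oplus>i\<in>E. F (prod.swap i))"
    by (rule add.finprod_reindex) (use assms in auto)
  finally show ?thesis .
qed

lemma inv_rel'_iff:
  assumes st: "(s, t) \<in> E"
  shows "inv_rel' s t \<longleftrightarrow>
    (\<forall>q\<in>V. L1 s t q = (\<Oplus>i\<in>into q. L2 s t i q \<otimes> R1 s i q)) \<and>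
    (\<forall>q\<in>V. \<forall>p. (s, p) \<in> E \<longrightarrow> (\<Oplus>i\<in>into q. L2 s t i q \<otimes> R2 s p i q)
        = (if t = p then f t \<otimes> g q else \<zero>))"
proof -
  interpret sw: frame S V "E\<inverse>" g f "\<lambda>a b. Z b a" "\<lambda>a b. X b a" by (rule swap)
  have ez: "sw.e a b = z b a" "sw.z a b = e b a" for a b
    by (simp_all add: sw.e_def sw.z_def e_def z_def)
  have "inv_rel' s t \<longleftrightarrow> sw.inv_rel t s"
    unfolding inv_rel'_def sw.inv_rel_def ez
    using st by (subst finsum_converse) (auto simp: E_verts)
  also have "\<dots> \<longleftrightarrow>
    (\<forall>q\<in>V. \<ominus> L1 s t q = (\<Oplus>i\<in>into q. L2 s t i q \<otimes> sw.L1 q i s)) \<and>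
    (\<forall>q\<in>V. \<forall>p. (s, p) \<in> E \<longrightarrow> (\<Oplus>i\<in>into q. L2 s t i q \<otimes> R2 s p i q)
        = (if t = p then g q \<otimes> f t else \<zero>))"
    using st by (simp add: sw.inv_rel_iff swap_arrows)
  also have "(\<forall>q\<in>V. \<ominus> L1 s t q = (\<Oplus>i\<in>into q. L2 s t i q \<otimes> sw.L1 q i s)) \<longleftrightarrow>
     (\<forall>q\<in>V. L1 s t q = (\<Oplus>i\<in>into q. L2 s t i q \<otimes> R1 s i q))"
  proof (intro ball_cong refl)
    fix q assume q: "q \<in> V"
    have "(\<Oplus>i\<in>into q. L2 s t i q \<otimes> sw.L1 q i s)
        = (\<Oplus>i\<in>into q. \<ominus> (L2 s t i q \<otimes> R1 s i q))"
      using q st by (intro finsum_cong') (auto simp: swap_arrows E_verts r_minus)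
    also have "\<dots> = \<ominus> (\<Oplus>i\<in>into q. L2 s t i q \<otimes> R1 s i q)"
      using q st by (intro finsum_neg) (auto simp: E_verts)
    finally show "\<ominus> L1 s t q = (\<Oplus>i\<in>into q. L2 s t i q \<otimes> sw.L1 q i s) \<longleftrightarrow>
       L1 s t q = (\<Oplus>i\<in>into q. L2 s t i q \<otimes> R1 s i q)"
      using q st by (simp add: neg_inject E_verts Pi_def)
  qed
  also have "(\<forall>q\<in>V. \<forall>p. (s, p) \<in> E \<longrightarrow> (\<Oplus>i\<in>into q. L2 s t i q \<otimes> R2 s p i q)
        = (if t = p then g q \<otimes> f t else \<zero>)) \<longleftrightarrow>
     (\<forall>q\<in>V. \<forall>p. (s, p) \<in> E \<longrightarrow> (\<Oplus>i\<in>into q. L2 s t i q \<otimes> R2 s p i q)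
        = (if t = p then f t \<otimes> g q else \<zero>))"
    using st by (intro ball_cong refl) (simp add: fg E_verts)
  finally show ?thesis .
qed

lemma ev_rel'_iff:
  assumes st: "(s, t) \<in> E"
  shows "ev_rel' s t \<longleftrightarrow>
    (\<forall>q\<in>V. \<forall>p. (p, t) \<in> E \<longrightarrow> (\<Oplus>i\<in>out q. R2 p t q i \<otimes> L2 s t q i)
        = (if p = s then f p \<otimes> g q else \<zero>))"
proof -
  interpret sw: frame S V "E\<inverse>" g f "\<lambda>a b. Z b a" "\<lambda>a b. X b a" by (rule swap)
  have ez: "sw.e a b = z b a" "sw.z a b = e b a" for a b
    by (simp_all add: sw.e_def sw.z_def e_def z_def)
  have "ev_rel' s t \<longleftrightarrow> sw.ev_rel t s"
    unfolding ev_rel'_def sw.ev_rel_def ez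
    using st by (intro ball_cong refl, subst finsum_converse) (auto simp: E_verts)
  also have "\<dots> \<longleftrightarrow>
    (\<forall>q\<in>V. \<forall>p. (p, t) \<in> E \<longrightarrow> (\<Oplus>i\<in>out q. R2 p t q i \<otimes> L2 s t q i)
        = (if p = s then g q \<otimes> f p else \<zero>))"
    using st by (simp add: sw.ev_rel_iff swap_arrows)
  also have "\<dots> \<longleftrightarrow>
    (\<forall>q\<in>V. \<forall>p. (p, t) \<in> E \<longrightarrow> (\<Oplus>i\<in>out q. R2 p t q i \<otimes> L2 s t q i)
        = (if p = s then f p \<otimes> g q else \<zero>))"
    using st by (intro ball_cong refl) (auto simp: fg E_verts)
  finally show ?thesis .
qed

lemma Z_decomp:
  assumes cd: "(c, d) \<in> E"
  shows "\<ominus> Z c d = (\<Oplus>p\<in>V. R1 p c d) \<oplus> (\<Oplus>i\<in>E. R2 (fst i) (snd i) c d)"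
proof -
  interpret sw: frame S V "E\<inverse>" g f "\<lambda>a b. Z b a" "\<lambda>a b. X b a" by (rule swap)
  have "Z c d = (\<Oplus>p\<in>V. sw.L1 d c p) \<ominus> (\<Oplus>i\<in>E\<inverse>. sw.L2 d c (fst i) (snd i))"
    using sw.X_decomp[of d c] cd by simp
  also have "(\<Oplus>p\<in>V. sw.L1 d c p) = (\<Oplus>p\<in>V. \<ominus> R1 p c d)"
    using cd by (intro finsum_cong') (auto simp: swap_arrows)
  also have "\<dots> = \<ominus> (\<Oplus>p\<in>V. R1 p c d)"
    using cd by (intro finsum_neg) auto
  also have "(\<Oplus>i\<in>E\<inverse>. sw.L2 d c (fst i) (snd i)) = (\<Oplus>i\<in>E. R2 (fst i) (snd i) c d)"
    using cd by (subst finsum_converse) (auto simp: swap_arrows)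
  finally show ?thesis
    using cd by (simp add: minus_eq minus_add[symmetric] Pi_def)
qed

end

section \<open>Homomorphisms out of the free algebra\<close>

lemma free_alg_simps:
  "x \<otimes>\<^bsub>free_alg G\<^esub> y = x \<bullet> y" "x \<oplus>\<^bsub>free_alg G\<^esub> y = x + y" "\<zero>\<^bsub>free_alg G\<^esub> = 0"
  "\<one>\<^bsub>free_alg G\<^esub> = free_one" "k \<odot>\<^bsub>free_alg G\<^esub> x = basis_smult k x"
  by (simp_all add: free_alg_def basis_alg_def free_mult_def free_one_def)

lemmas free_alg_uminus = basis_alg_uminus[OF ring_free_alg[unfolded free_alg_def], folded free_alg_def]

lemma hx_gens_closed:
  "a \<in> fun_A D \<Longrightarrow> hA a \<in> carrier (free_alg (hx_gens D))"
  "a \<in> fun_A D \<Longrightarrow> hAbar a \<in> carrier (free_alg (hx_gens D))"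
  "x \<in> vfields D \<Longrightarrow> hX x \<in> carrier (free_alg (hx_gens D))"
  "x \<in> vfields D \<Longrightarrow> hXbar x \<in> carrier (free_alg (hx_gens D))"
  by (auto simp: hA_def hAbar_def hX_def hXbar_def hx_gens_def intro!: free_gen_in_free_alg)

lemma (in pair_digraph) ev_e:
  fixes w :: "'a \<times> 'a \<Rightarrow> 'k::field"
  assumes "(a, b) \<in> parcs G"
  shows "ev G (e_vec b a) w = scale (w (a, b)) (f_vec b)"
    and "ev_u G w (e_vec b a) = scale (w (a, b)) (f_vec a)"
proof -
  have "(\<Sum>s | (s, t) \<in> parcs G. e_vec b a (s, t) * w (s, t))
      = (\<Sum>s | (s, t) \<in> parcs G. if s = a then (if t = b then w (a, b) else 0) else 0)" for t
    by (rule sum.cong) (auto simp: basis_vec_def)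
  note 1 = this
  have "(\<Sum>t | (s, t) \<in> parcs G. w (s, t) * e_vec b a (s, t))
      = (\<Sum>t | (s, t) \<in> parcs G. if t = b then (if s = a then w (a, b) else 0) else 0)" for s
    by (rule sum.cong) (auto simp: basis_vec_def)
  note 2 = this
  show "ev G (e_vec b a) w = scale (w (a, b)) (f_vec b)"
    unfolding ev_def 1 using assms by (auto simp: scale_def basis_vec_def fun_eq_iff finite_in_nbrs)
  show "ev_u G w (e_vec b a) = scale (w (a, b)) (f_vec a)"
    unfolding ev_u_def 2 using assms by (auto simp: scale_def basis_vec_def fun_eq_iff finite_out_nbrs)
qed

lemma free_alg_closed:
  assumes "x \<in> carrier (free_alg G)" "y \<in> carrier (free_alg G)"
  shows "x + y \<in> carrier (free_alg G)" "x - y \<in> carrier (free_alg G)" "x \<bullet> y \<in> carrier (free_alg G)"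
    "free_comm x y \<in> carrier (free_alg G)"
proof -
  interpret alg "free_alg G" by (rule alg_free_alg)
  have *: "x + y \<in> carrier (free_alg G)" "x \<bullet> y \<in> carrier (free_alg G)" "x - y \<in> carrier (free_alg G)"
    if "x \<in> carrier (free_alg G)" "y \<in> carrier (free_alg G)" for x y
    using a_closed[OF that] m_closed[OF that] a_closed[OF that(1) free_alg_uminus(2)[OF that(2)]]
    by (simp_all add: free_alg_simps)
  show "x + y \<in> carrier (free_alg G)" "x - y \<in> carrier (free_alg G)" "x \<bullet> y \<in> carrier (free_alg G)"
    "free_comm x y \<in> carrier (free_alg G)"
    unfolding free_comm_def by (intro * assms)+
qed

lemma free_alg_zero_closed: "0 \<in> carrier (free_alg G)"
  by (simp add: free_alg_def basis_alg_def)

locale free_hom = alg_morphism "free_alg G" S h for G and S :: "('k::field, 'a) module" (structure) and h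
begin

lemma h_mult: "x \<in> carrier (free_alg G) \<Longrightarrow> y \<in> carrier (free_alg G) \<Longrightarrow> h (x \<bullet> y) = h x \<otimes> h y"
  using mult[of x y] by (simp add: free_alg_simps)

lemma h_add: "x \<in> carrier (free_alg G) \<Longrightarrow> y \<in> carrier (free_alg G) \<Longrightarrow> h (x + y) = h x \<oplus> h y"
  using add[of x y] by (simp add: free_alg_simps)

lemma h_smult: "x \<in> carrier (free_alg G) \<Longrightarrow> h (basis_smult k x) = k \<odot> h x"
  using smult[of x k] by (simp add: free_alg_simps)

lemma h_0: "h 0 = \<zero>" and h_1: "h free_one = \<one>"
  using hom_zero one by (simp_all add: free_alg_simps)

lemma h_diff:
  assumes "x \<in> carrier (free_alg G)" "y \<in> carrier (free_alg G)"
  shows "h (x - y) = h x \<ominus> h y"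
proof -
  have "h (- y) = \<ominus> h y"
    using assms hom_a_inv[of y] by (simp add: free_alg_uminus)
  then show ?thesis
    using assms h_add[of x "- y"] free_alg_uminus(2)[of y] by (simp add: S.minus_eq)
qed

lemma h_comm:
  assumes "x \<in> carrier (free_alg G)" "y \<in> carrier (free_alg G)"
  shows "h (free_comm x y) = h x \<otimes> h y \<ominus> h y \<otimes> h x"
  unfolding free_comm_def using assms by (simp add: h_diff h_mult free_alg_closed)

lemma h_sum:
  assumes "\<And>i. i \<in> I \<Longrightarrow> t i \<in> carrier (free_alg G)"
  shows "h (\<Sum>i\<in>I. t i) = (\<Oplus>i\<in>I. h (t i))" "(\<Sum>i\<in>I. t i) \<in> carrier (free_alg G)"
proof -
  have "h (\<Sum>i\<in>I. t i) = (\<Oplus>i\<in>I. h (t i)) \<and> (\<Sum>i\<in>I. t i) \<in> carrier (free_alg G)"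
    using assms
    by (induction I rule: infinite_finite_induct)
       (simp_all add: h_0 h_add free_alg_closed free_alg_zero_closed Pi_def)
  then show "h (\<Sum>i\<in>I. t i) = (\<Oplus>i\<in>I. h (t i))" "(\<Sum>i\<in>I. t i) \<in> carrier (free_alg G)" by auto
qed

end

text \<open>
  The homomorphisms from the free algebra that respect the relations of $H\mathfrak{X}^1$. The class map is one of them, and
  so is the composite of any homomorphism from $H\mathfrak{X}^1$ with it.
\<close>

locale hx_hom = pair_digraph D + free_hom "hx_gens D" S h
  for D :: "'v pair_pre_digraph" and S :: "('k::field, 'a) module" (structure) and h +
  assumes rel: "\<And>l r. hx_rel D l r \<Longrightarrow> h l = h r"
begin

definition "f p = h (hA (f_vec p))"
definition "g p = h (hAbar (f_vec p))"
definition "X a b = h (hX (e_vec b a)) \<ominus> f b"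
definition "Z c d = \<ominus> (h (hXbar (e_vec d c)) \<oplus> g c)"

lemma arc_verts: "(a, b) \<in> parcs D \<Longrightarrow> a \<in> pverts D" "(a, b) \<in> parcs D \<Longrightarrow> b \<in> pverts D"
  by (auto dest: in_arcsD1 in_arcsD2)

lemma neq: "(a, b) \<in> parcs D \<Longrightarrow> a \<noteq> b"
  using pair_no_loops[of "(a, b)"] by simp

lemma f_vec_mult: "f_vec p * f_vec q = (if p = q then f_vec p else 0 :: 'v \<Rightarrow> 'k)"
  by (auto simp: basis_vec_def fun_eq_iff)

lemma scale_0: "scale 0 a = (0 :: 'i \<Rightarrow> 'k)"
  by (auto simp: scale_def fun_eq_iff)

lemma scale_m1: "scale (- 1) a = (- a :: 'i \<Rightarrow> 'k)"
  by (auto simp: scale_def fun_eq_iff)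

lemma zero_coord: "(0 :: 'i \<Rightarrow> 'k) \<in> coord_space I"
  by (simp add: coord_space_def)

lemma gens_linear:
  "a \<in> fun_A D \<Longrightarrow> b \<in> fun_A D \<Longrightarrow> h (hA (a + b)) = h (hA a) \<oplus> h (hA b)"
  "a \<in> fun_A D \<Longrightarrow> h (hA (scale k a)) = k \<odot> h (hA a)"
  "a \<in> fun_A D \<Longrightarrow> b \<in> fun_A D \<Longrightarrow> h (hAbar (a + b)) = h (hAbar a) \<oplus> h (hAbar b)"
  "a \<in> fun_A D \<Longrightarrow> h (hAbar (scale k a)) = k \<odot> h (hAbar a)"
  "x \<in> vfields D \<Longrightarrow> y \<in> vfields D \<Longrightarrow> h (hX (x + y)) = h (hX x) \<oplus> h (hX y)"
  "x \<in> vfields D \<Longrightarrow> h (hX (scale k x)) = k \<odot> h (hX x)"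
  "x \<in> vfields D \<Longrightarrow> y \<in> vfields D \<Longrightarrow> h (hXbar (x + y)) = h (hXbar x) \<oplus> h (hXbar y)"
  "x \<in> vfields D \<Longrightarrow> h (hXbar (scale k x)) = k \<odot> h (hXbar x)"
  using rel[OF hx_rel.A_add] rel[OF hx_rel.A_scale] rel[OF hx_rel.Abar_add] rel[OF hx_rel.Abar_scale]
    rel[OF hx_rel.X_add] rel[OF hx_rel.X_scale] rel[OF hx_rel.Xbar_add] rel[OF hx_rel.Xbar_scale]
  by (simp_all add: h_add h_smult hx_gens_closed)

lemma gens_0: "h (hA 0) = \<zero>" "h (hAbar 0) = \<zero>"
  using gens_linear(2)[of 0 0] gens_linear(4)[of 0 0] by (simp_all add: scale_0 zero_coord hx_gens_closed)

lemma finite_parcs [simp]: "finite (parcs D)"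
  using pair_finite_arcs .

lemma f_vec_in [simp]: "p \<in> pverts D \<Longrightarrow> f_vec p \<in> fun_A D"
  "(a, b) \<in> parcs D \<Longrightarrow> basis_vec (a, b) \<in> vfields D"
  by (simp_all add: basis_vec_coord)

lemma expand:
  "a \<in> fun_A D \<Longrightarrow> h (hA a) = (\<Oplus>p\<in>pverts D. a p \<odot> f p)"
  "a \<in> fun_A D \<Longrightarrow> h (hAbar a) = (\<Oplus>p\<in>pverts D. a p \<odot> g p)"
  "x \<in> vfields D \<Longrightarrow> h (hX x) = (\<Oplus>i\<in>parcs D. x i \<odot> h (hX (basis_vec i)))"
  "x \<in> vfields D \<Longrightarrow> h (hXbar x) = (\<Oplus>i\<in>parcs D. x i \<odot> h (hXbar (basis_vec i)))"
  unfolding f_def g_def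
  by (rule S.linear_expand[where T = "\<lambda>a. h (hA a)"] S.linear_expand[where T = "\<lambda>a. h (hAbar a)"]
      S.linear_expand[where T = "\<lambda>a. h (hX a)"] S.linear_expand[where T = "\<lambda>a. h (hXbar a)"],
      (rule pair_finite_verts finite_parcs closed hx_gens_closed gens_linear | assumption)+)+

text \<open>
  The two cases in which the evaluation term matters are $x\bullet f_a$ for $x=e_{b\leftarrow a}$,
  where the value of $df_a$ on $a\to b$ is $-1$, and $\overline x\bullet\overline{f_b}$, where the value of $df_b$ is $1$.
\<close>

lemma gens_mult:
  "(a, b) \<in> parcs D \<Longrightarrow> f b \<otimes> h (hX (e_vec b a)) = h (hX (e_vec b a))"
  "(a, b) \<in> parcs D \<Longrightarrow> h (hX (e_vec b a)) \<otimes> f a = h (hX (e_vec b a)) \<ominus> f b"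
  "(a, b) \<in> parcs D \<Longrightarrow> g a \<otimes> h (hXbar (e_vec b a)) = h (hXbar (e_vec b a))"
  "(a, b) \<in> parcs D \<Longrightarrow> h (hXbar (e_vec b a)) \<otimes> g b = h (hXbar (e_vec b a)) \<oplus> g a"
proof -
  assume ab: "(a, b) \<in> parcs D"
  have ev: "ev D (e_vec b a) (ext_d D (f_vec a)) = - (f_vec b :: 'v \<Rightarrow> 'k)"
    "ev_u D (ext_d D (f_vec b)) (e_vec b a) = (f_vec a :: 'v \<Rightarrow> 'k)"
    unfolding ev_e[OF ab] using ab neq[OF ab] by (auto simp: ext_d_def basis_vec_def scale_def fun_eq_iff)
  have act: "vf_ract (e_vec b a) (f_vec a) = (e_vec b a :: 'v \<times> 'v \<Rightarrow> 'k)"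
      "vf_lact (f_vec b) (e_vec b a) = (e_vec b a :: 'v \<times> 'v \<Rightarrow> 'k)"
    by (auto simp: vf_ract_def vf_lact_def basis_vec_def fun_eq_iff)
  have m: "- (f_vec b :: 'v \<Rightarrow> 'k) \<in> fun_A D" "h (hA (- f_vec b)) = \<ominus> f b"
    using ab gens_linear(2)[of "f_vec b" "- 1"] arc_verts
    by (auto simp: coord_space_def basis_vec_def scale_m1 f_def S.smult_minus_left hx_gens_closed)
  have act1: "vf_lact (f_vec b) (e_vec b a) = (e_vec b a :: 'v \<times> 'v \<Rightarrow> 'k)"
    by (auto simp: vf_lact_def basis_vec_def fun_eq_iff)
  show "f b \<otimes> h (hX (e_vec b a)) = h (hX (e_vec b a))"
    using rel[OF hx_rel.A_X[of "f_vec b" D "e_vec b a"]] ab arc_verts[OF ab]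
    by (simp add: act1 h_mult hx_gens_closed f_def)
  show "h (hX (e_vec b a)) \<otimes> f a = h (hX (e_vec b a)) \<ominus> f b"
    using rel[OF hx_rel.X_A[of "f_vec a" D "e_vec b a"]] ab m arc_verts[OF ab]
    by (simp add: ev act h_mult h_add hx_gens_closed f_def S.minus_eq)
  show "g a \<otimes> h (hXbar (e_vec b a)) = h (hXbar (e_vec b a))"
    using rel[OF hx_rel.Abar_Xbar[of "f_vec a" D "e_vec b a"]] ab arc_verts[OF ab]
    by (simp add: act h_mult h_add hx_gens_closed g_def)
  show "h (hXbar (e_vec b a)) \<otimes> g b = h (hXbar (e_vec b a)) \<oplus> g a"
    using rel[OF hx_rel.Xbar_Abar[of "f_vec b" D "e_vec b a"]] ab arc_verts[OF ab]
    by (simp add: ev act h_mult h_add hx_gens_closed g_def)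
qed

text \<open>
  The tensor $f_p\otimes f_q$ satisfies $f_pf_q=0$ and $f_p\,df_q=0$ as soon as \<open>p\<close> and \<open>q\<close> are distinct and
  not joined by an arc from \<open>p\<close> to \<open>q\<close>.
\<close>

lemma supp:
  assumes ab: "(a, b) \<in> parcs D" and pq: "p \<in> pverts D" "q \<in> pverts D" "p \<noteq> q" "(p, q) \<notin> parcs D"
  shows "g q \<otimes> h (hX (e_vec b a)) \<otimes> g p = \<zero>" "f p \<otimes> h (hXbar (e_vec b a)) \<otimes> f q = \<zero>"
proof -
  have 0: "f_vec p * f_vec q = (0 :: 'v \<Rightarrow> 'k)" "form_lact (f_vec p) (ext_d D (f_vec q)) = (0 :: 'v \<times> 'v \<Rightarrow> 'k)"
    using pq by (auto simp: basis_vec_def form_lact_def ext_d_def fun_eq_iff)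
  then show "g q \<otimes> h (hX (e_vec b a)) \<otimes> g p = \<zero>"
    using rel[OF hx_rel.ker_X[of "[(f_vec p, f_vec q)]" D "e_vec b a"]] ab pq
    by (simp add: h_mult h_0 hx_gens_closed free_alg_closed g_def)
  show "f p \<otimes> h (hXbar (e_vec b a)) \<otimes> f q = \<zero>"
    using 0 rel[OF hx_rel.ker_Xbar[of "[(f_vec p, f_vec q)]" D "e_vec b a"]] ab pq
    by (simp add: h_mult h_0 hx_gens_closed free_alg_closed f_def)
qed

lemma fg_closed [simp]: "p \<in> pverts D \<Longrightarrow> f p \<in> carrier S" "p \<in> pverts D \<Longrightarrow> g p \<in> carrier S"
  by (simp_all add: f_def g_def hx_gens_closed)

lemma fg_orth:
  assumes "p \<in> pverts D" "q \<in> pverts D"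
  shows "f p \<otimes> f q = (if p = q then f p else \<zero>)" "g p \<otimes> g q = (if p = q then g p else \<zero>)"
    "f p \<otimes> g q = g q \<otimes> f p"
  using assms rel[OF hx_rel.A_mult[of "f_vec p" D "f_vec q"]] rel[OF hx_rel.Abar_mult[of "f_vec p" D "f_vec q"]]
    rel[OF hx_rel.A_Abar_commute[of "f_vec p" D "f_vec q"]]
  by (auto simp: f_def g_def h_mult hx_gens_closed f_vec_mult gens_0 split: if_splits)

lemma fg_sum: "(\<Oplus>p\<in>pverts D. f p) = \<one>" "(\<Oplus>p\<in>pverts D. g p) = \<one>"
proof -
  have 1: "(one_A D :: 'v \<Rightarrow> 'k) \<in> fun_A D" by (simp add: one_A_def coord_space_def)
  have "(\<Oplus>p\<in>pverts D. f p) = h (hA (one_A D))"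
    unfolding expand(1)[OF 1] by (rule S.finsum_cong') (auto simp: one_A_def)
  then show "(\<Oplus>p\<in>pverts D. f p) = \<one>" using rel[OF hx_rel.A_one] by (simp add: h_1)
  have "(\<Oplus>p\<in>pverts D. g p) = h (hAbar (one_A D))"
    unfolding expand(2)[OF 1] by (rule S.finsum_cong') (auto simp: one_A_def)
  then show "(\<Oplus>p\<in>pverts D. g p) = \<one>" using rel[OF hx_rel.Abar_one] by (simp add: h_1)
qed

lemma e_closed [simp]: "(a, b) \<in> parcs D \<Longrightarrow> h (hX (e_vec b a)) \<in> carrier S"
  "(a, b) \<in> parcs D \<Longrightarrow> h (hXbar (e_vec b a)) \<in> carrier S"
  by (simp_all add: hx_gens_closed)

lemma XZ_corners:
  assumes "(a, b) \<in> parcs D" "p \<in> pverts D" "q \<in> pverts D" "p \<noteq> q"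
  shows "g q \<otimes> X a b \<otimes> g p = g q \<otimes> h (hX (e_vec b a)) \<otimes> g p"
    and "f p \<otimes> Z a b \<otimes> f q = \<ominus> (f p \<otimes> h (hXbar (e_vec b a)) \<otimes> f q)"
proof -
  note v = arc_verts[OF assms(1)]
  have "g q \<otimes> f b \<otimes> g p = \<zero>"
    using assms v by (simp add: fg_orth S.m_assoc) (simp add: S.m_assoc[symmetric] fg_orth)
  then show "g q \<otimes> X a b \<otimes> g p = g q \<otimes> h (hX (e_vec b a)) \<otimes> g p"
    using assms v by (simp add: X_def S.minus_eq S.r_distr S.l_distr S.r_minus S.l_minus)
  have "f p \<otimes> g a \<otimes> f q = \<zero>"
    using assms v by (simp add: fg_orth S.m_assoc)
  then show "f p \<otimes> Z a b \<otimes> f q = \<ominus> (f p \<otimes> h (hXbar (e_vec b a)) \<otimes> f q)"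
    using assms v by (simp add: Z_def S.minus_add S.r_distr S.l_distr S.r_minus S.l_minus)
qed

lemma frame: "frame S (pverts D) (parcs D) f g X Z"
proof
  show "finite (pverts D)" by (rule pair_finite_verts)
  show "parcs D \<subseteq> pverts D \<times> pverts D" using arc_verts by auto
  show "(a, a) \<notin> parcs D" for a using neq by auto
  show "f b \<otimes> X a b = X a b" "X a b \<otimes> f a = X a b" "X a b \<in> carrier S"
    "g a \<otimes> Z a b = Z a b" "Z a b \<otimes> g b = Z a b" "Z a b \<in> carrier S" if "(a, b) \<in> parcs D" for a b
    using that gens_mult[OF that] neq[OF that] arc_verts[OF that]
    by (auto simp: X_def Z_def S.minus_eq S.r_distr S.l_distr S.r_minus S.l_minus fg_orth)
  fix a b c d assume ab: "(a, b) \<in> parcs D" and cd: "c \<in> pverts D" "d \<in> pverts D" "c \<noteq> d" "(c, d) \<notin> parcs D"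
  show "g d \<otimes> X a b \<otimes> g c = \<zero>" "f c \<otimes> Z a b \<otimes> f d = \<zero>"
    using supp[OF ab cd] XZ_corners[OF ab cd(1-3)] by simp_all
qed (simp_all add: fg_orth fg_sum)

sublocale fr: frame S "pverts D" "parcs D" f g X Z by (rule frame)

lemma e_eq: "(a, b) \<in> parcs D \<Longrightarrow> fr.e a b = h (hX (e_vec b a))"
  using arc_verts by (simp add: fr.e_def X_def S.minus_eq S.a_assoc S.l_neg)

lemma z_eq: "(a, b) \<in> parcs D \<Longrightarrow> \<ominus> fr.z a b = h (hXbar (e_vec b a))"
  using arc_verts by (simp add: fr.z_def Z_def S.minus_add S.a_assoc S.r_neg)

lemma coev_images:
  assumes i: "i \<in> parcs D"
  shows "coev_b i \<in> fun_A D" "coev_c i \<in> fun_A D" "coev_x i \<in> vfields D" "coev_y i \<in> vfields D"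
    "h (hA (coev_b i)) = \<ominus> f (fst i)" "h (hAbar (coev_b i)) = \<ominus> g (fst i)"
    "h (hA (coev_c i)) = f (snd i)" "h (hAbar (coev_c i)) = g (snd i)"
    "h (hX (coev_x i)) = fr.e (fst i) (snd i)" "h (hX (coev_y i)) = fr.e (fst i) (snd i)"
    "h (hXbar (coev_x i)) = \<ominus> fr.z (fst i) (snd i)" "h (hXbar (coev_y i)) = \<ominus> fr.z (fst i) (snd i)"
proof -
  obtain a b where ab: "i = (a, b)" "(a, b) \<in> parcs D" using i by (cases i) auto
  note v = arc_verts[OF ab(2)]
  have m: "- f_vec a = (scale (- 1) (f_vec a) :: 'v \<Rightarrow> 'k)" by (auto simp: scale_def fun_eq_iff)
  show "coev_b i \<in> fun_A D"
    using ab v by (auto simp: coev_b_def coord_space_def basis_vec_def)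
  show "h (hA (coev_b i)) = \<ominus> f (fst i)" "h (hAbar (coev_b i)) = \<ominus> g (fst i)"
    unfolding coev_b_def ab fst_conv m f_def g_def using v
    by (simp_all add: gens_linear S.smult_minus_left hx_gens_closed)
qed (use i arc_verts[of "fst i" "snd i"] in \<open>simp_all add: coev_c_def coev_x_def coev_y_def f_def g_def e_eq z_eq basis_vec_coord\<close>)

lemma inv_rel:
  assumes cd: "(c, d) \<in> parcs D"
  shows "fr.inv_rel c d"
proof -
  let ?z = "fr.z c d"
  have "(\<Oplus>i\<in>parcs D. (?z \<otimes> f (fst i) \<ominus> f (fst i) \<otimes> ?z) \<otimes> fr.e (fst i) (snd i))
      = h (\<Sum>i\<in>parcs D. free_comm (hXbar (e_vec d c)) (hA (coev_b i)) \<bullet> hX (coev_x i))"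
    using cd by (subst h_sum(1)) (auto intro!: S.finsum_cong' simp: h_mult h_comm coev_images
      hx_gens_closed free_alg_closed arc_verts S.l_minus S.r_minus z_eq[symmetric])
  also have "\<dots> = h (hXbar (e_vec d c))" using cd by (intro rel hx_rel.Xbar_inv) simp
  finally show ?thesis using cd by (simp add: fr.inv_rel_def z_eq)
qed

lemma inv_rel':
  assumes st: "(s, t) \<in> parcs D"
  shows "fr.inv_rel' s t"
proof -
  let ?e = "fr.e s t" and ?S = "\<lambda>i. (fr.e s t \<otimes> g (snd i) \<ominus> g (snd i) \<otimes> fr.e s t) \<otimes> fr.z (fst i) (snd i)"
  have "\<ominus> (\<Oplus>i\<in>parcs D. ?S i) = (\<Oplus>i\<in>parcs D. \<ominus> ?S i)"
    using st by (intro S.finsum_neg[symmetric]) (auto simp: arc_verts)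
  also have "\<dots> = h (\<Sum>i\<in>parcs D. free_comm (hX (e_vec t s)) (hAbar (coev_c i)) \<bullet> hXbar (coev_y i))"
    using st by (subst h_sum(1)) (auto intro!: S.finsum_cong' simp: h_mult h_comm coev_images
      hx_gens_closed free_alg_closed arc_verts S.l_minus S.r_minus e_eq[symmetric])
  also have "\<dots> = h (hX (e_vec t s))" using st by (intro rel hx_rel.X_inv) simp
  finally have "\<ominus> (\<ominus> (\<Oplus>i\<in>parcs D. ?S i)) = \<ominus> ?e" using st by (simp add: e_eq)
  moreover have "(\<Oplus>i\<in>parcs D. ?S i) \<in> carrier S"
    using st by (intro S.finsum_closed) (auto simp: arc_verts)
  ultimately show ?thesis unfolding fr.inv_rel'_def by simp
qed

lemma ext_d_vec:
  assumes cd: "(c, d) \<in> parcs D"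
  shows "h (hAbar (ev D (e_vec d c) (ext_d D (f_vec r)))) = (if r = d then g d else \<zero>) \<ominus> (if r = c then g d else \<zero>)"
    and "h (hA (ev_u D (ext_d D (f_vec r)) (e_vec d c))) = (if r = d then f c else \<zero>) \<ominus> (if r = c then f c else \<zero>)"
proof -
  have k: "ext_d D (f_vec r) (c, d) = (if r = d then 1 else 0) - (if r = c then 1 else 0 :: 'k)"
    using cd by (auto simp: ext_d_def basis_vec_def)
  show "h (hAbar (ev D (e_vec d c) (ext_d D (f_vec r)))) = (if r = d then g d else \<zero>) \<ominus> (if r = c then g d else \<zero>)"
    unfolding ev_e[OF cd] k using arc_verts[OF cd]
    by (simp add: gens_linear S.smult_diff_left hx_gens_closed g_def)
  show "h (hA (ev_u D (ext_d D (f_vec r)) (e_vec d c))) = (if r = d then f c else \<zero>) \<ominus> (if r = c then f c else \<zero>)"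
    unfolding ev_e[OF cd] k using arc_verts[OF cd]
    by (simp add: gens_linear S.smult_diff_left hx_gens_closed f_def)
qed

lemma ev_rel:
  assumes cd: "(c, d) \<in> parcs D"
  shows "fr.ev_rel c d"
  unfolding fr.ev_rel_def
proof
  fix r assume r: "r \<in> pverts D"
  let ?S = "\<lambda>i. (fr.e (fst i) (snd i) \<otimes> g r \<ominus> g r \<otimes> fr.e (fst i) (snd i))
        \<otimes> (fr.z c d \<otimes> f (snd i) \<ominus> f (snd i) \<otimes> fr.z c d)"
  have S: "(\<Oplus>i\<in>parcs D. ?S i) \<in> carrier S"
    using cd r by (intro S.finsum_closed) (auto simp: arc_verts)
  have "\<ominus> (\<Oplus>i\<in>parcs D. ?S i) = (\<Oplus>i\<in>parcs D. \<ominus> ?S i)"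
    using cd r by (intro S.finsum_neg[symmetric]) (auto simp: arc_verts)
  also have "\<dots> = h (\<Sum>i\<in>parcs D. free_comm (hX (coev_y i)) (hAbar (f_vec r))
      \<bullet> free_comm (hXbar (e_vec d c)) (hA (coev_c i)))"
    using cd r by (subst h_sum(1)) (auto intro!: S.finsum_cong' simp: h_mult h_comm coev_images
      hx_gens_closed free_alg_closed arc_verts S.l_minus S.r_minus S.minus_eq S.minus_add S.r_distr z_eq[symmetric] g_def[symmetric])
  also have "\<dots> = h (hAbar (ev D (e_vec d c) (ext_d D (f_vec r))))"
    using cd r by (intro rel hx_rel.ev_inv) simp_all
  also have "\<dots> = \<ominus> ((if r = c then g d else \<zero>) \<ominus> (if r = d then g d else \<zero>))"
    unfolding ext_d_vec[OF cd] using cd by (simp add: S.minus_eq S.minus_add S.a_comm arc_verts)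
  finally show "(\<Oplus>i\<in>parcs D. ?S i) = (if r = c then g d else \<zero>) \<ominus> (if r = d then g d else \<zero>)"
    using S cd by (subst (asm) S.neg_inject) (simp_all add: arc_verts)
qed

lemma ev_rel':
  assumes st: "(s, t) \<in> parcs D"
  shows "fr.ev_rel' s t"
  unfolding fr.ev_rel'_def
proof
  fix r assume r: "r \<in> pverts D"
  have "(\<Oplus>i\<in>parcs D. (fr.z (fst i) (snd i) \<otimes> f r \<ominus> f r \<otimes> fr.z (fst i) (snd i))
        \<otimes> (fr.e s t \<otimes> g (fst i) \<ominus> g (fst i) \<otimes> fr.e s t))
      = h (\<Sum>i\<in>parcs D. free_comm (hXbar (coev_x i)) (hA (f_vec r))
      \<bullet> free_comm (hX (e_vec t s)) (hAbar (coev_b i)))"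
    using st r by (subst h_sum(1)) (auto intro!: S.finsum_cong' simp: h_mult h_comm coev_images
      hx_gens_closed free_alg_closed arc_verts S.l_minus S.r_minus S.l_distr S.minus_eq S.minus_add S.r_distr e_eq[symmetric] f_def[symmetric])
  also have "\<dots> = h (hA (ev_u D (ext_d D (f_vec r)) (e_vec t s)))"
    using st r by (intro rel hx_rel.ev_u_inv) simp_all
  also have "\<dots> = (if r = t then f s else \<zero>) \<ominus> (if r = s then f s else \<zero>)"
    by (rule ext_d_vec[OF st])
  finally show "(\<Oplus>i\<in>parcs D. (fr.z (fst i) (snd i) \<otimes> f r \<ominus> f r \<otimes> fr.z (fst i) (snd i))
        \<otimes> (fr.e s t \<otimes> g (fst i) \<ominus> g (fst i) \<otimes> fr.e s t))
      = (if r = t then f s else \<zero>) \<ominus> (if r = s then f s else \<zero>)" .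
qed

end

section \<open>From a frame to a homomorphism out of the free algebra\<close>

text \<open>
  A frame that satisfies the four sum relations. This is the description, common to both presentations, of a
  homomorphism into \<open>S\<close>.
\<close>

locale hx_frame = pair_digraph D + alg S + frame S "pverts D" "parcs D" f g X Z
  for D :: "'v pair_pre_digraph" and S :: "('k::field, 'a) module" (structure) and f g X Z +
  assumes inv: "\<And>c d. (c, d) \<in> parcs D \<Longrightarrow> inv_rel c d"
    and inv': "\<And>s t. (s, t) \<in> parcs D \<Longrightarrow> inv_rel' s t"
    and ev: "\<And>c d. (c, d) \<in> parcs D \<Longrightarrow> ev_rel c d"
    and ev': "\<And>s t. (s, t) \<in> parcs D \<Longrightarrow> ev_rel' s t"
begin

abbreviation "V \<equiv> pverts D"
abbreviation "E \<equiv> parcs D"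

text \<open>
  The images of the generators \<open>hA\<close>, \<open>hAbar\<close>, \<open>hX\<close> and \<open>hXbar\<close>.
\<close>

definition "imA = comb V f"
definition "imB = comb V g"
definition "imX = comb E (\<lambda>i. e (fst i) (snd i))"
definition "imY = comb E (\<lambda>i. \<ominus> z (fst i) (snd i))"

lemma im_linear: "linear_map V imA" "linear_map V imB" "linear_map E imX" "linear_map E imY"
  unfolding imA_def imB_def imX_def imY_def by (rule linear_map_comb; auto)+

lemma im_basis:
  "p \<in> V \<Longrightarrow> imA (f_vec p) = f p" "p \<in> V \<Longrightarrow> imB (f_vec p) = g p"
  "i \<in> E \<Longrightarrow> imX (basis_vec i) = e (fst i) (snd i)" "i \<in> E \<Longrightarrow> imY (basis_vec i) = \<ominus> z (fst i) (snd i)"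
  unfolding imA_def imB_def imX_def imY_def by (subst comb_basis; auto simp: fin_V)+

lemma im_closed [simp]:
  "a \<in> fun_A D \<Longrightarrow> imA a \<in> carrier S" "a \<in> fun_A D \<Longrightarrow> imB a \<in> carrier S"
  "x \<in> vfields D \<Longrightarrow> imX x \<in> carrier S" "x \<in> vfields D \<Longrightarrow> imY x \<in> carrier S"
  using im_linear by (auto dest: linear_mapD(1))

lemma absorb:
  assumes pq: "p \<in> V" "q \<in> V" and y: "y \<in> carrier S"
  shows "f p \<otimes> y = y \<Longrightarrow> f q \<otimes> y = (if p = q then y else \<zero>)"
    "y \<otimes> f p = y \<Longrightarrow> y \<otimes> f q = (if p = q then y else \<zero>)"
    "g p \<otimes> y = y \<Longrightarrow> g q \<otimes> y = (if p = q then y else \<zero>)"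
    "y \<otimes> g p = y \<Longrightarrow> y \<otimes> g q = (if p = q then y else \<zero>)"
proof -
  have *: "f q \<otimes> (f p \<otimes> y) = (if p = q then f p \<otimes> y else \<zero>)"
    "y \<otimes> f p \<otimes> f q = (if p = q then y \<otimes> f p else \<zero>)"
    "g q \<otimes> (g p \<otimes> y) = (if p = q then g p \<otimes> y else \<zero>)"
    "y \<otimes> g p \<otimes> g q = (if p = q then y \<otimes> g p else \<zero>)"
    using pq y assoc_rules(2,3)[OF y pq(2,1)] by (auto simp: m_assoc f_orth g_orth)
  show "f p \<otimes> y = y \<Longrightarrow> f q \<otimes> y = (if p = q then y else \<zero>)"
    "y \<otimes> f p = y \<Longrightarrow> y \<otimes> f q = (if p = q then y else \<zero>)"
    "g p \<otimes> y = y \<Longrightarrow> g q \<otimes> y = (if p = q then y else \<zero>)"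
    "y \<otimes> g p = y \<Longrightarrow> y \<otimes> g q = (if p = q then y else \<zero>)"
    using * by (simp_all only:)
qed

text \<open>
  An element fixed by \<open>f p\<close> or \<open>g p\<close> is an eigenvector for all functions, with their value at \<open>p\<close> as eigenvalue.
\<close>

lemma eigen:
  assumes p: "p \<in> V" and y: "y \<in> carrier S" and a: "a \<in> fun_A D"
  shows "f p \<otimes> y = y \<Longrightarrow> imA a \<otimes> y = a p \<odot> y" "y \<otimes> f p = y \<Longrightarrow> y \<otimes> imA a = a p \<odot> y"
    "g p \<otimes> y = y \<Longrightarrow> imB a \<otimes> y = a p \<odot> y" "y \<otimes> g p = y \<Longrightarrow> y \<otimes> imB a = a p \<odot> y"
proof -
  have coord: "linear_map V (\<lambda>a. a p \<odot> y)"
    using y by (simp add: linear_map_def smult_add_left smult_smult scale_def)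
  have basis: "f_vec q p \<odot> y = (if p = q then y else \<zero>)" for q
    using y by (simp add: basis_vec_def)
  note lin = coord linear_map_mult im_linear
  show "imA a \<otimes> y = a p \<odot> y" if "f p \<otimes> y = y"
    by (rule linear_eqI[OF fin_V _ coord _ a, where T = "\<lambda>a. imA a \<otimes> y"])
       (use y lin absorb(1)[OF p _ y that] in \<open>simp_all add: basis im_basis\<close>)
  show "y \<otimes> imA a = a p \<odot> y" if "y \<otimes> f p = y"
    by (rule linear_eqI[OF fin_V _ coord _ a, where T = "\<lambda>a. y \<otimes> imA a"])
       (use y lin absorb(2)[OF p _ y that] in \<open>simp_all add: basis im_basis\<close>)
  show "imB a \<otimes> y = a p \<odot> y" if "g p \<otimes> y = y"
    by (rule linear_eqI[OF fin_V _ coord _ a, where T = "\<lambda>a. imB a \<otimes> y"])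
       (use y lin absorb(3)[OF p _ y that] in \<open>simp_all add: basis im_basis\<close>)
  show "y \<otimes> imB a = a p \<odot> y" if "y \<otimes> g p = y"
    by (rule linear_eqI[OF fin_V _ coord _ a, where T = "\<lambda>a. y \<otimes> imB a"])
       (use y lin absorb(4)[OF p _ y that] in \<open>simp_all add: basis im_basis\<close>)
qed

lemma imA_mult:
  assumes a: "a \<in> fun_A D" and b: "b \<in> fun_A D"
  shows "imA a \<otimes> imA b = imA (a * b)" "imB a \<otimes> imB b = imB (b * a)"
proof -
  have vec: "a * f_vec q = scale (a q) (f_vec q)" "f_vec q * a = scale (a q) (f_vec q)" for q
    by (auto simp: basis_vec_def scale_def fun_eq_iff)
  show "imA a \<otimes> imA b = imA (a * b)"
  proof (rule linear_eqI[OF fin_V _ _ _ b, where T = "\<lambda>b. imA a \<otimes> imA b"])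
    show "linear_map V (\<lambda>b. imA (a * b))"
      by (rule linear_map_comp[OF im_linear(1)])
         (auto simp: coord_space_def scale_def algebra_simps fun_eq_iff)
    fix q assume "q \<in> V"
    then show "imA a \<otimes> imA (f_vec q) = imA (a * f_vec q)"
      using a eigen(1)[of q "f q" a] linear_mapD(3)[OF im_linear(1), of "f_vec q" "a q"]
      by (simp add: im_basis f_orth vec basis_vec_coord)
  qed (use a in \<open>auto intro!: linear_map_mult im_linear\<close>)
  show "imB a \<otimes> imB b = imB (b * a)"
  proof (rule linear_eqI[OF fin_V _ _ _ b, where T = "\<lambda>b. imB a \<otimes> imB b"])
    show "linear_map V (\<lambda>b. imB (b * a))"
      by (rule linear_map_comp[OF im_linear(2)])
         (auto simp: coord_space_def scale_def algebra_simps fun_eq_iff)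
    fix q assume "q \<in> V"
    then show "imB a \<otimes> imB (f_vec q) = imB (f_vec q * a)"
      using a eigen(3)[of q "g q" a] linear_mapD(3)[OF im_linear(2), of "f_vec q" "a q"]
      by (simp add: im_basis g_orth vec basis_vec_coord)
  qed (use a in \<open>auto intro!: linear_map_mult im_linear\<close>)
qed

lemma im_one: "imA (one_A D) = \<one>" "imB (one_A D) = \<one>"
proof -
  have "imA (one_A D) = (\<Oplus>p\<in>V. f p)" "imB (one_A D) = (\<Oplus>p\<in>V. g p)"
    unfolding imA_def imB_def comb_def by (intro finsum_cong'; auto simp: one_A_def)+
  then show "imA (one_A D) = \<one>" "imB (one_A D) = \<one>" by (simp_all add: f_sum g_sum)
qed

lemma im_commute:
  assumes a: "a \<in> fun_A D" and b: "b \<in> fun_A D"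
  shows "imA a \<otimes> imB b = imB b \<otimes> imA a"
proof (rule linear_eqI[OF fin_V _ _ _ b, where T = "\<lambda>b. imA a \<otimes> imB b"])
  fix q assume q: "q \<in> V"
  have "imA a \<otimes> g q = g q \<otimes> imA a"
    by (rule linear_eqI[OF fin_V _ _ _ a, where T = "\<lambda>a. imA a \<otimes> g q"])
       (use q fg in \<open>auto intro!: linear_map_mult im_linear simp: im_basis\<close>)
  then show "imA a \<otimes> imB (f_vec q) = imB (f_vec q) \<otimes> imA a" using q by (simp add: im_basis)
qed (use a in \<open>auto intro!: linear_map_mult im_linear\<close>)

text \<open>
  Splitting \<open>e a b = X a b \<oplus> f b\<close> into two eigenvectors on the right, with the eigenvalues \<open>w a\<close> and
  \<open>w b\<close>, shows how the derivation term comes back: it is the difference of the two eigenvalues.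
\<close>

lemma im_e_z:
  assumes ab: "(a, b) \<in> E" and w: "w \<in> fun_A D"
  shows "imA w \<otimes> e a b = w b \<odot> e a b" "e a b \<otimes> imA w = w a \<odot> e a b \<oplus> (w b - w a) \<odot> f b"
    "imB w \<otimes> z a b = w a \<odot> z a b" "z a b \<otimes> imB w = w b \<odot> z a b \<oplus> (w a - w b) \<odot> g a"
proof -
  note v = E_verts[OF ab]
  show "imA w \<otimes> e a b = w b \<odot> e a b"
    using ab v w by (intro eigen) (auto simp: e_def r_distr X_fl f_orth)
  show "imB w \<otimes> z a b = w a \<odot> z a b"
    using ab v w by (intro eigen) (auto simp: z_def r_distr Z_gl g_orth)
  have "e a b \<otimes> imA w = w a \<odot> X a b \<oplus> w b \<odot> f b"
    using ab v w eigen(2)[of a "X a b" w] eigen(2)[of b "f b" w]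
    by (simp add: e_def l_distr X_right f_orth)
  moreover have "w a \<odot> e a b \<oplus> (w b - w a) \<odot> f b = w a \<odot> X a b \<oplus> (w a + (w b - w a)) \<odot> f b"
    using ab v by (simp only: smult_add_left e_def smult_add_right a_assoc X_closed f_closed smult_closed)
  ultimately show "e a b \<otimes> imA w = w a \<odot> e a b \<oplus> (w b - w a) \<odot> f b" by simp
  have "z a b \<otimes> imB w = w b \<odot> Z a b \<oplus> w a \<odot> g a"
    using ab v w eigen(4)[of b "Z a b" w] eigen(4)[of a "g a" w]
    by (simp add: z_def l_distr Z_right g_orth)
  moreover have "w b \<odot> z a b \<oplus> (w a - w b) \<odot> g a = w b \<odot> Z a b \<oplus> (w b + (w a - w b)) \<odot> g a"
    using ab v by (simp only: smult_add_left z_def smult_add_right a_assoc Z_closed g_closed smult_closed)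
  ultimately show "z a b \<otimes> imB w = w b \<odot> z a b \<oplus> (w a - w b) \<odot> g a" by simp
qed

lemma act_simps:
  "vf_lact w (x + y) = vf_lact w x + vf_lact w (y :: 'v \<times> 'v \<Rightarrow> 'k)"
  "vf_lact w (scale k x) = scale k (vf_lact w x)"
  "vf_ract (x + y) w = vf_ract x w + vf_ract y w"
  "vf_ract (scale k x) w = scale k (vf_ract x w)"
  "ev D (x + y) t = ev D x t + ev D y t" "ev D (scale k x) t = scale k (ev D x t)"
  "ev_u D t (x + y) = ev_u D t x + ev_u D t y" "ev_u D t (scale k x) = scale k (ev_u D t x)"
  "ev D x (t + t') = ev D x t + ev D x t'" "ev D x (scale k t) = scale k (ev D x t)"
  "ev_u D (t + t') x = ev_u D t x + ev_u D t' x" "ev_u D (scale k t) x = scale k (ev_u D t x)"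
  "vf_lact w (basis_vec i) = scale (w (snd i)) (basis_vec i)"
  "vf_ract (basis_vec i) w = scale (w (fst i)) (basis_vec i)"
  by (auto simp: vf_lact_def vf_ract_def ev_def ev_u_def scale_def basis_vec_def fun_eq_iff
      algebra_simps sum.distrib sum_distrib_left)

lemma im_bimodule:
  assumes w: "w \<in> fun_A D" and x: "x \<in> vfields D"
  shows "imA w \<otimes> imX x = imX (vf_lact w x)"
    "imX x \<otimes> imA w = imX (vf_ract x w) \<oplus> imA (ev D x (ext_d D w))"
    "imB w \<otimes> imY x = imY (vf_ract x w)"
    "imY x \<otimes> imB w = imY (vf_lact w x) \<oplus> imB (ev_u D (ext_d D w) x)"
proof -
  have lin: "linear_map E (\<lambda>x. imX (vf_lact w x))" "linear_map E (\<lambda>x. imY (vf_lact w x))"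
    "linear_map E (\<lambda>x. imX (vf_ract x w))" "linear_map E (\<lambda>x. imY (vf_ract x w))"
    "linear_map E (\<lambda>x. imA (ev D x t))" "linear_map E (\<lambda>x. imB (ev_u D t x))" for t
    by (rule linear_map_comp[OF im_linear(3)] linear_map_comp[OF im_linear(4)]
          linear_map_comp[OF im_linear(1)] linear_map_comp[OF im_linear(2)];
        simp add: act_simps coord_space_closed ev_closed)+
  note lins = lin linear_map_mult im_linear linear_map_add
  have vec: "imX (scale k (basis_vec i)) = k \<odot> e (fst i) (snd i)"
    "imY (scale k (basis_vec i)) = \<ominus> (k \<odot> z (fst i) (snd i))"
    "imA (scale k (f_vec (snd i))) = k \<odot> f (snd i)" "imB (scale k (f_vec (fst i))) = k \<odot> g (fst i)"
    if "i \<in> E" for k i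
    using that E_verts[of "fst i" "snd i"]
    by (simp_all add: linear_mapD(3)[OF im_linear(1)] linear_mapD(3)[OF im_linear(2)]
      linear_mapD(3)[OF im_linear(3)] linear_mapD(3)[OF im_linear(4)] basis_vec_coord im_basis smult_minus_right)
  have evs: "ev D (basis_vec i) t = scale (t i) (f_vec (snd i))"
    "ev_u D t (basis_vec i) = scale (t i) (f_vec (fst i))" if "i \<in> E" for i and t :: "'v \<times> 'v \<Rightarrow> 'k"
    using ev_e[of "fst i" "snd i" t] that by simp_all
  have d: "ext_d D w i = w (snd i) - w (fst i)" if "i \<in> E" for i
    using that by (cases i) (simp add: ext_d_def)
  note base = im_basis act_simps(13,14) vec evs d im_e_z
  show "imA w \<otimes> imX x = imX (vf_lact w x)"
    by (rule linear_eqI[OF finite_E _ _ _ x, where T = "\<lambda>x. imA w \<otimes> imX x"])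
       (use w in \<open>auto intro!: lins simp: base\<close>)
  show "imX x \<otimes> imA w = imX (vf_ract x w) \<oplus> imA (ev D x (ext_d D w))"
    by (rule linear_eqI[OF finite_E _ _ _ x, where T = "\<lambda>x. imX x \<otimes> imA w"])
       (use w in \<open>auto intro!: lins simp: base\<close>)
  show "imB w \<otimes> imY x = imY (vf_ract x w)"
    by (rule linear_eqI[OF finite_E _ _ _ x, where T = "\<lambda>x. imB w \<otimes> imY x"])
       (use w in \<open>auto intro!: lins simp: base r_minus\<close>)
  show "imY x \<otimes> imB w = imY (vf_lact w x) \<oplus> imB (ev_u D (ext_d D w) x)"
    by (rule linear_eqI[OF finite_E _ _ _ x, where T = "\<lambda>x. imY x \<otimes> imB w"])
       (use w in \<open>auto intro!: lins simp: base l_minus minus_add E_verts smult_minus_left[symmetric]\<close>)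
qed

text \<open>
  The corner of a sandwich by a tensor is the corner of \<open>y\<close> times the value of the corresponding function on
  \<open>V \<times> V\<close>.
\<close>

lemma im_sandwich:
  assumes p: "p \<in> V" "q \<in> V" and y: "y \<in> carrier S" and rs: "r \<in> fun_A D" "s \<in> fun_A D"
  shows "g p \<otimes> (imB s \<otimes> y \<otimes> imB r) \<otimes> g q = (r q * s p) \<odot> (g p \<otimes> y \<otimes> g q)"
    "f p \<otimes> (imA r \<otimes> y \<otimes> imA s) \<otimes> f q = (r p * s q) \<odot> (f p \<otimes> y \<otimes> f q)"
proof -
  have "g p \<otimes> imB s = s p \<odot> g p" "imB r \<otimes> g q = r q \<odot> g q"
    "f p \<otimes> imA r = r p \<odot> f p" "imA s \<otimes> f q = s q \<odot> f q"
    using p rs by (auto intro!: eigen simp: f_orth g_orth)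
  note eq = this
  have "g p \<otimes> (imB s \<otimes> y \<otimes> imB r) \<otimes> g q = (g p \<otimes> imB s) \<otimes> y \<otimes> (imB r \<otimes> g q)"
    using p y rs by (simp add: m_assoc)
  then show "g p \<otimes> (imB s \<otimes> y \<otimes> imB r) \<otimes> g q = (r q * s p) \<odot> (g p \<otimes> y \<otimes> g q)"
    unfolding eq using p y by (simp add: smult_mult_left smult_mult_right smult_smult)
  have "f p \<otimes> (imA r \<otimes> y \<otimes> imA s) \<otimes> f q = (f p \<otimes> imA r) \<otimes> y \<otimes> (imA s \<otimes> f q)"
    using p y rs by (simp add: m_assoc)
  then show "f p \<otimes> (imA r \<otimes> y \<otimes> imA s) \<otimes> f q = (r p * s q) \<odot> (f p \<otimes> y \<otimes> f q)"
    unfolding eq using p y by (simp add: smult_mult_left smult_mult_right smult_smult mult.commute)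
qed

lemma im_supp:
  assumes pq: "p \<in> V" "q \<in> V" "p \<noteq> q" "(p, q) \<notin> E" and x: "x \<in> vfields D"
  shows "g q \<otimes> imX x \<otimes> g p = \<zero>" "f p \<otimes> imY x \<otimes> f q = \<zero>"
proof -
  have zero: "linear_map E (\<lambda>x. \<zero>)" by (simp add: linear_map_def)
  have e0: "g q \<otimes> e a b \<otimes> g p = \<zero>" "f p \<otimes> z a b \<otimes> f q = \<zero>" if "(a, b) \<in> E" for a b
  proof -
    have "g q \<otimes> f b \<otimes> g p = \<zero>" "f p \<otimes> g a \<otimes> f q = \<zero>"
      using pq that by (simp_all add: normalize)
    then show "g q \<otimes> e a b \<otimes> g p = \<zero>" "f p \<otimes> z a b \<otimes> f q = \<zero>"
      using pq that X_supp[OF that pq] Z_supp[OF that pq] E_verts[OF that]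
      by (simp_all add: e_def z_def r_distr l_distr)
  qed
  show "g q \<otimes> imX x \<otimes> g p = \<zero>"
    by (rule linear_eqI[OF finite_E _ zero _ x, where T = "\<lambda>x. g q \<otimes> imX x \<otimes> g p"])
       (use pq e0 in \<open>auto intro!: linear_map_mult im_linear simp: im_basis\<close>)
  show "f p \<otimes> imY x \<otimes> f q = \<zero>"
    by (rule linear_eqI[OF finite_E _ zero _ x, where T = "\<lambda>x. f p \<otimes> imY x \<otimes> f q"])
       (use pq e0 in \<open>auto intro!: linear_map_mult im_linear simp: im_basis l_minus r_minus E_verts\<close>)
qed

lemma im_coev:
  assumes i: "i \<in> E"
  shows "(coev_b i :: 'v \<Rightarrow> 'k) \<in> fun_A D" "coev_c i \<in> fun_A D" "coev_x i \<in> vfields D" "coev_y i \<in> vfields D"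
    "imA (coev_b i) = \<ominus> f (fst i)" "imB (coev_b i) = \<ominus> g (fst i)"
    "imA (coev_c i) = f (snd i)" "imB (coev_c i) = g (snd i)"
    "imX (coev_x i) = e (fst i) (snd i)" "imX (coev_y i) = e (fst i) (snd i)"
    "imY (coev_x i) = \<ominus> z (fst i) (snd i)" "imY (coev_y i) = \<ominus> z (fst i) (snd i)"
proof -
  have v: "fst i \<in> V" "snd i \<in> V" using i E_verts[of "fst i" "snd i"] by auto
  have m: "coev_b i = (scale (- 1) (f_vec (fst i)) :: 'v \<Rightarrow> 'k)"
    by (auto simp: coev_b_def scale_def fun_eq_iff)
  show "(coev_b i :: 'v \<Rightarrow> 'k) \<in> fun_A D" unfolding m using v by (simp add: coord_space_closed)
  show "imA (coev_b i) = \<ominus> f (fst i)" "imB (coev_b i) = \<ominus> g (fst i)"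
    unfolding m using v linear_mapD(3)[OF im_linear(1)] linear_mapD(3)[OF im_linear(2)]
    by (simp_all add: basis_vec_coord im_basis smult_minus_left)
  show "coev_c i \<in> fun_A D" "coev_x i \<in> vfields D" "coev_y i \<in> vfields D"
    "imA (coev_c i) = f (snd i)" "imB (coev_c i) = g (snd i)"
    "imX (coev_x i) = e (fst i) (snd i)" "imX (coev_y i) = e (fst i) (snd i)"
    "imY (coev_x i) = \<ominus> z (fst i) (snd i)" "imY (coev_y i) = \<ominus> z (fst i) (snd i)"
    using i v by (simp_all add: coev_c_def coev_x_def coev_y_def basis_vec_coord im_basis)
qed

lemmas linear_intros = linear_map_finsum linear_map_diff linear_map_mult im_linear

lemma im_inv:
  assumes x: "x \<in> vfields D"
  shows "(\<Oplus>i\<in>E. (imY x \<otimes> imA (coev_b i) \<ominus> imA (coev_b i) \<otimes> imY x) \<otimes> imX (coev_x i)) = imY x"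
    "(\<Oplus>i\<in>E. (imX x \<otimes> imB (coev_c i) \<ominus> imB (coev_c i) \<otimes> imX x) \<otimes> imY (coev_y i)) = imX x"
proof -
  show "(\<Oplus>i\<in>E. (imY x \<otimes> imA (coev_b i) \<ominus> imA (coev_b i) \<otimes> imY x) \<otimes> imX (coev_x i)) = imY x"
  proof (rule linear_eqI[OF finite_E _ im_linear(4) _ x])
    show "linear_map E (\<lambda>x. \<Oplus>i\<in>E. (imY x \<otimes> imA (coev_b i) \<ominus> imA (coev_b i) \<otimes> imY x) \<otimes> imX (coev_x i))"
      by (intro linear_intros) (simp_all add: im_coev im_linear)
    fix j assume j: "j \<in> E"
    let ?z = "z (fst j) (snd j)"
    have "(\<Oplus>i\<in>E. (imY (basis_vec j) \<otimes> imA (coev_b i) \<ominus> imA (coev_b i) \<otimes> imY (basis_vec j)) \<otimes> imX (coev_x i))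
        = (\<Oplus>i\<in>E. (?z \<otimes> f (fst i) \<ominus> f (fst i) \<otimes> ?z) \<otimes> e (fst i) (snd i))"
      using j by (intro finsum_cong') (auto simp: im_coev im_basis E_verts l_minus r_minus)
    also have "\<dots> = imY (basis_vec j)"
      using inv[of "fst j" "snd j"] j by (simp add: inv_rel_def im_basis)
    finally show "(\<Oplus>i\<in>E. (imY (basis_vec j) \<otimes> imA (coev_b i) \<ominus> imA (coev_b i) \<otimes> imY (basis_vec j)) \<otimes> imX (coev_x i))
        = imY (basis_vec j)" .
  qed
  show "(\<Oplus>i\<in>E. (imX x \<otimes> imB (coev_c i) \<ominus> imB (coev_c i) \<otimes> imX x) \<otimes> imY (coev_y i)) = imX x"
  proof (rule linear_eqI[OF finite_E _ im_linear(3) _ x])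
    show "linear_map E (\<lambda>x. \<Oplus>i\<in>E. (imX x \<otimes> imB (coev_c i) \<ominus> imB (coev_c i) \<otimes> imX x) \<otimes> imY (coev_y i))"
      by (intro linear_intros) (simp_all add: im_coev im_linear)
    fix j assume j: "j \<in> E"
    let ?e = "e (fst j) (snd j)"
    have "(\<Oplus>i\<in>E. (imX (basis_vec j) \<otimes> imB (coev_c i) \<ominus> imB (coev_c i) \<otimes> imX (basis_vec j)) \<otimes> imY (coev_y i))
        = (\<Oplus>i\<in>E. \<ominus> ((?e \<otimes> g (snd i) \<ominus> g (snd i) \<otimes> ?e) \<otimes> z (fst i) (snd i)))"
      using j by (intro finsum_cong') (auto simp: im_coev im_basis E_verts r_minus)
    also have "\<dots> = \<ominus> (\<Oplus>i\<in>E. (?e \<otimes> g (snd i) \<ominus> g (snd i) \<otimes> ?e) \<otimes> z (fst i) (snd i))"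
      using j by (intro finsum_neg) (auto simp: E_verts)
    also have "\<dots> = imX (basis_vec j)"
      using inv'[of "fst j" "snd j"] j by (simp add: inv_rel'_def im_basis)
    finally show "(\<Oplus>i\<in>E. (imX (basis_vec j) \<otimes> imB (coev_c i) \<ominus> imB (coev_c i) \<otimes> imX (basis_vec j)) \<otimes> imY (coev_y i))
        = imX (basis_vec j)" .
  qed
qed

lemma im_ev:
  assumes a: "a \<in> fun_A D" and x: "x \<in> vfields D"
  shows "(\<Oplus>i\<in>E. (imX (coev_y i) \<otimes> imB a \<ominus> imB a \<otimes> imX (coev_y i))
        \<otimes> (imY x \<otimes> imA (coev_c i) \<ominus> imA (coev_c i) \<otimes> imY x)) = imB (ev D x (ext_d D a))"
    (is "?L a x = ?R a x")
    "(\<Oplus>i\<in>E. (imY (coev_x i) \<otimes> imA a \<ominus> imA a \<otimes> imY (coev_x i))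
        \<otimes> (imX x \<otimes> imB (coev_b i) \<ominus> imB (coev_b i) \<otimes> imX x)) = imA (ev_u D (ext_d D a) x)"
    (is "?L' a x = ?R' a x")
proof -
  have evs: "ext_d D (f_vec r) j = (if r = snd j then 1 else 0) - (if r = fst j then 1 else 0 :: 'k)"
     if "j \<in> E" for r j using that by (cases j) (auto simp: ext_d_def basis_vec_def)
  have evb: "ev D (basis_vec j) t = scale (t j) (f_vec (snd j))"
    "ev_u D t (basis_vec j) = scale (t j) (f_vec (fst j))" if "j \<in> E" for j and t :: "'v \<times> 'v \<Rightarrow> 'k"
    using ev_e[of "fst j" "snd j" t] that by simp_all
  have linx: "linear_map E (?L a)" "linear_map E (?L' a)" "linear_map E (?R a)" "linear_map E (?R' a)"
    using a by (intro linear_intros; simp add: im_coev im_linear; fail)+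
      (rule linear_map_comp[OF im_linear(2)] linear_map_comp[OF im_linear(1)];
        simp only: act_simps ev_closed)+
  have lina: "linear_map V (\<lambda>a. ?L a (basis_vec j))" "linear_map V (\<lambda>a. ?L' a (basis_vec j))"
      "linear_map V (\<lambda>a. ?R a (basis_vec j))" "linear_map V (\<lambda>a. ?R' a (basis_vec j))" if "j \<in> E" for j
    using that by (intro linear_intros; simp add: im_coev im_linear basis_vec_coord; fail)+
      (rule linear_map_comp[OF im_linear(2)] linear_map_comp[OF im_linear(1)];
        simp only: act_simps ev_closed ext_d_add ext_d_scale)+
  have scl: "imA (scale k (f_vec p)) = k \<odot> f p" "imB (scale k (f_vec p)) = k \<odot> g p" if "p \<in> V" for k p
    using that by (simp_all add: linear_mapD(3)[OF im_linear(1)] linear_mapD(3)[OF im_linear(2)] basis_vec_coord im_basis)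
  show "?L a x = ?R a x"
  proof (rule linear_eqI[OF finite_E linx(1) linx(3) _ x])
    fix j assume j: "j \<in> E"
    have v: "fst j \<in> V" "snd j \<in> V" using j E_verts[of "fst j" "snd j"] by auto
    let ?z = "z (fst j) (snd j)"
    show "?L a (basis_vec j) = ?R a (basis_vec j)"
    proof (rule linear_eqI[OF fin_V lina(1)[OF j] lina(3)[OF j] _ a])
      fix r assume r: "r \<in> V"
      let ?S = "\<lambda>i. (e (fst i) (snd i) \<otimes> g r \<ominus> g r \<otimes> e (fst i) (snd i)) \<otimes> (?z \<otimes> f (snd i) \<ominus> f (snd i) \<otimes> ?z)"
      have "?L (f_vec r) (basis_vec j) = (\<Oplus>i\<in>E. \<ominus> ?S i)"
        using j r v by (intro finsum_cong')
          (auto simp: im_coev im_basis E_verts l_minus r_minus minus_eq r_distr minus_add)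
      also have "\<dots> = \<ominus> (\<Oplus>i\<in>E. ?S i)" using j r v by (intro finsum_neg) (auto simp: E_verts)
      also have "\<dots> = \<ominus> ((if r = fst j then g (snd j) else \<zero>) \<ominus> (if r = snd j then g (snd j) else \<zero>))"
        using ev[of "fst j" "snd j"] j r by (simp add: ev_rel_def)
      also have "\<dots> = ?R (f_vec r) (basis_vec j)"
        using j v E_neq[of "fst j" "snd j"] by (auto simp: evb evs scl smult_minus_left minus_eq)
      finally show "?L (f_vec r) (basis_vec j) = ?R (f_vec r) (basis_vec j)" .
    qed
  qed
  show "?L' a x = ?R' a x"
  proof (rule linear_eqI[OF finite_E linx(2) linx(4) _ x])
    fix j assume j: "j \<in> E"
    have v: "fst j \<in> V" "snd j \<in> V" using j E_verts[of "fst j" "snd j"] by auto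
    let ?e = "e (fst j) (snd j)"
    show "?L' a (basis_vec j) = ?R' a (basis_vec j)"
    proof (rule linear_eqI[OF fin_V lina(2)[OF j] lina(4)[OF j] _ a])
      fix r assume r: "r \<in> V"
      have "?L' (f_vec r) (basis_vec j) = (\<Oplus>i\<in>E. (z (fst i) (snd i) \<otimes> f r \<ominus> f r \<otimes> z (fst i) (snd i))
          \<otimes> (?e \<otimes> g (fst i) \<ominus> g (fst i) \<otimes> ?e))"
        using j r v by (intro finsum_cong')
          (auto simp: im_coev im_basis E_verts l_minus r_minus minus_eq r_distr l_distr minus_add)
      also have "\<dots> = (if r = snd j then f (fst j) else \<zero>) \<ominus> (if r = fst j then f (fst j) else \<zero>)"
        using ev'[of "fst j" "snd j"] j r by (simp add: ev_rel'_def)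
      also have "\<dots> = ?R' (f_vec r) (basis_vec j)"
        using j v E_neq[of "fst j" "snd j"] by (auto simp: evb evs scl smult_minus_left minus_eq)
      finally show "?L' (f_vec r) (basis_vec j) = ?R' (f_vec r) (basis_vec j)" .
    qed
  qed
qed

lemma sum_list_fun_apply: "(\<Sum>(r, s)\<leftarrow>ms. t r s) x = (\<Sum>(r, s)\<leftarrow>ms. t r s x)"
  for t :: "'b \<Rightarrow> 'c \<Rightarrow> 'i \<Rightarrow> 'k"
  by (induction ms) auto

text \<open>
  As a function on pairs of vertices, \<open>\<Sum>r\<cdot>s\<close> is the restriction of the tensor to the diagonal, and
  on an arc \<open>(p, q)\<close> the form \<open>\<Sum>r\<cdot>ds\<close> is its value at \<open>(p, q)\<close> minus its value at \<open>(p, p)\<close>.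
\<close>

lemma tensor_support:
  fixes ms :: "(('v \<Rightarrow> 'k) \<times> ('v \<Rightarrow> 'k)) list"
  assumes 1: "(\<Sum>(r, s)\<leftarrow>ms. r * s) = 0" and 2: "(\<Sum>(r, s)\<leftarrow>ms. form_lact r (ext_d D s)) = 0"
    and pq: "p = q \<or> (p, q) \<in> E"
  shows "(\<Sum>(r, s)\<leftarrow>ms. r p * s q) = 0"
proof -
  have diag: "(\<Sum>(r, s)\<leftarrow>ms. r p * s p) = 0"
    using fun_cong[OF 1, of p] by (simp add: sum_list_fun_apply)
  show ?thesis
  proof (cases "(p, q) \<in> E")
    case True
    have "(\<Sum>(r, s)\<leftarrow>ms. form_lact r (ext_d D s) (p, q)) = (\<Sum>(r, s)\<leftarrow>ms. r p * s q) - (\<Sum>(r, s)\<leftarrow>ms. r p * s p)"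
      by (induction ms) (use True in \<open>auto simp: form_lact_def ext_d_def algebra_simps\<close>)
    then show ?thesis using fun_cong[OF 2, of "(p, q)"] diag by (simp add: sum_list_fun_apply)
  qed (use diag pq in auto)
qed

text \<open>
  Each relation is checked on the images. Those indexed by tensors are checked at the corners: on the diagonal and on
  the arcs the coefficient is \<open>0\<close> by \<open>tensor_support\<close>, elsewhere the corner of the image is \<open>\<zero>\<close> by \<open>im_supp\<close>.
\<close>

lemma lift:
  obtains h where "hx_hom D S h"
    and "\<And>a. a \<in> fun_A D \<Longrightarrow> h (hA a) = imA a" "\<And>a. a \<in> fun_A D \<Longrightarrow> h (hAbar a) = imB a"
    and "\<And>x. x \<in> vfields D \<Longrightarrow> h (hX x) = imX x" "\<And>x. x \<in> vfields D \<Longrightarrow> h (hXbar x) = imY x"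
proof -
  define gen where "gen = (\<lambda>x. case x of GA a \<Rightarrow> imA a | GAbar a \<Rightarrow> imB a | GX x \<Rightarrow> imX x | GXbar x \<Rightarrow> imY x)"
  have gen_closed: "gen x \<in> carrier S" if "x \<in> hx_gens D" for x
    using that by (auto simp: hx_gens_def gen_def)
  obtain h where h: "h \<in> alg_hom (free_alg (hx_gens D)) S" "\<And>x. x \<in> hx_gens D \<Longrightarrow> h (free_gen x) = gen x"
    using free_alg_lift[of "hx_gens D" gen, OF gen_closed] by blast
  interpret h: free_hom "hx_gens D" S h
    by (intro free_hom.intro alg_morphism.intro alg_morphism_axioms.intro alg_free_alg alg_axioms h(1))
  have val: "a \<in> fun_A D \<Longrightarrow> h (hA a) = imA a" "a \<in> fun_A D \<Longrightarrow> h (hAbar a) = imB a"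
    "x \<in> vfields D \<Longrightarrow> h (hX x) = imX x" "x \<in> vfields D \<Longrightarrow> h (hXbar x) = imY x" for a x
    by (simp_all add: hA_def hAbar_def hX_def hXbar_def h(2) hx_gens_def gen_def)
  note hs = h.h_mult h.h_add h.h_smult h.h_1 h.h_0 h.h_comm h.h_diff val hx_gens_closed free_alg_closed
  note lin = linear_mapD(2,3)[OF im_linear(1)] linear_mapD(2,3)[OF im_linear(2)]
     linear_mapD(2,3)[OF im_linear(3)] linear_mapD(2,3)[OF im_linear(4)]
  have lists: "h (\<Sum>(r, s)\<leftarrow>ms. t r s) \<in> carrier S \<and> (\<Sum>(r, s)\<leftarrow>ms. t r s) \<in> carrier (free_alg (hx_gens D)) \<and>
      u \<otimes> h (\<Sum>(r, s)\<leftarrow>ms. t r s) \<otimes> u' = (\<Sum>(r, s)\<leftarrow>ms. c r s) \<odot> y"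
    if "set ms \<subseteq> fun_A D \<times> fun_A D" and u: "u \<in> carrier S" "u' \<in> carrier S" "y \<in> carrier S"
      and "\<And>r s. r \<in> fun_A D \<Longrightarrow> s \<in> fun_A D \<Longrightarrow> t r s \<in> carrier (free_alg (hx_gens D)) \<and> u \<otimes> h (t r s) \<otimes> u' = c r s \<odot> y"
    for ms :: "(('v \<Rightarrow> 'k) \<times> ('v \<Rightarrow> 'k)) list" and t u u' c y
    using that(1)
  proof (induction ms)
    case Nil then show ?case using u by (simp add: h.h_0 free_alg_zero_closed)
  next
    case (Cons m ms)
    obtain r s where m: "m = (r, s)" by fastforce
    then show ?case using Cons u that(5)[of r s]
      by (auto simp: h.h_add free_alg_closed r_distr l_distr smult_add_left)
  qed
  have "h l = h r" if "hx_rel D l r" for l r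
    using that
  proof (cases rule: hx_rel.cases)
    case (ker_X ms x)
    let ?w = "h (\<Sum>(r, s)\<leftarrow>ms. hAbar s \<bullet> hX x \<bullet> hAbar r)"
    have *: "?w \<in> carrier S \<and> g p \<otimes> ?w \<otimes> g q = (\<Sum>(r, s)\<leftarrow>ms. r q * s p) \<odot> (g p \<otimes> imX x \<otimes> g q)"
      if "p \<in> V" "q \<in> V" for p q
      using lists[OF ker_X(3), of "g p" "g q" "g p \<otimes> imX x \<otimes> g q" "\<lambda>r s. hAbar s \<bullet> hX x \<bullet> hAbar r" "\<lambda>r s. r q * s p"]
        that ker_X(4) im_sandwich(1)[OF that] by (simp add: hs)
    \<comment> \<open>the previous fact yields this only when there is a vertex to apply it to\<close>
    have c: "?w \<in> carrier S"
    proof (cases "V = {}")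
      case True
      then show ?thesis using lists[OF ker_X(3), of \<zero> \<zero> \<zero> "\<lambda>r s. hAbar s \<bullet> hX x \<bullet> hAbar r" "\<lambda>r s. 0"] ker_X(4)
        by (simp add: hs)
    qed (use * in auto)
    have "?w = \<zero>"
    proof (rule eqI_corners[where I = V and u = g and w = g])
      fix p q assume pq: "p \<in> V" "q \<in> V"
      show "g p \<otimes> ?w \<otimes> g q = g p \<otimes> \<zero> \<otimes> g q"
        using *[OF pq] tensor_support[OF ker_X(5,6), of q p] im_supp(1)[of q p, OF _ _ _ _ ker_X(4)] pq ker_X(4)
        by (cases "q = p \<or> (q, p) \<in> E") auto
    qed (use c g_sum in auto)
    then show ?thesis using ker_X(1,2) by (simp add: h.h_0)
  next
    case (ker_Xbar ms x)
    let ?w = "h (\<Sum>(r, s)\<leftarrow>ms. hA r \<bullet> hXbar x \<bullet> hA s)"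
    have *: "?w \<in> carrier S \<and> f p \<otimes> ?w \<otimes> f q = (\<Sum>(r, s)\<leftarrow>ms. r p * s q) \<odot> (f p \<otimes> imY x \<otimes> f q)"
      if "p \<in> V" "q \<in> V" for p q
      using lists[OF ker_Xbar(3), of "f p" "f q" "f p \<otimes> imY x \<otimes> f q" "\<lambda>r s. hA r \<bullet> hXbar x \<bullet> hA s" "\<lambda>r s. r p * s q"]
        that ker_Xbar(4) im_sandwich(2)[OF that] by (simp add: hs)
    have c: "?w \<in> carrier S"
    proof (cases "V = {}")
      case True
      then show ?thesis using lists[OF ker_Xbar(3), of \<zero> \<zero> \<zero> "\<lambda>r s. hA r \<bullet> hXbar x \<bullet> hA s" "\<lambda>r s. 0"] ker_Xbar(4)
        by (simp add: hs)
    qed (use * in auto)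
    have "?w = \<zero>"
    proof (rule eqI_corners[where I = V and u = f and w = f])
      fix p q assume pq: "p \<in> V" "q \<in> V"
      show "f p \<otimes> ?w \<otimes> f q = f p \<otimes> \<zero> \<otimes> f q"
        using *[OF pq] tensor_support[OF ker_Xbar(5,6), of p q] im_supp(2)[of p q, OF _ _ _ _ ker_Xbar(4)] pq ker_Xbar(4)
        by (cases "p = q \<or> (p, q) \<in> E") auto
    qed (use c f_sum in auto)
    then show ?thesis using ker_Xbar(1,2) by (simp add: h.h_0)
  next
    case (Xbar_inv x)
    have "h l = (\<Oplus>i\<in>E. (imY x \<otimes> imA (coev_b i) \<ominus> imA (coev_b i) \<otimes> imY x) \<otimes> imX (coev_x i))"
      unfolding Xbar_inv(1) using Xbar_inv(3)
      by (subst h.h_sum(1)) (auto intro!: finsum_cong' simp: hs im_coev(1-4))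
    then show ?thesis using Xbar_inv im_inv(1) by (simp add: val)
  next
    case (X_inv x)
    have "h l = (\<Oplus>i\<in>E. (imX x \<otimes> imB (coev_c i) \<ominus> imB (coev_c i) \<otimes> imX x) \<otimes> imY (coev_y i))"
      unfolding X_inv(1) using X_inv(3)
      by (subst h.h_sum(1)) (auto intro!: finsum_cong' simp: hs im_coev(1-4))
    then show ?thesis using X_inv im_inv(2) by (simp add: val)
  next
    case (ev_inv a x)
    have "h l = (\<Oplus>i\<in>E. (imX (coev_y i) \<otimes> imB a \<ominus> imB a \<otimes> imX (coev_y i))
        \<otimes> (imY x \<otimes> imA (coev_c i) \<ominus> imA (coev_c i) \<otimes> imY x))"
      unfolding ev_inv(1) using ev_inv(3,4)
      by (subst h.h_sum(1)) (auto intro!: finsum_cong' simp: hs im_coev(1-4))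
    then show ?thesis using ev_inv im_ev(1) by (simp add: val ev_closed)
  next
    case (ev_u_inv a x)
    have "h l = (\<Oplus>i\<in>E. (imY (coev_x i) \<otimes> imA a \<ominus> imA a \<otimes> imY (coev_x i))
        \<otimes> (imX x \<otimes> imB (coev_b i) \<ominus> imB (coev_b i) \<otimes> imX x))"
      unfolding ev_u_inv(1) using ev_u_inv(3,4)
      by (subst h.h_sum(1)) (auto intro!: finsum_cong' simp: hs im_coev(1-4))
    then show ?thesis using ev_u_inv im_ev(2) by (simp add: val ev_closed)
  qed (simp_all add: hs lin coord_space_closed ev_closed imA_mult im_one im_commute im_bimodule)
  then have "hx_hom D S h"
    by (intro hx_hom.intro hx_hom_axioms.intro pair_digraph_axioms h.free_hom_axioms)
  then show ?thesis using that val by blast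
qed

end

section \<open>Homomorphisms out of the path algebra of the double\<close>

lemma path_alg_simps:
  "x \<otimes>\<^bsub>path_alg Q\<^esub> y = x \<bullet>\<^sub>p y" "x \<oplus>\<^bsub>path_alg Q\<^esub> y = x + y" "\<zero>\<^bsub>path_alg Q\<^esub> = 0"
  "\<one>\<^bsub>path_alg Q\<^esub> = (\<Sum>v\<in>verts Q. vertex_idem v)"
  if "fin_digraph Q"
  using that
  by (simp_all add: path_alg_def basis_alg_def path_mult_def vertex_idem_def sum.reindex inj_on_def o_def)

context pair_digraph
begin

lemma double_verts: "verts (double G) = pverts G \<times> pverts G"
  by (simp add: double_def)

lemma double_arcs:
  "L2 a b c d \<in> arcs (double G) \<longleftrightarrow> (a, b) \<in> parcs G \<and> (c, d) \<in> parcs G"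
  "R2 a b c d \<in> arcs (double G) \<longleftrightarrow> (a, b) \<in> parcs G \<and> (c, d) \<in> parcs G"
  "L1 a b q \<in> arcs (double G) \<longleftrightarrow> (a, b) \<in> parcs G \<and> q \<in> pverts G"
  "R1 p c d \<in> arcs (double G) \<longleftrightarrow> p \<in> pverts G \<and> (c, d) \<in> parcs G"
  by (auto simp: double_def)

lemma double_elt_closed:
  "p \<in> pverts G \<Longrightarrow> q \<in> pverts G \<Longrightarrow> u_elt p q \<in> carrier (path_alg (double G))"
  "(a, b) \<in> parcs G \<Longrightarrow> (c, d) \<in> parcs G \<Longrightarrow> L2_elt G (a, b) (c, d) \<in> carrier (path_alg (double G))"
  "(a, b) \<in> parcs G \<Longrightarrow> (c, d) \<in> parcs G \<Longrightarrow> R2_elt G (a, b) (c, d) \<in> carrier (path_alg (double G))"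
  "(a, b) \<in> parcs G \<Longrightarrow> q \<in> pverts G \<Longrightarrow> L1_elt G (a, b) q \<in> carrier (path_alg (double G))"
  "p \<in> pverts G \<Longrightarrow> (c, d) \<in> parcs G \<Longrightarrow> R1_elt G p (c, d) \<in> carrier (path_alg (double G))"
  by (auto simp: u_elt_def L2_elt_def R2_elt_def L1_elt_def R1_elt_def double_verts double_arcs
      intro!: path_alg_gens fin_digraph_double)

lemma double_products:
  "u_elt p q \<bullet>\<^sub>p u_elt p' q' = (if p = p' \<and> q = q' then u_elt p q else 0)"
  "u_elt p q \<bullet>\<^sub>p L2_elt G (a, b) (c, d) = (if p = b \<and> q = d then L2_elt G (a, b) (c, d) else 0)"
  "L2_elt G (a, b) (c, d) \<bullet>\<^sub>p u_elt p q = (if p = a \<and> q = c then L2_elt G (a, b) (c, d) else 0)"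
  "u_elt p q \<bullet>\<^sub>p R2_elt G (a, b) (c, d) = (if p = a \<and> q = c then R2_elt G (a, b) (c, d) else 0)"
  "R2_elt G (a, b) (c, d) \<bullet>\<^sub>p u_elt p q = (if p = b \<and> q = d then R2_elt G (a, b) (c, d) else 0)"
  "u_elt p q \<bullet>\<^sub>p L1_elt G (a, b) r = (if p = b \<and> q = r then L1_elt G (a, b) r else 0)"
  "L1_elt G (a, b) r \<bullet>\<^sub>p u_elt p q = (if p = a \<and> q = r then L1_elt G (a, b) r else 0)"
  "u_elt p q \<bullet>\<^sub>p R1_elt G r (c, d) = (if p = r \<and> q = c then R1_elt G r (c, d) else 0)"
  "R1_elt G r (c, d) \<bullet>\<^sub>p u_elt p q = (if p = r \<and> q = d then R1_elt G r (c, d) else 0)"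
  by (auto simp: u_elt_def L2_elt_def R2_elt_def L1_elt_def R1_elt_def vertex_idem_def arrow_elt_def
      path_mult_def basis_mult_single path_comp_def opt_single_def double_def)

end

lemma path_mult_closed:
  assumes "fin_digraph Q" "x \<in> carrier (path_alg Q)" "y \<in> carrier (path_alg Q)"
  shows "x \<bullet>\<^sub>p y \<in> carrier (path_alg Q)"
proof -
  interpret alg "path_alg Q" by (rule alg_path_alg) fact
  show ?thesis using m_closed[OF assms(2,3)] by (simp add: path_alg_simps assms(1))
qed

locale path_hom = alg_morphism "path_alg Q" S h
  for Q and S :: "('k::field, 'a) module" (structure) and h +
  assumes fin_Q: "fin_digraph Q"
begin

lemmas psimps = path_alg_simps[OF fin_Q]

lemma h_mult: "x \<in> carrier (path_alg Q) \<Longrightarrow> y \<in> carrier (path_alg Q) \<Longrightarrow> h (x \<bullet>\<^sub>p y) = h x \<otimes> h y"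
  using mult[of x y] by (simp add: psimps)

lemma h_0: "h 0 = \<zero>"
  using hom_zero by (simp add: psimps)

lemmas mult_closed = path_mult_closed[OF fin_Q]

lemma h_sum:
  assumes "\<And>i. i \<in> I \<Longrightarrow> t i \<in> carrier (path_alg Q)"
  shows "h (\<Sum>i\<in>I. t i) = (\<Oplus>i\<in>I. h (t i))"
proof -
  have "h (\<Sum>i\<in>I. t i) = (\<Oplus>i\<in>I. h (t i)) \<and> (\<Sum>i\<in>I. t i) \<in> carrier (path_alg Q)"
    using assms
  proof (induction I rule: infinite_finite_induct)
    case (insert i I)
    then show ?case
      using add[of "t i" "\<Sum>i\<in>I. t i"] R.a_closed[of "t i" "\<Sum>i\<in>I. t i"] by (simp add: psimps Pi_def)
  qed (use h_0 R.zero_closed in \<open>simp_all add: psimps\<close>)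
  then show ?thesis by simp
qed

end

text \<open>
  The homomorphisms from the path algebra of the double that respect its relations, and the frame that they define: row and
  column sums of the vertex idempotents, and the sums of all corners as in \<open>frame.X_decomp\<close> and \<open>frame.Z_decomp\<close>.
\<close>

locale dbl_hom = pair_digraph D + path_hom "double D" S h
  for D :: "'v pair_pre_digraph" and S :: "('k::field, 'a) module" (structure) and h +
  assumes rel: "\<And>l r. dbl_rel D l r \<Longrightarrow> h l = h r"
begin

abbreviation "V \<equiv> pverts D"
abbreviation "E \<equiv> parcs D"

definition "U p q = h (u_elt p q)"
definition "l2 a b c d = h (L2_elt D (a, b) (c, d))"
definition "r2 a b c d = h (R2_elt D (a, b) (c, d))"
definition "l1 a b q = h (L1_elt D (a, b) q)"
definition "r1 p c d = h (R1_elt D p (c, d))"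

definition "f p = (\<Oplus>q\<in>V. U p q)"
definition "g q = (\<Oplus>p\<in>V. U p q)"
definition "X a b = (\<Oplus>q\<in>V. l1 a b q) \<oplus> (\<Oplus>i\<in>E. \<ominus> l2 a b (fst i) (snd i))"
definition "Z c d = (\<Oplus>p\<in>V. \<ominus> r1 p c d) \<oplus> (\<Oplus>i\<in>E. \<ominus> r2 (fst i) (snd i) c d)"

lemma arc_verts: "(a, b) \<in> E \<Longrightarrow> a \<in> V" "(a, b) \<in> E \<Longrightarrow> b \<in> V"
  by (auto dest: in_arcsD1 in_arcsD2)

lemma neq: "(a, b) \<in> E \<Longrightarrow> a \<noteq> b"
  using pair_no_loops[of "(a, b)"] by simp

lemma finite_VE [simp]: "finite V" "finite E"
  by simp_all

lemma im_closed [simp]: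
  "p \<in> V \<Longrightarrow> q \<in> V \<Longrightarrow> U p q \<in> carrier S"
  "(a, b) \<in> E \<Longrightarrow> (c, d) \<in> E \<Longrightarrow> l2 a b c d \<in> carrier S"
  "(a, b) \<in> E \<Longrightarrow> (c, d) \<in> E \<Longrightarrow> r2 a b c d \<in> carrier S"
  "(a, b) \<in> E \<Longrightarrow> q \<in> V \<Longrightarrow> l1 a b q \<in> carrier S"
  "(c, d) \<in> E \<Longrightarrow> p \<in> V \<Longrightarrow> r1 p c d \<in> carrier S"
  by (simp_all add: U_def l2_def r2_def l1_def r1_def double_elt_closed)

lemma fgXZ_closed [simp]:
  "p \<in> V \<Longrightarrow> f p \<in> carrier S" "p \<in> V \<Longrightarrow> g p \<in> carrier S"
  "(a, b) \<in> E \<Longrightarrow> X a b \<in> carrier S" "(a, b) \<in> E \<Longrightarrow> Z a b \<in> carrier S"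
  by (auto simp: f_def g_def X_def Z_def)

lemma U_mult:
  assumes "p \<in> V" "q \<in> V"
  shows "p' \<in> V \<Longrightarrow> q' \<in> V \<Longrightarrow> U p q \<otimes> U p' q' = (if p = p' \<and> q = q' then U p q else \<zero>)"
    "(a, b) \<in> E \<Longrightarrow> (c, d) \<in> E \<Longrightarrow> U p q \<otimes> l2 a b c d = (if p = b \<and> q = d then l2 a b c d else \<zero>)"
    "(a, b) \<in> E \<Longrightarrow> (c, d) \<in> E \<Longrightarrow> l2 a b c d \<otimes> U p q = (if p = a \<and> q = c then l2 a b c d else \<zero>)"
    "(a, b) \<in> E \<Longrightarrow> (c, d) \<in> E \<Longrightarrow> U p q \<otimes> r2 a b c d = (if p = a \<and> q = c then r2 a b c d else \<zero>)"
    "(a, b) \<in> E \<Longrightarrow> (c, d) \<in> E \<Longrightarrow> r2 a b c d \<otimes> U p q = (if p = b \<and> q = d then r2 a b c d else \<zero>)"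
    "(a, b) \<in> E \<Longrightarrow> r \<in> V \<Longrightarrow> U p q \<otimes> l1 a b r = (if p = b \<and> q = r then l1 a b r else \<zero>)"
    "(a, b) \<in> E \<Longrightarrow> r \<in> V \<Longrightarrow> l1 a b r \<otimes> U p q = (if p = a \<and> q = r then l1 a b r else \<zero>)"
    "(c, d) \<in> E \<Longrightarrow> r \<in> V \<Longrightarrow> U p q \<otimes> r1 r c d = (if p = r \<and> q = c then r1 r c d else \<zero>)"
    "(c, d) \<in> E \<Longrightarrow> r \<in> V \<Longrightarrow> r1 r c d \<otimes> U p q = (if p = r \<and> q = d then r1 r c d else \<zero>)"
  unfolding U_def l2_def r2_def l1_def r1_def using assms
  by (subst h_mult[symmetric], simp_all only: double_elt_closed double_products, simp add: h_0)+

text \<open>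
  An element fixed by one vertex idempotent is killed by all others, so a row or column sum fixes or kills it.
\<close>

lemma idem_mult:
  assumes "p \<in> V" "q \<in> V" "y \<in> carrier S"
  shows "U p q \<otimes> y = y \<Longrightarrow> r \<in> V \<Longrightarrow> f r \<otimes> y = (if r = p then y else \<zero>)"
    "U p q \<otimes> y = y \<Longrightarrow> r \<in> V \<Longrightarrow> g r \<otimes> y = (if r = q then y else \<zero>)"
    "y \<otimes> U p q = y \<Longrightarrow> r \<in> V \<Longrightarrow> y \<otimes> f r = (if r = p then y else \<zero>)"
    "y \<otimes> U p q = y \<Longrightarrow> r \<in> V \<Longrightarrow> y \<otimes> g r = (if r = q then y else \<zero>)"
proof -
  have L: "U p' q' \<otimes> y = (if p' = p \<and> q' = q then y else \<zero>)" if "U p q \<otimes> y = y" "p' \<in> V" "q' \<in> V" for p' q'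
  proof -
    have "U p' q' \<otimes> y = U p' q' \<otimes> U p q \<otimes> y" using that assms by (simp add: S.m_assoc)
    also have "\<dots> = (if p' = p \<and> q' = q then U p q \<otimes> y else \<zero>)" using that assms by (auto simp: U_mult)
    finally show ?thesis using that by simp
  qed
  have R: "y \<otimes> U p' q' = (if p' = p \<and> q' = q then y else \<zero>)" if "y \<otimes> U p q = y" "p' \<in> V" "q' \<in> V" for p' q'
  proof -
    have "y \<otimes> U p' q' = y \<otimes> (U p q \<otimes> U p' q')" using that assms by (simp add: S.m_assoc[symmetric])
    also have "\<dots> = (if p' = p \<and> q' = q then y \<otimes> U p q else \<zero>)" using that assms by (auto simp: U_mult)
    finally show ?thesis using that by simp
  qed
  show "f r \<otimes> y = (if r = p then y else \<zero>)" if "U p q \<otimes> y = y" "r \<in> V"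
  proof -
    have "f r \<otimes> y = (\<Oplus>s\<in>V. U r s \<otimes> y)" unfolding f_def using that assms by (intro S.finsum_ldistr) auto
    also have "\<dots> = (\<Oplus>s\<in>V. if s = q then (if r = p then y else \<zero>) else \<zero>)"
      using that assms L by (intro S.finsum_cong') auto
    finally show ?thesis using assms by (simp add: S.finsum_delta)
  qed
  show "g r \<otimes> y = (if r = q then y else \<zero>)" if "U p q \<otimes> y = y" "r \<in> V"
  proof -
    have "g r \<otimes> y = (\<Oplus>s\<in>V. U s r \<otimes> y)" unfolding g_def using that assms by (intro S.finsum_ldistr) auto
    also have "\<dots> = (\<Oplus>s\<in>V. if s = p then (if r = q then y else \<zero>) else \<zero>)"
      using that assms L by (intro S.finsum_cong') auto
    finally show ?thesis using assms by (simp add: S.finsum_delta)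
  qed
  show "y \<otimes> f r = (if r = p then y else \<zero>)" if "y \<otimes> U p q = y" "r \<in> V"
  proof -
    have "y \<otimes> f r = (\<Oplus>s\<in>V. y \<otimes> U r s)" unfolding f_def using that assms by (intro S.finsum_rdistr) auto
    also have "\<dots> = (\<Oplus>s\<in>V. if s = q then (if r = p then y else \<zero>) else \<zero>)"
      using that assms R by (intro S.finsum_cong') auto
    finally show ?thesis using assms by (simp add: S.finsum_delta)
  qed
  show "y \<otimes> g r = (if r = q then y else \<zero>)" if "y \<otimes> U p q = y" "r \<in> V"
  proof -
    have "y \<otimes> g r = (\<Oplus>s\<in>V. y \<otimes> U s r)" unfolding g_def using that assms by (intro S.finsum_rdistr) auto
    also have "\<dots> = (\<Oplus>s\<in>V. if s = p then (if r = q then y else \<zero>) else \<zero>)"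
      using that assms R by (intro S.finsum_cong') auto
    finally show ?thesis using assms by (simp add: S.finsum_delta)
  qed
qed

lemma fg_mult:
  "p \<in> V \<Longrightarrow> q \<in> V \<Longrightarrow> r \<in> V \<Longrightarrow> f r \<otimes> U p q = (if r = p then U p q else \<zero>)"
  "p \<in> V \<Longrightarrow> q \<in> V \<Longrightarrow> r \<in> V \<Longrightarrow> g r \<otimes> U p q = (if r = q then U p q else \<zero>)"
  "(a, b) \<in> E \<Longrightarrow> (c, d) \<in> E \<Longrightarrow> r \<in> V \<Longrightarrow> f r \<otimes> l2 a b c d = (if r = b then l2 a b c d else \<zero>)"
  "(a, b) \<in> E \<Longrightarrow> (c, d) \<in> E \<Longrightarrow> r \<in> V \<Longrightarrow> g r \<otimes> l2 a b c d = (if r = d then l2 a b c d else \<zero>)"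
  "(a, b) \<in> E \<Longrightarrow> (c, d) \<in> E \<Longrightarrow> r \<in> V \<Longrightarrow> l2 a b c d \<otimes> f r = (if r = a then l2 a b c d else \<zero>)"
  "(a, b) \<in> E \<Longrightarrow> (c, d) \<in> E \<Longrightarrow> r \<in> V \<Longrightarrow> l2 a b c d \<otimes> g r = (if r = c then l2 a b c d else \<zero>)"
  "(a, b) \<in> E \<Longrightarrow> (c, d) \<in> E \<Longrightarrow> r \<in> V \<Longrightarrow> f r \<otimes> r2 a b c d = (if r = a then r2 a b c d else \<zero>)"
  "(a, b) \<in> E \<Longrightarrow> (c, d) \<in> E \<Longrightarrow> r \<in> V \<Longrightarrow> g r \<otimes> r2 a b c d = (if r = c then r2 a b c d else \<zero>)"
  "(a, b) \<in> E \<Longrightarrow> (c, d) \<in> E \<Longrightarrow> r \<in> V \<Longrightarrow> r2 a b c d \<otimes> f r = (if r = b then r2 a b c d else \<zero>)"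
  "(a, b) \<in> E \<Longrightarrow> (c, d) \<in> E \<Longrightarrow> r \<in> V \<Longrightarrow> r2 a b c d \<otimes> g r = (if r = d then r2 a b c d else \<zero>)"
  "(a, b) \<in> E \<Longrightarrow> q \<in> V \<Longrightarrow> r \<in> V \<Longrightarrow> f r \<otimes> l1 a b q = (if r = b then l1 a b q else \<zero>)"
  "(a, b) \<in> E \<Longrightarrow> q \<in> V \<Longrightarrow> r \<in> V \<Longrightarrow> g r \<otimes> l1 a b q = (if r = q then l1 a b q else \<zero>)"
  "(a, b) \<in> E \<Longrightarrow> q \<in> V \<Longrightarrow> r \<in> V \<Longrightarrow> l1 a b q \<otimes> f r = (if r = a then l1 a b q else \<zero>)"
  "(a, b) \<in> E \<Longrightarrow> q \<in> V \<Longrightarrow> r \<in> V \<Longrightarrow> l1 a b q \<otimes> g r = (if r = q then l1 a b q else \<zero>)"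
  "(c, d) \<in> E \<Longrightarrow> p \<in> V \<Longrightarrow> r \<in> V \<Longrightarrow> f r \<otimes> r1 p c d = (if r = p then r1 p c d else \<zero>)"
  "(c, d) \<in> E \<Longrightarrow> p \<in> V \<Longrightarrow> r \<in> V \<Longrightarrow> g r \<otimes> r1 p c d = (if r = c then r1 p c d else \<zero>)"
  "(c, d) \<in> E \<Longrightarrow> p \<in> V \<Longrightarrow> r \<in> V \<Longrightarrow> r1 p c d \<otimes> f r = (if r = p then r1 p c d else \<zero>)"
  "(c, d) \<in> E \<Longrightarrow> p \<in> V \<Longrightarrow> r \<in> V \<Longrightarrow> r1 p c d \<otimes> g r = (if r = d then r1 p c d else \<zero>)"
  using idem_mult(1,2)[of p q "U p q"] idem_mult(1,2)[of b d "l2 a b c d"] idem_mult(3,4)[of a c "l2 a b c d"]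
    idem_mult(1,2)[of a c "r2 a b c d"] idem_mult(3,4)[of b d "r2 a b c d"]
    idem_mult(1,2)[of b q "l1 a b q"] idem_mult(3,4)[of a q "l1 a b q"]
    idem_mult(1,2)[of p c "r1 p c d"] idem_mult(3,4)[of p d "r1 p c d"]
  by (simp_all add: U_mult arc_verts)

lemma f_mult_g:
  assumes "p \<in> V" "q \<in> V"
  shows "f p \<otimes> g q = U p q" "g q \<otimes> f p = U p q"
    "f p \<otimes> f q = (if p = q then f p else \<zero>)" "g p \<otimes> g q = (if p = q then g p else \<zero>)"
proof -
  have delta: "(\<Oplus>i\<in>V. if j = i then U' i else \<zero>) = U' j" if "j \<in> V" "U' \<in> V \<rightarrow> carrier S" for j U'
    using S.add.finprod_singleton[OF that(1) finite_VE(1) that(2)] .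
  have "f p \<otimes> g q = (\<Oplus>s\<in>V. f p \<otimes> U s q)" unfolding g_def using assms by (intro S.finsum_rdistr) auto
  also have "\<dots> = (\<Oplus>s\<in>V. if p = s then U s q else \<zero>)" using assms by (intro S.finsum_cong') (auto simp: fg_mult)
  also have "\<dots> = U p q" using assms by (intro delta) auto
  finally show "f p \<otimes> g q = U p q" .
  have "g q \<otimes> f p = (\<Oplus>s\<in>V. g q \<otimes> U p s)" unfolding f_def using assms by (intro S.finsum_rdistr) auto
  also have "\<dots> = (\<Oplus>s\<in>V. if q = s then U p s else \<zero>)" using assms by (intro S.finsum_cong') (auto simp: fg_mult)
  also have "\<dots> = U p q" using assms by (intro delta) auto
  finally show "g q \<otimes> f p = U p q" .
  have "f p \<otimes> f q = (\<Oplus>s\<in>V. f p \<otimes> U q s)" unfolding f_def[of q] using assms by (intro S.finsum_rdistr) auto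
  also have "\<dots> = (\<Oplus>s\<in>V. if p = q then U q s else \<zero>)" using assms by (intro S.finsum_cong') (auto simp: fg_mult)
  finally show "f p \<otimes> f q = (if p = q then f p else \<zero>)" by (auto simp: f_def)
  have "g p \<otimes> g q = (\<Oplus>s\<in>V. g p \<otimes> U s q)" unfolding g_def[of q] using assms by (intro S.finsum_rdistr) auto
  also have "\<dots> = (\<Oplus>s\<in>V. if p = q then U s q else \<zero>)" using assms by (intro S.finsum_cong') (auto simp: fg_mult)
  finally show "g p \<otimes> g q = (if p = q then g p else \<zero>)" by (auto simp: g_def)
qed

lemma fg_sum: "(\<Oplus>p\<in>V. f p) = \<one>" "(\<Oplus>q\<in>V. g q) = \<one>"
proof -
  have "\<one>\<^bsub>path_alg (double D)\<^esub> = (\<Sum>(p, q)\<in>V \<times> V. u_elt p q :: ('v, 'k) dbl_elt)"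
    by (simp add: psimps double_verts u_elt_def split_def)
  then have one: "\<one> = (\<Oplus>v\<in>V \<times> V. U (fst v) (snd v))"
    using one h_sum[of "V \<times> V" "\<lambda>(p, q). u_elt p q"] by (auto simp: double_elt_closed U_def split_def)
  \<comment> \<open>the row sums and the column sums fix every vertex idempotent, hence equal the unit\<close>
  have ext: "y = \<one>" if y: "y \<in> carrier S" "\<And>p q. p \<in> V \<Longrightarrow> q \<in> V \<Longrightarrow> y \<otimes> U p q = U p q" for y
  proof -
    have "y = (\<Oplus>v\<in>V \<times> V. y \<otimes> U (fst v) (snd v))"
      using y(1) S.r_one[OF y(1)] unfolding one by (subst S.finsum_rdistr[symmetric]) auto
    also have "\<dots> = (\<Oplus>v\<in>V \<times> V. U (fst v) (snd v))" using y by (intro S.finsum_cong') auto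
    finally show ?thesis by (simp add: one)
  qed
  have "(\<Oplus>r\<in>V. f r) \<otimes> U p q = U p q" "(\<Oplus>r\<in>V. g r) \<otimes> U p q = U p q" if "p \<in> V" "q \<in> V" for p q
  proof -
    have "(\<Oplus>r\<in>V. f r) \<otimes> U p q = (\<Oplus>r\<in>V. f r \<otimes> U p q)" using that by (intro S.finsum_ldistr) auto
    also have "\<dots> = (\<Oplus>r\<in>V. if r = p then U p q else \<zero>)" using that by (intro S.finsum_cong') (auto simp: fg_mult)
    finally show "(\<Oplus>r\<in>V. f r) \<otimes> U p q = U p q" using that by (simp add: S.finsum_delta)
    have "(\<Oplus>r\<in>V. g r) \<otimes> U p q = (\<Oplus>r\<in>V. g r \<otimes> U p q)" using that by (intro S.finsum_ldistr) auto
    also have "\<dots> = (\<Oplus>r\<in>V. if r = q then U p q else \<zero>)" using that by (intro S.finsum_cong') (auto simp: fg_mult)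
    finally show "(\<Oplus>r\<in>V. g r) \<otimes> U p q = U p q" using that by (simp add: S.finsum_delta)
  qed
  then show "(\<Oplus>p\<in>V. f p) = \<one>" "(\<Oplus>q\<in>V. g q) = \<one>" by (intro ext; auto)+
qed

lemma X_corner:
  assumes ab: "(a, b) \<in> E" and cd: "c \<in> V" "d \<in> V"
  shows "g d \<otimes> X a b \<otimes> g c = (if c = d then l1 a b c else \<zero>) \<oplus> (if (c, d) \<in> E then \<ominus> l2 a b c d else \<zero>)"
proof -
  have 1: "g d \<otimes> (\<Oplus>q\<in>V. l1 a b q) \<otimes> g c = (if c = d then l1 a b c else \<zero>)"
  proof (cases "c = d")
    case True
    then show ?thesis
      using ab cd S.conj_sum[of V "g d" "g c" "l1 a b" c] by (auto simp: fg_mult S.if_mult)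
  next
    case False
    have "g d \<otimes> (\<Oplus>q\<in>V. l1 a b q) \<otimes> g c = \<zero>"
      by (rule S.conj_sum_0) (use ab cd False in \<open>auto simp: fg_mult S.if_mult\<close>)
    then show ?thesis using False by simp
  qed
  have 2: "g d \<otimes> (\<Oplus>i\<in>E. \<ominus> l2 a b (fst i) (snd i)) \<otimes> g c = (if (c, d) \<in> E then \<ominus> l2 a b c d else \<zero>)"
  proof (cases "(c, d) \<in> E")
    case True
    have "g d \<otimes> (\<Oplus>i\<in>E. \<ominus> l2 a b (fst i) (snd i)) \<otimes> g c
        = \<ominus> l2 a b (fst (c, d)) (snd (c, d))"
      by (rule S.conj_sum) (use ab cd True in \<open>auto simp: fg_mult S.if_mult S.l_minus S.r_minus\<close>)
    then show ?thesis using True by simp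
  next
    case False
    have "g d \<otimes> (\<Oplus>i\<in>E. \<ominus> l2 a b (fst i) (snd i)) \<otimes> g c = \<zero>"
      by (rule S.conj_sum_0) (use ab cd False in \<open>auto simp: fg_mult S.if_mult S.l_minus S.r_minus\<close>)
    then show ?thesis using False by simp
  qed
  have "g d \<otimes> X a b \<otimes> g c = g d \<otimes> (\<Oplus>q\<in>V. l1 a b q) \<otimes> g c \<oplus> g d \<otimes> (\<Oplus>i\<in>E. \<ominus> l2 a b (fst i) (snd i)) \<otimes> g c"
    unfolding X_def using ab cd by (subst S.r_distr, auto)  (subst S.l_distr, auto)
  then show ?thesis unfolding 1 2 .
qed

lemma Z_corner:
  assumes cd: "(c, d) \<in> E" and ab: "a \<in> V" "b \<in> V"
  shows "f a \<otimes> Z c d \<otimes> f b = (if a = b then \<ominus> r1 a c d else \<zero>) \<oplus> (if (a, b) \<in> E then \<ominus> r2 a b c d else \<zero>)"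
proof -
  have 1: "f a \<otimes> (\<Oplus>p\<in>V. \<ominus> r1 p c d) \<otimes> f b = (if a = b then \<ominus> r1 a c d else \<zero>)"
  proof (cases "a = b")
    case True
    then show ?thesis
      using ab cd S.conj_sum[of V "f a" "f b" "\<lambda>p. \<ominus> r1 p c d" a]
      by (auto simp: fg_mult S.if_mult S.l_minus S.r_minus)
  next
    case False
    have "f a \<otimes> (\<Oplus>p\<in>V. \<ominus> r1 p c d) \<otimes> f b = \<zero>"
      by (rule S.conj_sum_0) (use ab cd False in \<open>auto simp: fg_mult S.if_mult S.l_minus S.r_minus\<close>)
    then show ?thesis using False by simp
  qed
  have 2: "f a \<otimes> (\<Oplus>i\<in>E. \<ominus> r2 (fst i) (snd i) c d) \<otimes> f b = (if (a, b) \<in> E then \<ominus> r2 a b c d else \<zero>)"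
  proof (cases "(a, b) \<in> E")
    case True
    have "f a \<otimes> (\<Oplus>i\<in>E. \<ominus> r2 (fst i) (snd i) c d) \<otimes> f b
        = \<ominus> r2 (fst (a, b)) (snd (a, b)) c d"
      by (rule S.conj_sum) (use ab cd True in \<open>auto simp: fg_mult S.if_mult S.l_minus S.r_minus\<close>)
    then show ?thesis using True by simp
  next
    case False
    have "f a \<otimes> (\<Oplus>i\<in>E. \<ominus> r2 (fst i) (snd i) c d) \<otimes> f b = \<zero>"
      by (rule S.conj_sum_0) (use ab cd False in \<open>auto simp: fg_mult S.if_mult S.l_minus S.r_minus\<close>)
    then show ?thesis using False by simp
  qed
  have "f a \<otimes> Z c d \<otimes> f b = f a \<otimes> (\<Oplus>p\<in>V. \<ominus> r1 p c d) \<otimes> f b \<oplus> f a \<otimes> (\<Oplus>i\<in>E. \<ominus> r2 (fst i) (snd i) c d) \<otimes> f b"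
    unfolding Z_def using ab cd by (subst S.r_distr, auto)  (subst S.l_distr, auto)
  then show ?thesis unfolding 1 2 .
qed

lemma frame: "frame S V E f g X Z"
proof
  show "finite V" by simp
  show "E \<subseteq> V \<times> V" using arc_verts by auto
  show "(a, a) \<notin> E" for a using neq by auto
  show "f b \<otimes> X a b = X a b" "X a b \<otimes> f a = X a b" if ab: "(a, b) \<in> E" for a b
    unfolding X_def using ab arc_verts[OF ab]
    by (subst S.r_distr S.l_distr; auto simp: S.finsum_absorb fg_mult S.l_minus S.r_minus)+
  show "g a \<otimes> Z a b = Z a b" "Z a b \<otimes> g b = Z a b" if ab: "(a, b) \<in> E" for a b
    unfolding Z_def using ab arc_verts[OF ab]
    by (subst S.r_distr S.l_distr; auto simp: S.finsum_absorb fg_mult S.l_minus S.r_minus)+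
qed (simp_all add: f_mult_g fg_sum X_corner Z_corner)

sublocale fr: frame S V E f g X Z by (rule frame)

lemma arrows:
  "(a, b) \<in> E \<Longrightarrow> (c, d) \<in> E \<Longrightarrow> fr.L2 a b c d = l2 a b c d"
  "(a, b) \<in> E \<Longrightarrow> (c, d) \<in> E \<Longrightarrow> fr.R2 a b c d = r2 a b c d"
  "(a, b) \<in> E \<Longrightarrow> q \<in> V \<Longrightarrow> fr.L1 a b q = l1 a b q"
  "(c, d) \<in> E \<Longrightarrow> p \<in> V \<Longrightarrow> fr.R1 p c d = r1 p c d"
  using neq arc_verts by (auto simp: fr.L2_def fr.R2_def fr.L1_def fr.R1_def X_corner Z_corner)

lemma h_sum_mult:
  assumes "\<And>i. i \<in> I \<Longrightarrow> s i \<in> carrier (path_alg (double D))" "\<And>i. i \<in> I \<Longrightarrow> t i \<in> carrier (path_alg (double D))"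
  shows "h (\<Sum>i\<in>I. s i \<bullet>\<^sub>p t i) = (\<Oplus>i\<in>I. h (s i) \<otimes> h (t i))"
proof -
  have "h (\<Sum>i\<in>I. s i \<bullet>\<^sub>p t i) = (\<Oplus>i\<in>I. h (s i \<bullet>\<^sub>p t i))"
    using assms by (intro h_sum mult_closed)
  also have "\<dots> = (\<Oplus>i\<in>I. h (s i) \<otimes> h (t i))"
    using assms by (intro S.finsum_cong') (auto simp: h_mult)
  finally show ?thesis .
qed

lemma sum_images:
  "(a, b) \<in> E \<Longrightarrow> (p, b) \<in> E \<Longrightarrow> h (\<Sum>i | (q, i) \<in> E. R2_elt D (a, b) (q, i) \<bullet>\<^sub>p L2_elt D (p, b) (q, i))
     = (\<Oplus>i\<in>{i. (q, i) \<in> E}. r2 a b q i \<otimes> l2 p b q i)"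
  "(a, b) \<in> E \<Longrightarrow> (p, b) \<in> E \<Longrightarrow> h (\<Sum>i | (q, i) \<in> E. R2_elt D (q, i) (a, b) \<bullet>\<^sub>p L2_elt D (q, i) (p, b))
     = (\<Oplus>i\<in>{i. (q, i) \<in> E}. r2 q i a b \<otimes> l2 q i p b)"
  "(d, a) \<in> E \<Longrightarrow> (d, p) \<in> E \<Longrightarrow> h (\<Sum>i | (i, q) \<in> E. L2_elt D (d, a) (i, q) \<bullet>\<^sub>p R2_elt D (d, p) (i, q))
     = (\<Oplus>i\<in>{i. (i, q) \<in> E}. l2 d a i q \<otimes> r2 d p i q)"
  "(d, a) \<in> E \<Longrightarrow> (d, p) \<in> E \<Longrightarrow> h (\<Sum>i | (i, q) \<in> E. L2_elt D (i, q) (d, a) \<bullet>\<^sub>p R2_elt D (i, q) (d, p))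
     = (\<Oplus>i\<in>{i. (i, q) \<in> E}. l2 i q d a \<otimes> r2 i q d p)"
  "(s, t) \<in> E \<Longrightarrow> h (\<Sum>i | (q, i) \<in> E. R2_elt D (q, i) (s, t) \<bullet>\<^sub>p L1_elt D (q, i) t)
     = (\<Oplus>i\<in>{i. (q, i) \<in> E}. r2 q i s t \<otimes> l1 q i t)"
  "(s, t) \<in> E \<Longrightarrow> h (\<Sum>i | (i, q) \<in> E. L2_elt D (s, t) (i, q) \<bullet>\<^sub>p R1_elt D s (i, q))
     = (\<Oplus>i\<in>{i. (i, q) \<in> E}. l2 s t i q \<otimes> r1 s i q)"
  unfolding r2_def l2_def r1_def l1_def
  by (subst h_sum_mult; auto simp: double_elt_closed arc_verts)+

lemma hx_frame: "hx_frame D S f g X Z"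
proof (intro hx_frame.intro hx_frame_axioms.intro pair_digraph_axioms S.alg_axioms frame)
  note defs = U_def[symmetric] l2_def[symmetric] r2_def[symmetric] l1_def[symmetric] r1_def[symmetric]
  note cong = S.finsum_cong'[OF refl]
  fix c d assume cd: "(c, d) \<in> E"
  have "fr.R1 q c d = (\<Oplus>i\<in>{i. (q, i) \<in> E}. fr.R2 q i c d \<otimes> fr.L1 q i d)" if q: "q \<in> V" for q
  proof -
    have "(\<Oplus>i\<in>{i. (q, i) \<in> E}. fr.R2 q i c d \<otimes> fr.L1 q i d) = (\<Oplus>i\<in>{i. (q, i) \<in> E}. r2 q i c d \<otimes> l1 q i d)"
      using cd q by (intro cong) (auto simp: arrows arc_verts)
    then show ?thesis
      using rel[OF dbl_rel.R1[OF q cd]] cd q arc_verts[OF cd]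
      by (simp add: sum_images defs arrows)
  qed
  moreover have "(\<Oplus>i\<in>{i. (q, i) \<in> E}. fr.R2 q i c d \<otimes> fr.L2 q i s d) = (if c = s then f q \<otimes> g c else \<zero>)"
    if q: "q \<in> V" and s: "(s, d) \<in> E" for q s
  proof -
    have "(\<Oplus>i\<in>{i. (q, i) \<in> E}. fr.R2 q i c d \<otimes> fr.L2 q i s d) = (\<Oplus>i\<in>{i. (q, i) \<in> E}. r2 q i c d \<otimes> l2 q i s d)"
      using cd q s by (intro cong) (auto simp: arrows arc_verts)
    then show ?thesis
      using rel[OF dbl_rel.RL_upper[OF q cd s]] cd q s arc_verts[OF cd] arc_verts[OF s] by (simp add: sum_images defs f_mult_g h_0 if_distrib[of h])
  qed
  ultimately show "fr.inv_rel c d" unfolding fr.inv_rel_iff[OF cd] by blast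
  have "(\<Oplus>i\<in>{i. (i, q) \<in> E}. fr.L2 i q c t \<otimes> fr.R2 i q c d) = (if t = d then f q \<otimes> g t else \<zero>)"
    if q: "q \<in> V" and t: "(c, t) \<in> E" for q t
  proof -
    have "(\<Oplus>i\<in>{i. (i, q) \<in> E}. fr.L2 i q c t \<otimes> fr.R2 i q c d) = (\<Oplus>i\<in>{i. (i, q) \<in> E}. l2 i q c t \<otimes> r2 i q c d)"
      using cd q t by (intro cong) (auto simp: arrows arc_verts)
    then show ?thesis
      using rel[OF dbl_rel.LR_upper[OF q t cd]] cd q t arc_verts[OF t] arc_verts[OF cd] by (simp add: sum_images defs f_mult_g h_0 if_distrib[of h])
  qed
  then show "fr.ev_rel c d" unfolding fr.ev_rel_iff[OF cd] by blast
  have "fr.L1 c d q = (\<Oplus>i\<in>{i. (i, q) \<in> E}. fr.L2 c d i q \<otimes> fr.R1 c i q)" if q: "q \<in> V" for q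
  proof -
    have "(\<Oplus>i\<in>{i. (i, q) \<in> E}. fr.L2 c d i q \<otimes> fr.R1 c i q) = (\<Oplus>i\<in>{i. (i, q) \<in> E}. l2 c d i q \<otimes> r1 c i q)"
      using cd q by (intro cong) (auto simp: arrows arc_verts)
    then show ?thesis
      using rel[OF dbl_rel.L1[OF q cd]] cd q arc_verts[OF cd] by (simp add: sum_images defs arrows)
  qed
  moreover have "(\<Oplus>i\<in>{i. (i, q) \<in> E}. fr.L2 c d i q \<otimes> fr.R2 c p i q) = (if d = p then f d \<otimes> g q else \<zero>)"
    if q: "q \<in> V" and p: "(c, p) \<in> E" for q p
  proof -
    have "(\<Oplus>i\<in>{i. (i, q) \<in> E}. fr.L2 c d i q \<otimes> fr.R2 c p i q) = (\<Oplus>i\<in>{i. (i, q) \<in> E}. l2 c d i q \<otimes> r2 c p i q)"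
      using cd q p by (intro cong) (auto simp: arrows arc_verts)
    then show ?thesis
      using rel[OF dbl_rel.LR_lower[OF q cd p]] cd q p arc_verts[OF cd] arc_verts[OF p] by (simp add: sum_images defs f_mult_g h_0 if_distrib[of h])
  qed
  ultimately show "fr.inv_rel' c d" unfolding fr.inv_rel'_iff[OF cd] by blast
  have "(\<Oplus>i\<in>{i. (q, i) \<in> E}. fr.R2 p d q i \<otimes> fr.L2 c d q i) = (if p = c then f p \<otimes> g q else \<zero>)"
    if q: "q \<in> V" and p: "(p, d) \<in> E" for q p
  proof -
    have "(\<Oplus>i\<in>{i. (q, i) \<in> E}. fr.R2 p d q i \<otimes> fr.L2 c d q i) = (\<Oplus>i\<in>{i. (q, i) \<in> E}. r2 p d q i \<otimes> l2 c d q i)"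
      using cd q p by (intro cong) (auto simp: arrows arc_verts)
    then show ?thesis
      using rel[OF dbl_rel.RL_lower[OF q p cd]] cd q p arc_verts[OF cd] arc_verts[OF p] by (simp add: sum_images defs f_mult_g h_0 if_distrib[of h])
  qed
  then show "fr.ev_rel' c d" unfolding fr.ev_rel'_iff[OF cd] by blast
qed

end

text \<open>
  The elements \<open>f p \<otimes> g q\<close> are orthogonal idempotents with sum \<open>\<one>\<close>, and the corners of \<open>X\<close> and \<open>Z\<close>
  have the sources and targets of the arrows. The relations of the double then hold by \<open>inv_rel_iff\<close>,
  \<open>ev_rel_iff\<close> and their primed versions, read from left to right; the lemma \<open>dbl_hom.hx_frame\<close> reads them from right to left.
\<close>

lemma (in hx_frame) path_lift:
  obtains h where "dbl_hom D S h"
    and "\<And>p q. p \<in> V \<Longrightarrow> q \<in> V \<Longrightarrow> h (u_elt p q) = f p \<otimes> g q"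
    and "\<And>a b c d. (a, b) \<in> E \<Longrightarrow> (c, d) \<in> E \<Longrightarrow> h (L2_elt D (a, b) (c, d)) = L2 a b c d"
    and "\<And>a b c d. (a, b) \<in> E \<Longrightarrow> (c, d) \<in> E \<Longrightarrow> h (R2_elt D (a, b) (c, d)) = R2 a b c d"
    and "\<And>a b q. (a, b) \<in> E \<Longrightarrow> q \<in> V \<Longrightarrow> h (L1_elt D (a, b) q) = L1 a b q"
    and "\<And>p c d. p \<in> V \<Longrightarrow> (c, d) \<in> E \<Longrightarrow> h (R1_elt D p (c, d)) = R1 p c d"
proof -
  define U where "U = (\<lambda>(p, q). f p \<otimes> g q)"
  define \<alpha> where "\<alpha> e = (case e of dbl_arrow.L2 a b c d \<Rightarrow> L2 a b c d | dbl_arrow.R2 a b c d \<Rightarrow> R2 a b c d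
    | dbl_arrow.L1 a b q \<Rightarrow> L1 a b q | dbl_arrow.R1 p c d \<Rightarrow> R1 p c d)" for e
  have arrow_cases: "(\<exists>a b c d. e = dbl_arrow.L2 a b c d \<and> (a, b) \<in> E \<and> (c, d) \<in> E) \<or>
     (\<exists>a b c d. e = dbl_arrow.R2 a b c d \<and> (a, b) \<in> E \<and> (c, d) \<in> E) \<or>
     (\<exists>a b q. e = dbl_arrow.L1 a b q \<and> (a, b) \<in> E \<and> q \<in> V) \<or>
     (\<exists>p c d. e = dbl_arrow.R1 p c d \<and> p \<in> V \<and> (c, d) \<in> E)" if "e \<in> arcs (double D)" for e
    using that by (auto simp: double_def)
  have ht: "head (double D) = dbl_head" "tail (double D) = dbl_tail" by (simp_all add: double_def)
  have X_gf: "X a b \<otimes> (g r \<otimes> f a) = X a b \<otimes> g r" if "(a, b) \<in> E" "r \<in> V" for a b r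
  proof -
    have "X a b \<otimes> (g r \<otimes> f a) = X a b \<otimes> f a \<otimes> g r" using that by (simp add: fg m_assoc E_verts)
    then show ?thesis using that by (simp add: X_right)
  qed
  obtain h where h: "h \<in> alg_hom (path_alg (double D)) S" "\<And>v. v \<in> verts (double D) \<Longrightarrow> h (vertex_idem v) = U v"
    "\<And>e. e \<in> arcs (double D) \<Longrightarrow> h (arrow_elt (double D) e) = \<alpha> e"
  proof (rule path_alg_lift[OF fin_digraph_double, of U \<alpha>])
    show "(\<Oplus>v\<in>verts (double D). U v) = \<one>"
      unfolding double_verts
    proof (rule eqI_corners[where I = V and u = f and w = g])
      fix p q assume pq: "p \<in> V" "q \<in> V"
      have "f p \<otimes> (\<Oplus>v\<in>V \<times> V. U v) \<otimes> g q = (\<Oplus>v\<in>V \<times> V. f p \<otimes> U v \<otimes> g q)"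
        using pq fin_V by (simp add: U_def finsum_rdistr finsum_ldistr Pi_def split_def)
      also have "\<dots> = (\<Oplus>v\<in>V \<times> V. if v = (p, q) then f p \<otimes> g q else \<zero>)"
        using pq by (intro finsum_cong') (auto simp: U_def normalize split: if_splits)
      also have "\<dots> = f p \<otimes> g q" using pq fin_V by (intro finsum_delta) auto
      finally show "f p \<otimes> (\<Oplus>v\<in>V \<times> V. U v) \<otimes> g q = f p \<otimes> \<one> \<otimes> g q" using pq by simp
    qed (use f_sum g_sum in \<open>auto simp: U_def split_def intro!: finsum_closed\<close>)
    show "U v \<in> carrier S" if "v \<in> verts (double D)" for v
      using that by (auto simp: U_def double_verts)
    show "U v \<otimes> U w = (if v = w then U v else \<zero>)" if "v \<in> verts (double D)" "w \<in> verts (double D)" for v w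
      using that by (auto simp: U_def double_verts normalize split: if_splits)
    show "\<alpha> e \<in> carrier S" "U (head (double D) e) \<otimes> \<alpha> e = \<alpha> e" "\<alpha> e \<otimes> U (tail (double D) e) = \<alpha> e"
      if "e \<in> arcs (double D)" for e
      using arrow_cases[OF that]
      by (auto simp: \<alpha>_def U_def ht L2_def R2_def L1_def R1_def normalize X_gf l_minus r_minus)
  qed blast
  interpret h: path_hom "double D" S h
    by (intro path_hom.intro path_hom_axioms.intro alg_morphism.intro alg_morphism_axioms.intro
       alg_path_alg fin_digraph_double alg_axioms h(1))
  have val: "p \<in> V \<Longrightarrow> q \<in> V \<Longrightarrow> h (u_elt p q) = f p \<otimes> g q"
    "(a, b) \<in> E \<Longrightarrow> (c, d) \<in> E \<Longrightarrow> h (L2_elt D (a, b) (c, d)) = L2 a b c d"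
    "(a, b) \<in> E \<Longrightarrow> (c, d) \<in> E \<Longrightarrow> h (R2_elt D (a, b) (c, d)) = R2 a b c d"
    "(a, b) \<in> E \<Longrightarrow> q \<in> V \<Longrightarrow> h (L1_elt D (a, b) q) = L1 a b q"
    "p \<in> V \<Longrightarrow> (c, d) \<in> E \<Longrightarrow> h (R1_elt D p (c, d)) = R1 p c d" for a b c d p q
    by (simp_all add: u_elt_def L2_elt_def R2_elt_def L1_elt_def R1_elt_def h(2,3) double_verts double_arcs U_def \<alpha>_def)
  note sum = h.h_sum h.h_mult h.mult_closed double_elt_closed
  have "h l = h r" if "dbl_rel D l r" for l r
    using that
  proof (cases rule: dbl_rel.cases)
    case (RL_lower q a b p)
    have "h l = (\<Oplus>i\<in>out q. R2 a b q i \<otimes> L2 p b q i)"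
      unfolding RL_lower(1) using RL_lower(4,5)
      by (subst h.h_sum) (auto intro!: finsum_cong' simp: sum val)
    also have "\<dots> = (if a = p then f a \<otimes> g q else \<zero>)"
      using ev'[OF RL_lower(5)] RL_lower(3,4) unfolding ev_rel'_iff[OF RL_lower(5)] by blast
    finally show ?thesis using RL_lower E_verts[OF RL_lower(4)] E_verts[OF RL_lower(5)] by (simp add: val h.h_0)
  next
    case (RL_upper q a b p)
    have "h l = (\<Oplus>i\<in>out q. R2 q i a b \<otimes> L2 q i p b)"
      unfolding RL_upper(1) using RL_upper(4,5)
      by (subst h.h_sum) (auto intro!: finsum_cong' simp: sum val)
    also have "\<dots> = (if a = p then f q \<otimes> g a else \<zero>)"
      using inv[OF RL_upper(4)] RL_upper(3,5) unfolding inv_rel_iff[OF RL_upper(4)] by blast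
    finally show ?thesis using RL_upper E_verts[OF RL_upper(4)] E_verts[OF RL_upper(5)] by (simp add: val h.h_0)
  next
    case (LR_lower q d a p)
    have "h l = (\<Oplus>i\<in>into q. L2 d a i q \<otimes> R2 d p i q)"
      unfolding LR_lower(1) using LR_lower(4,5)
      by (subst h.h_sum) (auto intro!: finsum_cong' simp: sum val)
    also have "\<dots> = (if a = p then f a \<otimes> g q else \<zero>)"
      using inv'[OF LR_lower(4)] LR_lower(3,5) unfolding inv_rel'_iff[OF LR_lower(4)] by blast
    finally show ?thesis using LR_lower E_verts[OF LR_lower(4)] E_verts[OF LR_lower(5)] by (simp add: val h.h_0)
  next
    case (LR_upper q d a p)
    have "h l = (\<Oplus>i\<in>into q. L2 i q d a \<otimes> R2 i q d p)"
      unfolding LR_upper(1) using LR_upper(4,5)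
      by (subst h.h_sum) (auto intro!: finsum_cong' simp: sum val)
    also have "\<dots> = (if a = p then f q \<otimes> g a else \<zero>)"
      using ev[OF LR_upper(5)] LR_upper(3,4) unfolding ev_rel_iff[OF LR_upper(5)] by blast
    finally show ?thesis using LR_upper E_verts[OF LR_upper(4)] E_verts[OF LR_upper(5)] by (simp add: val h.h_0)
  next
    case (R1 q s t)
    have "h r = (\<Oplus>i\<in>out q. R2 q i s t \<otimes> L1 q i t)"
      unfolding R1(2) using R1(4) E_verts[OF R1(4)]
      by (subst h.h_sum) (auto intro!: finsum_cong' simp: sum val)
    then show ?thesis
      using inv[OF R1(4)] R1(1,3,4) unfolding inv_rel_iff[OF R1(4)] by (simp add: val)
  next
    case (L1 q s t)
    have "h r = (\<Oplus>i\<in>into q. L2 s t i q \<otimes> R1 s i q)"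
      unfolding L1(2) using L1(4) E_verts[OF L1(4)]
      by (subst h.h_sum) (auto intro!: finsum_cong' simp: sum val)
    then show ?thesis
      using inv'[OF L1(4)] L1(1,3,4) unfolding inv_rel'_iff[OF L1(4)] by (simp add: val)
  qed
  then have "dbl_hom D S h"
    by (intro dbl_hom.intro dbl_hom_axioms.intro pair_digraph_axioms h.path_hom_axioms)
  then show ?thesis using that val by blast
qed

section \<open>The isomorphism\<close>

text \<open>
  Both algebras of the theorem are quotients of an algebra with a multiplicative basis by the differences \<open>l - r\<close>
  of a set of relations. The subtraction here is that of finitely supported functions.
\<close>

locale presentation =
  fixes B :: "'p set" and c U and rel :: "('p \<Rightarrow>\<^sub>0 'k::field) \<Rightarrow> ('p \<Rightarrow>\<^sub>0 'k) \<Rightarrow> bool"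
    and R I
  assumes R_def: "R = basis_alg B c U" and I_def: "I = genideal R {l - r | l r. rel l r}"
    and R: "ring R"
    and rel_closed: "\<And>l r. rel l r \<Longrightarrow> l \<in> carrier R" "\<And>l r. rel l r \<Longrightarrow> r \<in> carrier R"
begin

lemma alg_R: "alg R" using alg_basis_alg R unfolding R_def .

lemma diff: "x \<in> carrier R \<Longrightarrow> y \<in> carrier R \<Longrightarrow> x \<ominus>\<^bsub>R\<^esub> y = x - y"
  using basis_alg_diff R unfolding R_def by blast

lemma gens_closed: "{l - r | l r. rel l r} \<subseteq> carrier R"
proof -
  interpret ring R by (rule R)
  have "l - r \<in> carrier R" if "rel l r" for l r
    using diff[OF rel_closed[OF that]] minus_closed[OF rel_closed[OF that]] by simp
  then show ?thesis by blast
qed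

sublocale alg_ideal R I
proof (intro alg_ideal.intro alg_R)
  show "ideal I R" unfolding I_def by (intro ring.genideal_ideal R gens_closed)
qed

lemma cls_rel:
  assumes "rel l r"
  shows "I +>\<^bsub>R\<^esub> l = I +>\<^bsub>R\<^esub> r"
proof -
  have "l - r \<in> I" unfolding I_def using assms genideal_self[OF gens_closed] by blast
  then show ?thesis using rel_closed[OF assms] by (simp add: cls_eq_iff diff)
qed

lemma factor:
  assumes S: "alg S" and h: "h \<in> alg_hom R S" and resp: "\<And>l r. rel l r \<Longrightarrow> h l = h r"
  obtains h' where "h' \<in> alg_hom (quot_alg R I) S" "\<And>x. x \<in> carrier R \<Longrightarrow> h' (I +>\<^bsub>R\<^esub> x) = h x"
proof -
  interpret h: alg_morphism R S h by (intro alg_morphism.intro alg_morphism_axioms.intro alg_R S h)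
  have "h x = \<zero>\<^bsub>S\<^esub>" if mem: "x \<in> {l - r | l r. rel l r}" for x
  proof -
    obtain l r where x: "x = l - r" "rel l r" using mem by blast
    then have "h x = h l \<ominus>\<^bsub>S\<^esub> h r"
      using h.minus[of l r] rel_closed[OF x(2)] by (simp add: diff)
    then show ?thesis using resp[OF x(2)] rel_closed[OF x(2)] by (simp add: h.S.minus_eq h.S.r_neg)
  qed
  from quot_factor[OF alg_R S h gens_closed this] that show ?thesis unfolding I_def by blast
qed

end

context pair_digraph
begin

lemma dbl_presentation:
  "presentation {(u, p, v). pre_digraph.awalk (double G) u p v} path_comp
     ((\<lambda>v. (v, [], v)) ` verts (double G)) (dbl_rel G) (path_alg (double G)) (dbl_ideal G)"
  by (rule presentation.intro)
     (simp_all add: path_alg_def[symmetric] dbl_ideal_def dbl_rel_carrier ring_path_alg fin_digraph_double)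

lemma hx_presentation:
  "presentation (lists (hx_gens G)) (\<lambda>v w. Some (v @ w)) {[]} (hx_rel G) (free_alg (hx_gens G)) (hx_ideal G)"
  by (rule presentation.intro)
     (simp_all add: free_alg_def[symmetric] hx_ideal_def hx_rel_carrier ring_free_alg)

lemma dbl_cls_hom: "dbl_hom G (dbl_quot G) (dbl_cls G)"
proof -
  interpret P: presentation "{(u, p, v). pre_digraph.awalk (double G) u p v}" path_comp
     "(\<lambda>v. (v, [], v)) ` verts (double G)" "dbl_rel G" "path_alg (double G)" "dbl_ideal G"
    by (rule dbl_presentation)
  show ?thesis
    unfolding dbl_quot_def dbl_cls_def[abs_def]
    by (intro dbl_hom.intro dbl_hom_axioms.intro path_hom.intro path_hom_axioms.intro alg_morphism.intro
        alg_morphism_axioms.intro pair_digraph_axioms P.alg_R P.alg_Q P.cls_alg_hom P.cls_rel fin_digraph_double)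
qed

lemma hx_cls_hom: "hx_hom G (HX1 G) (hx_cls G)"
proof -
  interpret F: presentation "lists (hx_gens G)" "\<lambda>v w. Some (v @ w)" "{[]}" "hx_rel G"
     "free_alg (hx_gens G)" "hx_ideal G"
    by (rule hx_presentation)
  show ?thesis
    unfolding HX1_def hx_cls_def[abs_def]
    by (intro hx_hom.intro hx_hom_axioms.intro free_hom.intro alg_morphism.intro
        alg_morphism_axioms.intro pair_digraph_axioms F.alg_R F.alg_Q F.cls_alg_hom F.cls_rel)
qed

end

context hx_hom
begin

lemma hx_frame: "hx_frame D S f g X Z"
  by (intro hx_frame.intro hx_frame_axioms.intro pair_digraph_axioms S.alg_axioms frame
      inv_rel inv_rel' ev_rel ev_rel')

text \<open>
  The corners of the frame of a homomorphism from $H\mathfrak{X}^1$ are the elements by which the theorem describes the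
  images of the arrows.
\<close>

lemma arrows:
  "(a, b) \<in> parcs D \<Longrightarrow> (c, d) \<in> parcs D \<Longrightarrow>
     fr.L2 a b c d = h (- (hAbar (f_vec d) \<bullet> hX (e_vec b a) \<bullet> hAbar (f_vec c)))"
  "(a, b) \<in> parcs D \<Longrightarrow> (c, d) \<in> parcs D \<Longrightarrow>
     fr.R2 a b c d = h (hA (f_vec a) \<bullet> hXbar (e_vec d c) \<bullet> hA (f_vec b))"
  "(a, b) \<in> parcs D \<Longrightarrow> q \<in> pverts D \<Longrightarrow>
     fr.L1 a b q = h (hAbar (f_vec q) \<bullet> hX (e_vec b a) \<bullet> hAbar (f_vec q) - hA (f_vec b) \<bullet> hAbar (f_vec q))"
  "p \<in> pverts D \<Longrightarrow> (c, d) \<in> parcs D \<Longrightarrow>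
     fr.R1 p c d = h (hA (f_vec p) \<bullet> hXbar (e_vec d c) \<bullet> hA (f_vec p) + hA (f_vec p) \<bullet> hAbar (f_vec c))"
proof -
  note hs = h_mult h_add h_diff hx_gens_closed free_alg_closed f_def[symmetric] g_def[symmetric]
  show "fr.L2 a b c d = h (- (hAbar (f_vec d) \<bullet> hX (e_vec b a) \<bullet> hAbar (f_vec c)))"
    if "(a, b) \<in> parcs D" "(c, d) \<in> parcs D"
  proof -
    have "h (- y) = \<ominus> h y" if "y \<in> carrier (free_alg (hx_gens D))" for y
      using h_diff[of 0 y] that by (simp add: h_0 free_alg_zero_closed S.minus_eq)
    then show ?thesis
      using that XZ_corners(1)[of a b c d] arc_verts[OF that(2)] neq[OF that(2)]
      by (simp add: fr.L2_def hs)
  qed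
  show "fr.R2 a b c d = h (hA (f_vec a) \<bullet> hXbar (e_vec d c) \<bullet> hA (f_vec b))"
    if "(a, b) \<in> parcs D" "(c, d) \<in> parcs D"
    using that XZ_corners(2)[of c d a b] arc_verts[OF that(1)] neq[OF that(1)]
    by (simp add: fr.R2_def hs)
  show "fr.L1 a b q = h (hAbar (f_vec q) \<bullet> hX (e_vec b a) \<bullet> hAbar (f_vec q) - hA (f_vec b) \<bullet> hAbar (f_vec q))"
    if "(a, b) \<in> parcs D" "q \<in> pverts D"
  proof -
    have "g q \<otimes> f b \<otimes> g q = f b \<otimes> g q"
      using that arc_verts[OF that(1)] by (simp add: fr.normalize)
    then show ?thesis
      using that arc_verts[OF that(1)]
      by (simp add: fr.L1_def X_def hs S.minus_eq S.r_distr S.l_distr S.r_minus S.l_minus)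
  qed
  show "fr.R1 p c d = h (hA (f_vec p) \<bullet> hXbar (e_vec d c) \<bullet> hA (f_vec p) + hA (f_vec p) \<bullet> hAbar (f_vec c))"
    if "p \<in> pverts D" "(c, d) \<in> parcs D"
  proof -
    have "f p \<otimes> g c \<otimes> f p = f p \<otimes> g c"
      using that arc_verts[OF that(2)] by (simp add: fr.normalize)
    then show ?thesis
      using that arc_verts[OF that(2)]
      by (simp add: fr.R1_def Z_def hs S.minus_add S.r_distr S.l_distr S.r_minus S.l_minus)
  qed
qed

end

text \<open>
  The corners are given by ring expressions in the frame, so a homomorphism that matches two frames matches their corners.
\<close>

locale frame_morphism = A: frame A V E f g X Z + B: frame B V E f' g' X' Z' + ring_hom_ring A B h
  for A :: "('a, 'm) ring_scheme" and B :: "('b, 'n) ring_scheme" and V :: "'v set" and E f g X Z f' g' X' Z' h +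
  assumes map: "\<And>p. p \<in> V \<Longrightarrow> h (f p) = f' p" "\<And>p. p \<in> V \<Longrightarrow> h (g p) = g' p"
    "\<And>a b. (a, b) \<in> E \<Longrightarrow> h (X a b) = X' a b" "\<And>a b. (a, b) \<in> E \<Longrightarrow> h (Z a b) = Z' a b"
begin

lemma map_arrows:
  "(a, b) \<in> E \<Longrightarrow> (c, d) \<in> E \<Longrightarrow> h (A.L2 a b c d) = B.L2 a b c d"
  "(a, b) \<in> E \<Longrightarrow> (c, d) \<in> E \<Longrightarrow> h (A.R2 a b c d) = B.R2 a b c d"
  "(a, b) \<in> E \<Longrightarrow> q \<in> V \<Longrightarrow> h (A.L1 a b q) = B.L1 a b q"
  "p \<in> V \<Longrightarrow> (c, d) \<in> E \<Longrightarrow> h (A.R1 p c d) = B.R1 p c d"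
  by (simp_all add: A.L2_def A.R2_def A.L1_def A.R1_def B.L2_def B.R2_def B.L1_def B.R1_def
      A.E_verts map)

end

theorem theorem5p1:
  fixes D :: "'v pair_pre_digraph"
  assumes "pair_digraph D"
  shows "\<exists>\<phi> :: ('v, 'k::field) dbl_elt set \<Rightarrow> ('v, 'k) hx_elt set.
    \<phi> \<in> alg_iso (dbl_quot D) (HX1 D) \<and>
    (\<forall>p\<in>pverts D. \<forall>q\<in>pverts D.
       \<phi> (dbl_cls D (u_elt p q)) = hx_cls D (hA (f_vec p) \<bullet> hAbar (f_vec q))) \<and>
    (\<forall>a b c d. (a, b) \<in> parcs D \<longrightarrow> (c, d) \<in> parcs D \<longrightarrow>
       \<phi> (dbl_cls D (L2_elt D (a, b) (c, d)))
         = hx_cls D (- (hAbar (f_vec d) \<bullet> hX (e_vec b a) \<bullet> hAbar (f_vec c)))) \<and>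
    (\<forall>a b c d. (a, b) \<in> parcs D \<longrightarrow> (c, d) \<in> parcs D \<longrightarrow>
       \<phi> (dbl_cls D (R2_elt D (a, b) (c, d)))
         = hx_cls D (hA (f_vec a) \<bullet> hXbar (e_vec d c) \<bullet> hA (f_vec b))) \<and>
    (\<forall>a b q. (a, b) \<in> parcs D \<longrightarrow> q \<in> pverts D \<longrightarrow>
       \<phi> (dbl_cls D (L1_elt D (a, b) q))
         = hx_cls D (hAbar (f_vec q) \<bullet> hX (e_vec b a) \<bullet> hAbar (f_vec q)
                     - hA (f_vec b) \<bullet> hAbar (f_vec q))) \<and>
    (\<forall>p c d. p \<in> pverts D \<longrightarrow> (c, d) \<in> parcs D \<longrightarrow>
       \<phi> (dbl_cls D (R1_elt D p (c, d)))
         = hx_cls D (hA (f_vec p) \<bullet> hXbar (e_vec d c) \<bullet> hA (f_vec p)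
                     + hA (f_vec p) \<bullet> hAbar (f_vec c)))"
proof -
  interpret pair_digraph D by fact
  let ?P = "path_alg (double D) :: ('k, ('v \<times> 'v, 'v dbl_arrow) qpath \<Rightarrow>\<^sub>0 'k) module"
  let ?F = "free_alg (hx_gens D) :: ('k, ('v, 'k) hx_elt) module"
  let ?P' = "dbl_quot D :: ('k, ('v, 'k) dbl_elt set) module"
  let ?F' = "HX1 D :: ('k, ('v, 'k) hx_elt set) module"
  interpret P: presentation "{(u, p, v). pre_digraph.awalk (double D) u p v}" path_comp
     "(\<lambda>v. (v, [], v)) ` verts (double D)" "dbl_rel D" ?P "dbl_ideal D"
    by (rule dbl_presentation)
  interpret F: presentation "lists (hx_gens D)" "\<lambda>v w. Some (v @ w)" "{[]}" "hx_rel D" ?F "hx_ideal D"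
    by (rule hx_presentation)
  interpret A: hx_hom D ?F' "hx_cls D" by (rule hx_cls_hom)
  interpret B: dbl_hom D ?P' "dbl_cls D" by (rule dbl_cls_hom)
  interpret A': hx_frame D ?F' A.f A.g A.X A.Z by (rule A.hx_frame)
  interpret B': hx_frame D ?P' B.f B.g B.X B.Z by (rule B.hx_frame)

  \<comment> \<open>the frame of $H\mathfrak{X}^1$ gives a homomorphism from the path algebra\<close>
  obtain \<phi>0 where \<phi>0: "dbl_hom D ?F' \<phi>0"
    and \<phi>0_val: "\<And>p q. p \<in> pverts D \<Longrightarrow> q \<in> pverts D \<Longrightarrow> \<phi>0 (u_elt p q) = A.f p \<otimes>\<^bsub>?F'\<^esub> A.g q"
      "\<And>a b c d. (a, b) \<in> parcs D \<Longrightarrow> (c, d) \<in> parcs D \<Longrightarrow> \<phi>0 (L2_elt D (a, b) (c, d)) = A.fr.L2 a b c d"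
      "\<And>a b c d. (a, b) \<in> parcs D \<Longrightarrow> (c, d) \<in> parcs D \<Longrightarrow> \<phi>0 (R2_elt D (a, b) (c, d)) = A.fr.R2 a b c d"
      "\<And>a b q. (a, b) \<in> parcs D \<Longrightarrow> q \<in> pverts D \<Longrightarrow> \<phi>0 (L1_elt D (a, b) q) = A.fr.L1 a b q"
      "\<And>p c d. p \<in> pverts D \<Longrightarrow> (c, d) \<in> parcs D \<Longrightarrow> \<phi>0 (R1_elt D p (c, d)) = A.fr.R1 p c d"
    by (rule A'.path_lift) blast
  interpret \<phi>0: dbl_hom D ?F' \<phi>0 by (rule \<phi>0)
  obtain \<phi> where \<phi>: "\<phi> \<in> alg_hom ?P' ?F'" "\<And>x. x \<in> carrier ?P \<Longrightarrow> \<phi> (dbl_cls D x) = \<phi>0 x"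
    using P.factor[OF A.S.alg_axioms \<phi>0.hom \<phi>0.rel] unfolding dbl_quot_def dbl_cls_def by blast
  interpret \<phi>: alg_morphism ?P' ?F' \<phi>
    by (intro alg_morphism.intro alg_morphism_axioms.intro B.S.alg_axioms A.S.alg_axioms \<phi>(1))

  \<comment> \<open>the frame of the quotient of the path algebra gives a homomorphism from the free algebra\<close>
  obtain \<psi>0 where \<psi>0: "hx_hom D ?P' \<psi>0"
    and \<psi>0_val: "\<And>a. a \<in> fun_A D \<Longrightarrow> \<psi>0 (hA a) = B'.imA a" "\<And>a. a \<in> fun_A D \<Longrightarrow> \<psi>0 (hAbar a) = B'.imB a"
      "\<And>x. x \<in> vfields D \<Longrightarrow> \<psi>0 (hX x) = B'.imX x" "\<And>x. x \<in> vfields D \<Longrightarrow> \<psi>0 (hXbar x) = B'.imY x"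
    by (rule B'.lift) blast
  interpret \<psi>0: hx_hom D ?P' \<psi>0 by (rule \<psi>0)
  obtain \<psi> where \<psi>: "\<psi> \<in> alg_hom ?F' ?P'" "\<And>x. x \<in> carrier ?F \<Longrightarrow> \<psi> (hx_cls D x) = \<psi>0 x"
    using F.factor[OF B.S.alg_axioms \<psi>0.hom \<psi>0.rel] unfolding HX1_def hx_cls_def by blast
  interpret \<psi>: alg_morphism ?F' ?P' \<psi>
    by (intro alg_morphism.intro alg_morphism_axioms.intro B.S.alg_axioms A.S.alg_axioms \<psi>(1))

  have \<phi>_val: "p \<in> pverts D \<Longrightarrow> q \<in> pverts D \<Longrightarrow> \<phi> (B.U p q) = A.f p \<otimes>\<^bsub>?F'\<^esub> A.g q"
      "(a, b) \<in> parcs D \<Longrightarrow> (c, d) \<in> parcs D \<Longrightarrow> \<phi> (B.l2 a b c d) = A.fr.L2 a b c d"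
      "(a, b) \<in> parcs D \<Longrightarrow> (c, d) \<in> parcs D \<Longrightarrow> \<phi> (B.r2 a b c d) = A.fr.R2 a b c d"
      "(a, b) \<in> parcs D \<Longrightarrow> q \<in> pverts D \<Longrightarrow> \<phi> (B.l1 a b q) = A.fr.L1 a b q"
      "p \<in> pverts D \<Longrightarrow> (c, d) \<in> parcs D \<Longrightarrow> \<phi> (B.r1 p c d) = A.fr.R1 p c d" for a b c d p q
    by (simp_all add: B.U_def B.l2_def B.r2_def B.l1_def B.r1_def \<phi>(2) \<phi>0_val double_elt_closed)

  \<comment> \<open>\<open>\<psi>\<close> is defined on the generators by \<open>e\<close> and \<open>z\<close> of the target frame, so it matches
    \<open>X\<close> and \<open>Z\<close>, hence also their corners\<close>
  interpret \<psi>_frame: frame_morphism ?F' ?P' "pverts D" "parcs D" A.f A.g A.X A.Z B.f B.g B.X B.Z \<psi>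
  proof (intro frame_morphism.intro frame_morphism_axioms.intro A.frame B.frame \<psi>.ring_hom_ring_axioms)
    fix p assume p: "p \<in> pverts D"
    show f: "\<psi> (A.f p) = B.f p" and g: "\<psi> (A.g p) = B.g p"
      using p by (simp_all add: A.f_def A.g_def \<psi>(2) \<psi>0_val hx_gens_closed B'.im_basis basis_vec_coord)
  next
    fix a b assume ab: "(a, b) \<in> parcs D"
    note v = A.arc_verts[OF ab]
    have f: "\<psi> (A.f b) = B.f b" and g: "\<psi> (A.g a) = B.g a"
      using v by (simp_all add: A.f_def A.g_def \<psi>(2) \<psi>0_val hx_gens_closed B'.im_basis basis_vec_coord)
    have e: "\<psi> (hx_cls D (hX (e_vec b a))) = B.fr.e a b" "\<psi> (hx_cls D (hXbar (e_vec b a))) = \<ominus>\<^bsub>?P'\<^esub> B.fr.z a b"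
      using ab by (simp_all add: \<psi>(2) \<psi>0_val hx_gens_closed B'.im_basis basis_vec_coord)
    show "\<psi> (A.X a b) = B.X a b"
      using ab v by (simp add: A.X_def \<psi>.minus e f B.fr.e_def B.S.minus_eq B.S.a_assoc B.S.r_neg)
    show "\<psi> (A.Z a b) = B.Z a b"
      using ab v by (simp add: A.Z_def e g B.fr.z_def B.S.minus_add B.S.a_assoc B.S.r_neg)
  qed

  have \<psi>\<phi>0: "\<psi> (\<phi>0 x) = dbl_cls D x" if x: "x \<in> carrier ?P" for x
  proof -
    have "(\<psi> \<circ> \<phi>0) x = dbl_cls D x"
    proof (rule path_alg_hom_eqI[OF fin_digraph_double B.S.alg_axioms alg_hom_comp[OF \<phi>0.hom \<psi>.hom] B.hom _ _ x])
      fix v assume "v \<in> verts (double D)"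
      then obtain p q where v: "v = (p, q)" "p \<in> pverts D" "q \<in> pverts D" by (auto simp: double_verts)
      then show "(\<psi> \<circ> \<phi>0) (vertex_idem v) = dbl_cls D (vertex_idem v)"
        using \<phi>0_val(1)[of p q] B.U_def[of p q]
        by (simp add: u_elt_def \<psi>.mult \<psi>_frame.map B.f_mult_g)
    next
      fix e assume "e \<in> arcs (double D)"
      then consider a b c d where "e = dbl_arrow.L2 a b c d" "(a, b) \<in> parcs D" "(c, d) \<in> parcs D"
        | a b c d where "e = dbl_arrow.R2 a b c d" "(a, b) \<in> parcs D" "(c, d) \<in> parcs D"
        | a b q where "e = dbl_arrow.L1 a b q" "(a, b) \<in> parcs D" "q \<in> pverts D"
        | p c d where "e = dbl_arrow.R1 p c d" "p \<in> pverts D" "(c, d) \<in> parcs D"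
        by (auto simp: double_def)
      then show "(\<psi> \<circ> \<phi>0) (arrow_elt (double D) e) = dbl_cls D (arrow_elt (double D) e)"
      proof cases
        case (1 a b c d)
        then show ?thesis using \<phi>0_val(2)[of a b c d] B.arrows(1)[of a b c d] B.l2_def[of a b c d]
          by (simp add: L2_elt_def \<psi>_frame.map_arrows)
      next
        case (2 a b c d)
        then show ?thesis using \<phi>0_val(3)[of a b c d] B.arrows(2)[of a b c d] B.r2_def[of a b c d]
          by (simp add: R2_elt_def \<psi>_frame.map_arrows)
      next
        case (3 a b q)
        then show ?thesis using \<phi>0_val(4)[of a b q] B.arrows(3)[of a b q] B.l1_def[of a b q]
          by (simp add: L1_elt_def \<psi>_frame.map_arrows)
      next
        case (4 p c d)
        then show ?thesis using \<phi>0_val(5)[of p c d] B.arrows(4)[of c d p] B.r1_def[of p c d]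
          by (simp add: R1_elt_def \<psi>_frame.map_arrows)
      qed
    qed
    then show ?thesis by simp
  qed

  have \<phi>_f: "\<phi> (B.f p) = A.f p" "\<phi> (B.g p) = A.g p" if p: "p \<in> pverts D" for p
  proof -
    have "\<phi> (B.f p) = (\<Oplus>\<^bsub>?F'\<^esub>q\<in>pverts D. A.f p \<otimes>\<^bsub>?F'\<^esub> A.g q)"
      unfolding B.f_def using p by (intro \<phi>.finsum_image) (simp_all add: \<phi>_val)
    also have "\<dots> = A.f p" using p by (intro A.fr.resolve_g) simp
    finally show "\<phi> (B.f p) = A.f p" .
    have "\<phi> (B.g p) = (\<Oplus>\<^bsub>?F'\<^esub>q\<in>pverts D. A.f q \<otimes>\<^bsub>?F'\<^esub> A.g p)"
      unfolding B.g_def using p by (intro \<phi>.finsum_image) (simp_all add: \<phi>_val)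
    also have "\<dots> = A.g p" using p by (intro A.fr.resolve_f) simp
    finally show "\<phi> (B.g p) = A.g p" .
  qed
  \<comment> \<open>\<open>\<phi>\<close> is known on the corners only, which suffices since \<open>X\<close> and \<open>Z\<close> are the sums of their corners\<close>
  have \<phi>_X: "\<phi> (B.X a b) = A.X a b" "\<phi> (\<ominus>\<^bsub>?P'\<^esub> B.Z a b) = \<ominus>\<^bsub>?F'\<^esub> A.Z a b" if ab: "(a, b) \<in> parcs D" for a b
  proof -
    have "\<phi> (\<Oplus>\<^bsub>?P'\<^esub>q\<in>pverts D. B.fr.L1 a b q) = (\<Oplus>\<^bsub>?F'\<^esub>q\<in>pverts D. A.fr.L1 a b q)"
      "\<phi> (\<Oplus>\<^bsub>?P'\<^esub>i\<in>parcs D. B.fr.L2 a b (fst i) (snd i)) = (\<Oplus>\<^bsub>?F'\<^esub>i\<in>parcs D. A.fr.L2 a b (fst i) (snd i))"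
      "\<phi> (\<Oplus>\<^bsub>?P'\<^esub>p\<in>pverts D. B.fr.R1 p a b) = (\<Oplus>\<^bsub>?F'\<^esub>p\<in>pverts D. A.fr.R1 p a b)"
      "\<phi> (\<Oplus>\<^bsub>?P'\<^esub>i\<in>parcs D. B.fr.R2 (fst i) (snd i) a b) = (\<Oplus>\<^bsub>?F'\<^esub>i\<in>parcs D. A.fr.R2 (fst i) (snd i) a b)"
      using ab by (intro \<phi>.finsum_image; simp add: \<phi>_val B.arrows)+
    then show "\<phi> (B.X a b) = A.X a b" "\<phi> (\<ominus>\<^bsub>?P'\<^esub> B.Z a b) = \<ominus>\<^bsub>?F'\<^esub> A.Z a b"
      unfolding A.fr.X_decomp[OF ab] B.fr.X_decomp[OF ab] A.fr.Z_decomp[OF ab] B.fr.Z_decomp[OF ab]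
      using ab by (simp_all add: \<phi>.minus \<phi>.add Pi_def)
  qed
  have \<phi>\<psi>0: "\<phi> (\<psi>0 x) = hx_cls D x" if x: "x \<in> carrier ?F" for x
  proof -
    have "(\<phi> \<circ> \<psi>0) x = hx_cls D x"
    proof (rule free_alg_hom_eqI[OF A.S.alg_axioms alg_hom_comp[OF \<psi>0.hom \<phi>.hom] A.hom _ x])
      have comb: "\<phi> (B.S.comb I v a) = A.S.comb I v' a"
        if "\<And>i. i \<in> I \<Longrightarrow> v i \<in> carrier ?P'" "\<And>i. i \<in> I \<Longrightarrow> \<phi> (v i) = v' i"
        for I :: "'i set" and v v' a
        unfolding B.S.comb_def A.S.comb_def using that
        by (intro \<phi>.finsum_image) (simp_all add: \<phi>.smult)
      have e: "\<phi> (B.fr.e (fst i) (snd i)) = hx_cls D (hX (basis_vec i))"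
        "\<phi> (\<ominus>\<^bsub>?P'\<^esub> B.fr.z (fst i) (snd i)) = hx_cls D (hXbar (basis_vec i))" if "i \<in> parcs D" for i
      proof -
        obtain a b where i: "i = (a, b)" "(a, b) \<in> parcs D" using \<open>i \<in> parcs D\<close> by (cases i) auto
        note v = A.arc_verts[OF i(2)]
        show "\<phi> (B.fr.e (fst i) (snd i)) = hx_cls D (hX (basis_vec i))"
          using i v A.e_eq[OF i(2)] by (simp add: B.fr.e_def \<phi>.add \<phi>_f \<phi>_X A.fr.e_def)
        have "\<phi> (\<ominus>\<^bsub>?P'\<^esub> B.fr.z a b) = \<phi> (\<ominus>\<^bsub>?P'\<^esub> B.Z a b \<oplus>\<^bsub>?P'\<^esub> \<ominus>\<^bsub>?P'\<^esub> B.g a)"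
          using i v by (simp add: B.fr.z_def B.S.minus_add)
        also have "\<dots> = \<ominus>\<^bsub>?F'\<^esub> A.Z a b \<oplus>\<^bsub>?F'\<^esub> \<ominus>\<^bsub>?F'\<^esub> A.g a"
          using i v \<phi>_X(2)[OF i(2)] by (simp only: \<phi>.add \<phi>_f \<phi>.hom_a_inv B.S.a_inv_closed B.fgXZ_closed)
        also have "\<dots> = hx_cls D (hXbar (e_vec b a))"
          using i v A.z_eq[OF i(2)] by (simp add: A.fr.z_def A.S.minus_add)
        finally show "\<phi> (\<ominus>\<^bsub>?P'\<^esub> B.fr.z (fst i) (snd i)) = hx_cls D (hXbar (basis_vec i))" using i by simp
      qed
      fix y :: "('v, 'k) hx_gen" assume "y \<in> hx_gens D"
      then consider a where "y = GA a" "a \<in> fun_A D" | a where "y = GAbar a" "a \<in> fun_A D"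
        | v where "y = GX v" "v \<in> vfields D" | v where "y = GXbar v" "v \<in> vfields D"
        by (auto simp: hx_gens_def)
      then show "(\<phi> \<circ> \<psi>0) (free_gen y) = hx_cls D (free_gen y)"
      proof cases
        case (1 a)
        have "\<phi> (B'.imA a) = A.S.comb (pverts D) A.f a"
          unfolding B'.imA_def by (rule comb) (simp_all add: \<phi>_f)
        then show ?thesis using 1 A.expand(1)[of a] \<psi>0_val(1)[of a] by (simp add: hA_def A.S.comb_def)
      next
        case (2 a)
        have "\<phi> (B'.imB a) = A.S.comb (pverts D) A.g a"
          unfolding B'.imB_def by (rule comb) (simp_all add: \<phi>_f)
        then show ?thesis using 2 A.expand(2)[of a] \<psi>0_val(2)[of a] by (simp add: hAbar_def A.S.comb_def)
      next
        case (3 v)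
        have "\<phi> (B'.imX v) = A.S.comb (parcs D) (\<lambda>i. hx_cls D (hX (basis_vec i))) v"
          unfolding B'.imX_def by (rule comb[OF _ e(1)]) simp_all
        then show ?thesis using 3 A.expand(3)[of v] \<psi>0_val(3)[of v] by (simp add: hX_def A.S.comb_def)
      next
        case (4 v)
        have "\<phi> (B'.imY v) = A.S.comb (parcs D) (\<lambda>i. hx_cls D (hXbar (basis_vec i))) v"
          unfolding B'.imY_def by (rule comb[OF _ e(2)]) simp_all
        then show ?thesis using 4 A.expand(4)[of v] \<psi>0_val(4)[of v] by (simp add: hXbar_def A.S.comb_def)
      qed
    qed
    then show ?thesis by simp
  qed

  have "\<phi> \<in> alg_iso ?P' ?F'"
  proof (rule alg_isoI[OF \<phi>(1) \<psi>(1)])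
    fix y assume "y \<in> carrier ?P'"
    then obtain x where "x \<in> carrier ?P" "y = dbl_cls D x"
      using P.carrier_Q by (auto simp: dbl_quot_def dbl_cls_def)
    then show "\<psi> (\<phi> y) = y" by (simp add: \<phi>(2) \<psi>\<phi>0)
  next
    fix y assume "y \<in> carrier ?F'"
    then obtain x where "x \<in> carrier ?F" "y = hx_cls D x"
      using F.carrier_Q by (auto simp: HX1_def hx_cls_def)
    then show "\<phi> (\<psi> y) = y" by (simp add: \<psi>(2) \<phi>\<psi>0)
  qed
  moreover have "\<phi> (dbl_cls D (u_elt p q)) = hx_cls D (hA (f_vec p) \<bullet> hAbar (f_vec q))"
    if "p \<in> pverts D" "q \<in> pverts D" for p q
    using that by (simp add: \<phi>(2) \<phi>0_val double_elt_closed A.h_mult hx_gens_closed basis_vec_coord A.f_def A.g_def)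
  ultimately show ?thesis
    by (intro exI[of _ \<phi>]) (simp add: \<phi>(2) \<phi>0_val double_elt_closed A.arrows)
qed

end
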